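(* Let $\rho\in\mathbb{Z}_{\ge1}$ and $r>0$ be fixed, and consider the two-color competition dynamics on $\mathbb{Z}^2$ with red neighborhood $\mathcal{R}=\{x\in\mathbb{Z}^2:\|x\|_1\le\rho\}$, blue neighborhood $\mathcal{B}$ (a finite subset of $\mathbb{Z}\times\{0\}$), red update interval $r$, and initial densities $p$ of blue and $q$ of red. (1) If $e_1\in\mathcal{B}$ and $p,q$ are not both zero, then almost surely every site in $\mathbb{Z}^2$ is eventually nonempty. (2) Suppose $\mathcal{B}=([-\tau,\tau]\cap\mathbb{Z})\times\{0\}$ with $\tau\in\mathbb{Z}_{\ge1}$, and $q=a\,p^{1+\rho/(\rho+1)}$. Then for every $a>0$, $$\limsup_{p\to0}\mathbb{P}(0\text{ is eventually blue})<1,$$ and this $\limsup$ tends to $0$ as $a\to\infty$. (3) Suppose $\mathcal{B}=\{e_1\}$ and $q=a\,p^{1+\rho/(\rho+1)}$. Then for every $a>0$, $$\liminf_{p\to0}\mathbb{P}(0\text{ is eventually blue})>0,$$ and this $\liminf$ tends to $1$ as $a\to0$.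
   Context: Here $e_1=(1,0)$. Two-color competition dynamics on $\mathbb{Z}^2$: initially each vertex of $\mathbb{Z}^2$ is independently blue with probability $p$, red with probability $q$, and empty with probability $1-p-q$. Let $\mathcal{B}\subset\mathbb{Z}\times\{0\}$ and $\mathcal{R}\subset\mathbb{Z}^2$ be finite sets and $r>0$. At times $t\in\{1,2,3,\dots\}$, every empty vertex $x$ that has a blue vertex in $x+\mathcal{B}$ becomes blue. At times $t\in\{r,2r,3r,\dots\}$, every empty vertex $x$ that has a red vertex in $x+\mathcal{R}$ becomes red. If a vertex is due to become both blue and red at the same time, its color is decided by an independent fair coin flip. Colored vertices never change color again. Hence every vertex changes state at most once and has a final state; "eventually blue" means the final state is blue and "eventually nonempty" means the final state is blue or red. *)

theory Defs
  imports "HOL-Probability.Probability"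
begin

type_synonym site = "int \<times> int"

datatype state = Empty | Blue | Red

definition blue_times :: "real set" where
  "blue_times = {real k | k. 1 \<le> k}"

definition red_times :: "real \<Rightarrow> real set" where
  "red_times r = {real k * r | k. 1 \<le> k}"

definition next_time :: "real \<Rightarrow> real \<Rightarrow> real" where
  "next_time r t = (LEAST s. s \<in> blue_times \<union> red_times r \<and> t < s)"

text \<open>The \<open>n\<close>-th element, in increasing order, of the set of all update times, with
  \<open>update_time r 0 = 0\<close> standing for the initial time.  The lemmas below show that the
  \<open>LEAST\<close> is attained and that every update time is reached.\<close>

primrec update_time :: "real \<Rightarrow> nat \<Rightarrow> real" where
  "update_time r 0 = 0"
| "update_time r (Suc n) = next_time r (update_time r n)"

lemma finite_update_times_le:
  assumes "r > 0"
  shows "finite {s \<in> blue_times \<union> red_times r. s \<le> u}"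
proof -
  have "{s \<in> blue_times. s \<le> u} \<subseteq> real ` {..nat \<lfloor>u\<rfloor>}"
    by (auto simp: blue_times_def le_nat_floor)
  moreover have "{s \<in> red_times r. s \<le> u} \<subseteq> (\<lambda>k. real k * r) ` {..nat \<lfloor>u / r\<rfloor>}"
    using assms by (auto simp: red_times_def le_nat_floor pos_le_divide_eq)
  ultimately have "finite ({s \<in> blue_times. s \<le> u} \<union> {s \<in> red_times r. s \<le> u})"
    by (meson finite_Un finite_atMost finite_imageI finite_subset)
  then show ?thesis
    by (rule rev_finite_subset) auto
qed

lemma next_time:
  assumes "r > 0"
  shows "next_time r t \<in> blue_times \<union> red_times r" "t < next_time r t"
    "s \<in> blue_times \<union> red_times r \<Longrightarrow> t < s \<Longrightarrow> next_time r t \<le> s"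
proof -
  obtain k :: nat where k: "t < real k"
    using reals_Archimedean2 by blast
  define u where "u = real (Suc k)"
  have "u \<in> blue_times"
    unfolding u_def blue_times_def by (rule CollectI, rule exI[of _ "Suc k"]) simp
  moreover have "t < u"
    using k by (simp add: u_def)
  ultimately have u: "u \<in> blue_times" "t < u" .
  define A where "A = {s \<in> blue_times \<union> red_times r. s \<le> u \<and> t < s}"
  have A: "finite A" "A \<noteq> {}"
    using u finite_subset[OF _ finite_update_times_le[OF assms, of u], of A]
    by (auto simp: A_def)
  have le: "Min A \<le> s" if "s \<in> blue_times \<union> red_times r" "t < s" for s
  proof (cases "s \<le> u")
    case True
    then show ?thesis using that A by (auto simp: A_def intro!: Min_le)
  next
    case False
    have "Min A \<le> u" using u A by (auto simp: A_def intro!: Min_le)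
    then show ?thesis using False by linarith
  qed
  have mem: "Min A \<in> blue_times \<union> red_times r" "t < Min A"
    using Min_in[OF A] by (auto simp: A_def)
  have "next_time r t = Min A"
    unfolding next_time_def by (rule Least_equality) (use mem le in blast)+
  then show "next_time r t \<in> blue_times \<union> red_times r" "t < next_time r t"
    "s \<in> blue_times \<union> red_times r \<Longrightarrow> t < s \<Longrightarrow> next_time r t \<le> s"
    using mem le by simp_all
qed

lemma strict_mono_update_time: "r > 0 \<Longrightarrow> strict_mono (update_time r)"
  by (simp add: strict_mono_Suc_iff next_time(2))

lemma range_update_time:
  assumes "r > 0"
  shows "range (update_time r) = insert 0 (blue_times \<union> red_times r)"
proof
  show "range (update_time r) \<subseteq> insert 0 (blue_times \<union> red_times r)"
  proof (rule image_subsetI)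
    fix n show "update_time r n \<in> insert 0 (blue_times \<union> red_times r)"
      using next_time(1)[OF assms] by (cases n) simp_all
  qed
next
  have "s \<in> range (update_time r)" if s: "s \<in> blue_times \<union> red_times r" for s
  proof (rule ccontr)
    assume ns: "s \<notin> range (update_time r)"
    have "s > 0"
      using s assms by (auto simp: blue_times_def red_times_def)
    have less: "update_time r n < s" for n
    proof (induction n)
      case (Suc n)
      then have "update_time r (Suc n) \<le> s"
        using next_time(3)[OF assms s] by simp
      then show ?case using ns by (metis order_le_less rangeI)
    qed (use \<open>s > 0\<close> in simp)
    have "update_time r (Suc n) \<in> {s' \<in> blue_times \<union> red_times r. s' \<le> s}" for n
      using next_time(1)[OF assms] less[of "Suc n"] by auto
    then have "range (\<lambda>n. update_time r (Suc n)) \<subseteq> {s' \<in> blue_times \<union> red_times r. s' \<le> s}"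
      by blast
    then have "finite (range (\<lambda>n. update_time r (Suc n)))"
      using finite_update_times_le[OF assms] finite_subset by blast
    moreover have "inj (\<lambda>n. update_time r (Suc n))"
      by (rule injI) (use strict_mono_eq[OF strict_mono_update_time[OF assms]] in blast)
    ultimately show False
      using finite_imageD infinite_UNIV_nat by blast
  qed
  moreover have "0 \<in> range (update_time r)"
    by (rule range_eqI[of _ _ 0]) simp
  ultimately show "insert 0 (blue_times \<union> red_times r) \<subseteq> range (update_time r)"
    by blast
qed

text \<open>Each site carries its initial state and one coin (\<open>True\<close> means blue).  One coin per
  site is enough, since a site changes state at most once.\<close>

type_synonym sample = "site \<Rightarrow> state \<times> bool"

definition update ::
  "site set \<Rightarrow> site set \<Rightarrow> real \<Rightarrow> sample \<Rightarrow> real \<Rightarrow> (site \<Rightarrow> state) \<Rightarrow> site \<Rightarrow> state" where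
  "update B R r \<omega> t \<sigma> x =
    (let blue_due = (t \<in> blue_times \<and> (\<exists>b\<in>B. \<sigma> (x + b) = Blue));
         red_due = (t \<in> red_times r \<and> (\<exists>b\<in>R. \<sigma> (x + b) = Red))
     in if \<sigma> x \<noteq> Empty then \<sigma> x
        else if blue_due \<and> red_due then (if snd (\<omega> x) then Blue else Red)
        else if blue_due then Blue
        else if red_due then Red
        else Empty)"

text \<open>The configuration just after the \<open>n\<close>-th update time.\<close>

primrec config :: "site set \<Rightarrow> site set \<Rightarrow> real \<Rightarrow> sample \<Rightarrow> nat \<Rightarrow> site \<Rightarrow> state" where
  "config B R r \<omega> 0 = (\<lambda>x. fst (\<omega> x))"
| "config B R r \<omega> (Suc n) = update B R r \<omega> (update_time r (Suc n)) (config B R r \<omega> n)"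

definition final_state :: "site set \<Rightarrow> site set \<Rightarrow> real \<Rightarrow> sample \<Rightarrow> site \<Rightarrow> state" where
  "final_state B R r \<omega> x = (THE s. \<forall>\<^sub>F n in sequentially. config B R r \<omega> n x = s)"

lemma config_mono:
  assumes "config B R r \<omega> n x \<noteq> Empty" "n \<le> m"
  shows "config B R r \<omega> m x = config B R r \<omega> n x"
  using assms(2)
proof (induction m rule: dec_induct)
  case (step m)
  then show ?case using assms(1) by (simp add: update_def)
qed simp

lemma eventually_final_state:
  "\<forall>\<^sub>F n in sequentially. config B R r \<omega> n x = final_state B R r \<omega> x"
proof -
  obtain s where s: "\<forall>\<^sub>F n in sequentially. config B R r \<omega> n x = s"
  proof (cases "\<exists>n. config B R r \<omega> n x \<noteq> Empty")
    case True
    then obtain n where "config B R r \<omega> n x \<noteq> Empty" by blast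
    then have "\<forall>\<^sub>F m in sequentially. config B R r \<omega> m x = config B R r \<omega> n x"
      unfolding eventually_sequentially by (intro exI[of _ n] allI impI config_mono)
    then show ?thesis by (rule that)
  next
    case False
    then show ?thesis by (intro that[of Empty]) simp
  qed
  have "s' = s" if "\<forall>\<^sub>F n in sequentially. config B R r \<omega> n x = s'" for s'
  proof -
    have "\<forall>\<^sub>F n in sequentially. s' = s"
      using that s by eventually_elim simp
    then show ?thesis by simp
  qed
  then have "final_state B R r \<omega> x = s"
    unfolding final_state_def using s by (intro the_equality)
  then show ?thesis using s by simp
qed

text \<open>Meaningful for \<open>0 \<le> p\<close>, \<open>0 \<le> q\<close> and \<open>p + q \<le> 1\<close> only.\<close>

definition initial_pmf :: "real \<Rightarrow> real \<Rightarrow> state pmf" where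
  "initial_pmf p q = pmf_of_list [(Blue, p), (Red, q), (Empty, 1 - p - q)]"

lemma pmf_initial_pmf:
  assumes "0 \<le> p" "0 \<le> q" "p + q \<le> 1"
  shows "pmf (initial_pmf p q) Blue = p" "pmf (initial_pmf p q) Red = q"
    "pmf (initial_pmf p q) Empty = 1 - p - q"
proof -
  have "pmf_of_list_wf [(Blue, p), (Red, q), (Empty, 1 - p - q)]"
    using assms by (intro pmf_of_list_wfI) auto
  then show "pmf (initial_pmf p q) Blue = p" "pmf (initial_pmf p q) Red = q"
    "pmf (initial_pmf p q) Empty = 1 - p - q"
    by (simp_all add: initial_pmf_def pmf_pmf_of_list)
qed

definition sample_measure :: "real \<Rightarrow> real \<Rightarrow> sample measure" where
  "sample_measure p q =
    (\<Pi>\<^sub>M x\<in>UNIV. measure_pmf (pair_pmf (initial_pmf p q) (bernoulli_pmf (1 / 2))))"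

definition blue_prob :: "site set \<Rightarrow> site set \<Rightarrow> real \<Rightarrow> real \<Rightarrow> real \<Rightarrow> real" where
  "blue_prob B R r p q =
    measure (sample_measure p q) {\<omega>. final_state B R r \<omega> (0, 0) = Blue}"

lemma space_sample_measure: "space (sample_measure p q) = UNIV"
  by (simp add: sample_measure_def space_PiM)

text \<open>The set in \<open>blue_prob\<close> is an event, so its measure is not the default value.\<close>

lemma measurable_config [measurable]:
  "(\<lambda>\<omega>. config B R r \<omega> n x) \<in> sample_measure p q \<rightarrow>\<^sub>M count_space UNIV"
proof -
  have coord: "(\<lambda>\<omega>. \<omega> x) \<in> sample_measure p q \<rightarrow>\<^sub>M count_space UNIV" for x
  proof -
    have "(\<lambda>\<omega>. \<omega> x) \<in> sample_measure p q \<rightarrow>\<^sub>M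
        measure_pmf (pair_pmf (initial_pmf p q) (bernoulli_pmf (1 / 2)))"
      unfolding sample_measure_def by (rule measurable_component_singleton) simp
    then show ?thesis by simp
  qed
  have comp: "(\<lambda>\<omega>. fst (\<omega> x)) \<in> sample_measure p q \<rightarrow>\<^sub>M count_space UNIV"
    "(\<lambda>\<omega>. snd (\<omega> x)) \<in> sample_measure p q \<rightarrow>\<^sub>M count_space UNIV" for x
    using measurable_compose[OF coord, of fst] measurable_compose[OF coord, of snd]
    by simp_all
  show ?thesis
  proof (induction n arbitrary: x)
    case (Suc n)
    have eq: "Measurable.pred (sample_measure p q) (\<lambda>\<omega>. config B R r \<omega> n y = c)" for y c
      using measurable_compose[OF Suc, of "\<lambda>s. s = c" "count_space UNIV"] by simp
    have "Measurable.pred (sample_measure p q) (\<lambda>\<omega>. \<exists>b\<in>C. config B R r \<omega> n (x + b) = c)" for C c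
      by (rule pred_intros_countable_bounded(4)) (rule eq)
    then have ex: "Measurable.pred (sample_measure p q)
        (\<lambda>\<omega>. t \<and> (\<exists>b\<in>C. config B R r \<omega> n (x + b) = c))" for t C c
      by (cases t) simp_all
    have neq: "Measurable.pred (sample_measure p q) (\<lambda>\<omega>. config B R r \<omega> n x \<noteq> Empty)"
      using eq by (rule pred_intros_logic(2))
    show ?case
      unfolding config.simps update_def Let_def
      by (intro measurable_If[OF _ _ predE] measurable_const Suc neq ex comp(2)
          pred_intros_logic(3)[OF ex ex]) simp_all
  qed (simp add: comp(1))
qed

lemma sets_final_state:
  "{\<omega>. final_state B R r \<omega> x = s} \<in> sets (sample_measure p q)"
proof -
  have "final_state B R r \<omega> x = s \<longleftrightarrow> (\<exists>N. \<forall>n\<ge>N. config B R r \<omega> n x = s)" for \<omega>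
  proof
    assume "final_state B R r \<omega> x = s"
    then show "\<exists>N. \<forall>n\<ge>N. config B R r \<omega> n x = s"
      using eventually_final_state[of B R r \<omega> x] by (simp add: eventually_sequentially)
  next
    assume "\<exists>N. \<forall>n\<ge>N. config B R r \<omega> n x = s"
    then have "\<forall>\<^sub>F n in sequentially. config B R r \<omega> n x = s"
      by (simp add: eventually_sequentially)
    then have "\<forall>\<^sub>F n in sequentially. final_state B R r \<omega> x = s"
      using eventually_final_state[of B R r \<omega> x] by eventually_elim simp
    then show "final_state B R r \<omega> x = s" by simp
  qed
  then have "{\<omega>. final_state B R r \<omega> x = s} =
      {\<omega> \<in> space (sample_measure p q). \<exists>N. \<forall>n\<ge>N. config B R r \<omega> n x = s}"
    by (simp add: space_sample_measure)
  also have "\<dots> \<in> sets (sample_measure p q)" by measurable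
  finally show ?thesis .
qed

definition l1_ball :: "nat \<Rightarrow> site set" where
  "l1_ball \<rho> = {x. \<bar>fst x\<bar> + \<bar>snd x\<bar> \<le> int \<rho>}"

end

theory Submission imports Defs "HOL-Real_Asymp.Real_Asymp" begin

text \<open>Blue travels only along rows, so rows interact through red alone, and red steps over at most
  \<open>\<rho> - 1\<close> rows at a time: red is stopped vertically exactly by \<open>\<rho>\<close> consecutive blue rows. Within time
  and horizontal distance \<open>t\<close> a row is blue with probability about \<open>p * t\<close>, so a red seed typically
  meets its first barrier at height \<open>t\<close> when \<open>t * (p * t) ^ \<rho> = 1\<close>, that is, at the height scale
  \<open>h = p powr (- \<rho> / (\<rho> + 1))\<close>. Blue decides the row of the origin after a time of order \<open>1 / p\<close>, and
  \<open>q = a * p / h\<close> is the density at which a box of width \<open>1 / p\<close> and height \<open>h\<close> contains about \<open>a\<close> red seeds.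

  For (2), take the first red seed, in a fixed enumeration, of a box of size \<open>c / p\<close> by \<open>K * h\<close> with small \<open>c\<close>
  and \<open>K\<close>. With probability close to one no \<open>\<rho>\<close> consecutive rows below it and no site near the origin in
  row \<open>0\<close> are blue early on, and then red runs down to row \<open>0\<close> and along it to the origin.

  For (3), suppose that a box of size \<open>C / p\<close> by \<open>K * h\<close> has no red seed. Red must
  then enter it from above or below. At the times \<open>4 * w\<close>, with \<open>w = K * h * g ^ i\<close> growing geometrically, red
  is shown to be confined to heights above a level that decreases with \<open>i\<close> but stays nonnegative.
  In one such time step red cannot leave a window of columns of width \<open>w\<close>, so it suffices that every window has a
  barrier in the strip between consecutive levels; as no red has reached the strip, blue has developed there
  undisturbed. A barrier is needed only in windows with a red seed within reach. There are about
  \<open>1 / (p * w)\<close> windows, each has such a seed with probability of order \<open>q * w\<^sup>2\<close>, and, independently,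
  no barrier with a probability that is superpolynomially small in \<open>K * g ^ i\<close>. The sum over all scales is
  therefore small.\<close>

subsection \<open>Finite-range events of the product measure\<close>

abbreviation Pr :: "real \<Rightarrow> real \<Rightarrow> (sample \<Rightarrow> bool) \<Rightarrow> real" where
  "Pr p q P \<equiv> measure (sample_measure p q) {\<omega>. P \<omega>}"

text \<open>Finite-range events are kept as predicates together with a set of sites that they depend
  on. Finite sets give measurability, and disjoint finite sets give independence.\<close>

definition determined_by :: "site set \<Rightarrow> (sample \<Rightarrow> bool) \<Rightarrow> bool" where
  "determined_by K P \<longleftrightarrow> (\<forall>\<omega> \<omega>'. (\<forall>z\<in>K. \<omega> z = \<omega>' z) \<longrightarrow> P \<omega> = P \<omega>')"

lemma determined_byI:
  "(\<And>\<omega> \<omega>'. (\<And>z. z \<in> K \<Longrightarrow> \<omega> z = \<omega>' z) \<Longrightarrow> P \<omega> = P \<omega>') \<Longrightarrow> determined_by K P"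
  unfolding determined_by_def by blast

lemma determined_by_site: "determined_by {z} (\<lambda>\<omega>. Q (\<omega> z))"
  by (auto simp: determined_by_def)

lemma determined_by_ball:
  "(\<And>i. i \<in> I \<Longrightarrow> determined_by (K i) (P i)) \<Longrightarrow>
    determined_by (\<Union>i\<in>I. K i) (\<lambda>\<omega>. \<forall>i\<in>I. P i \<omega>)"
  unfolding determined_by_def by (metis (no_types, lifting) UN_I)

lemma determined_by_not: "determined_by K P \<Longrightarrow> determined_by K (\<lambda>\<omega>. \<not> P \<omega>)"
  by (auto simp: determined_by_def)

lemma determined_by_conj:
  "determined_by K P \<Longrightarrow> determined_by L Q \<Longrightarrow> determined_by (K \<union> L) (\<lambda>\<omega>. P \<omega> \<and> Q \<omega>)"
  unfolding determined_by_def by (metis UnCI)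

lemma prob_space_sample_measure: "prob_space (sample_measure p q)"
  unfolding sample_measure_def by (intro prob_space_PiM prob_space_measure_pmf)

interpretation sample: prob_space "sample_measure p q" for p q
  by (rule prob_space_sample_measure)

interpretation sample_product: product_prob_space
  "\<lambda>_. measure_pmf (pair_pmf (initial_pmf p q) (bernoulli_pmf (1 / 2)))" UNIV for p q
  by unfold_locales

lemma determined_by_restrict: "determined_by K P \<Longrightarrow> P (restrict \<omega> K) = P \<omega>"
  by (auto simp: determined_by_def)

lemma measurable_coordinate:
  "(\<lambda>\<omega>. \<omega> z) \<in> sample_measure p q \<rightarrow>\<^sub>M count_space UNIV"
proof -
  have "(\<lambda>\<omega>. \<omega> z) \<in> sample_measure p q \<rightarrow>\<^sub>M
      measure_pmf (pair_pmf (initial_pmf p q) (bernoulli_pmf (1 / 2)))"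
    unfolding sample_measure_def by (rule measurable_component_singleton) simp
  then show ?thesis by simp
qed

lemma UNIV_state: "UNIV = {Empty, Blue, Red}"
  using state.exhaust by auto

text \<open>The values at one site form a finite, hence countable, type, so a finite product of
  these discrete spaces is again discrete.\<close>

lemma sets_PiM_coordinates:
  fixes K :: "site set"
  assumes "finite K" and "A \<subseteq> extensional K"
  shows "A \<in> sets (PiM K (\<lambda>_. count_space (UNIV :: (state \<times> bool) set)))"
proof -
  have "finite (UNIV :: (state \<times> bool) set)"
    unfolding UNIV_Times_UNIV[symmetric] UNIV_state by simp
  then have "countable (UNIV :: (state \<times> bool) set)"
    by (rule countable_finite)
  then show ?thesis
    using assms by (simp add: count_space_PiM_finite PiE_def)
qed

lemma sets_determined_by:
  assumes "determined_by K P" and "finite K"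
  shows "{\<omega>. P \<omega>} \<in> sets (sample_measure p q)"
proof -
  let ?A = "{\<omega> \<in> extensional K. P \<omega>}"
  have "(\<lambda>\<omega>. restrict \<omega> K) \<in> sample_measure p q \<rightarrow>\<^sub>M PiM K (\<lambda>_. count_space UNIV)"
    by (intro measurable_restrict measurable_coordinate)
  then have "(\<lambda>\<omega>. restrict \<omega> K) -` ?A \<inter> space (sample_measure p q) \<in> sets (sample_measure p q)"
    by (rule measurable_sets) (use assms sets_PiM_coordinates in auto)
  also have "(\<lambda>\<omega>. restrict \<omega> K) -` ?A \<inter> space (sample_measure p q) = {\<omega>. P \<omega>}"
    using determined_by_restrict[OF assms(1)] by (auto simp: space_sample_measure)
  finally show ?thesis .
qed

lemma Pr_mono:
  assumes "\<And>\<omega>. P \<omega> \<Longrightarrow> Q \<omega>" and "determined_by L Q" "finite L"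
  shows "Pr p q P \<le> Pr p q Q"
  using assms by (intro sample.finite_measure_mono sets_determined_by) auto

lemma indep_coordinates:
  "sample.indep_vars p q (\<lambda>_. count_space UNIV) (\<lambda>z \<omega>. \<omega> z) (UNIV :: site set)"
proof -
  let ?N = "measure_pmf (pair_pmf (initial_pmf p q) (bernoulli_pmf (1 / 2)))"
  have sets_eq: "sets (PiM (UNIV::site set) (\<lambda>_. count_space UNIV)) = sets (sample_measure p q)"
    unfolding sample_measure_def by (rule sets_PiM_cong) simp_all
  have comp: "distr (sample_measure p q) (count_space UNIV) (\<lambda>\<omega>. \<omega> z) = ?N" for z :: site
  proof -
    have "distr (sample_measure p q) ?N (\<lambda>\<omega>. \<omega> z) = ?N"
      unfolding sample_measure_def by (rule sample_product.PiM_component) simp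
    moreover have "distr (sample_measure p q) (count_space UNIV) (\<lambda>\<omega>. \<omega> z)
        = distr (sample_measure p q) ?N (\<lambda>\<omega>. \<omega> z)"
      by (rule distr_cong) simp_all
    ultimately show ?thesis
      by simp
  qed
  show ?thesis
  proof (subst sample.indep_vars_iff_distr_eq_PiM')
    show "distr (sample_measure p q) (Pi\<^sub>M UNIV (\<lambda>_. count_space UNIV)) (\<lambda>x. \<lambda>i\<in>UNIV. x i) =
       Pi\<^sub>M UNIV (\<lambda>i. distr (sample_measure p q) (count_space UNIV) (\<lambda>\<omega>. \<omega> i))"
      unfolding comp restrict_UNIV
      unfolding distr_id2[OF sets_eq] by (simp only: sample_measure_def)
  qed (auto simp: measurable_coordinate)
qed

text \<open>The coordinates are independent, hence so are their restrictions to disjoint blocks, and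
  each \<open>P j\<close> is the preimage of a set of extensional functions under the restriction to
  \<open>K j\<close>.\<close>

lemma Pr_independent:
  assumes J: "finite J" and disj: "disjoint_family_on K J"
    and fin: "\<And>j. j \<in> J \<Longrightarrow> finite (K j)" and det: "\<And>j. j \<in> J \<Longrightarrow> determined_by (K j) (P j)"
  shows "Pr p q (\<lambda>\<omega>. \<forall>j\<in>J. P j \<omega>) = (\<Prod>j\<in>J. Pr p q (P j))"
proof (cases "J = {}")
  case True
  then show ?thesis using sample.prob_space[of p q] by (simp add: space_sample_measure)
next
  case False
  let ?A = "\<lambda>j. {\<omega> \<in> extensional (K j). P j \<omega>}"
  have ind: "sample.indep_vars p q (\<lambda>j. PiM (K j) (\<lambda>_. count_space UNIV))
      (\<lambda>j \<omega>. restrict (\<lambda>z. \<omega> z) (K j)) J"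
    by (rule sample.indep_vars_restrict[OF indep_coordinates]) (use disj in auto)
  have vimage: "(\<lambda>\<omega>. restrict (\<lambda>z. \<omega> z) (K j)) -` ?A j \<inter> space (sample_measure p q) = {\<omega>. P j \<omega>}"
    if "j \<in> J" for j
    using determined_by_restrict[OF det[OF that]] by (auto simp: space_sample_measure)
  have "sample.prob p q (\<Inter>j\<in>J. (\<lambda>\<omega>. restrict (\<lambda>z. \<omega> z) (K j)) -` ?A j \<inter> space (sample_measure p q))
      = (\<Prod>j\<in>J. sample.prob p q ((\<lambda>\<omega>. restrict (\<lambda>z. \<omega> z) (K j)) -` ?A j \<inter> space (sample_measure p q)))"
    by (rule sample.indep_varsD_finite[OF ind False J]) (use fin sets_PiM_coordinates in auto)
  moreover have "(\<Inter>j\<in>J. (\<lambda>\<omega>. restrict (\<lambda>z. \<omega> z) (K j)) -` ?A j \<inter> space (sample_measure p q))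
      = {\<omega>. \<forall>j\<in>J. P j \<omega>}"
    using vimage False by auto
  ultimately show ?thesis
    using vimage by simp
qed

lemma Pr_site: "Pr p q (\<lambda>\<omega>. fst (\<omega> z) \<in> S) = measure (measure_pmf (initial_pmf p q)) S"
proof -
  let ?N = "pair_pmf (initial_pmf p q) (bernoulli_pmf (1 / 2))"
  have "emeasure (sample_measure p q) {\<omega> \<in> space (sample_measure p q). \<omega> z \<in> fst -` S}
      = emeasure ?N (fst -` S)"
    unfolding sample_measure_def by (rule sample_product.emeasure_PiM_Collect_single) auto
  then have "Pr p q (\<lambda>\<omega>. fst (\<omega> z) \<in> S) = measure ?N (fst -` S)"
    by (simp add: measure_def space_sample_measure)
  also have "\<dots> = measure (map_pmf fst ?N) S"
    by (simp add: measure_map_pmf)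
  finally show ?thesis by (simp add: map_fst_pair_pmf)
qed

lemma Pr_cylinder:
  assumes "finite F"
  shows "Pr p q (\<lambda>\<omega>. \<forall>z\<in>F. fst (\<omega> z) \<in> S z) = (\<Prod>z\<in>F. measure (initial_pmf p q) (S z))"
  using Pr_independent[OF assms, of "\<lambda>z. {z}" "\<lambda>z \<omega>. fst (\<omega> z) \<in> S z" p q]
  by (simp add: Pr_site disjoint_family_on_def determined_by_def)

lemma initial_pmf_complement:
  assumes "0 \<le> p" "0 \<le> q" "p + q \<le> 1"
  shows "measure (initial_pmf p q) {Blue} = p" "measure (initial_pmf p q) {Red} = q"
    "measure (initial_pmf p q) {Empty} = 1 - p - q"
    "measure (initial_pmf p q) (- {Blue}) = 1 - p" "measure (initial_pmf p q) (- {Red}) = 1 - q"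
  using pmf_initial_pmf[OF assms] measure_pmf.prob_compl[of _ "initial_pmf p q"]
  by (auto simp: measure_pmf_single Compl_eq_Diff_UNIV)

lemma Pr_all_not_blue:
  assumes "0 \<le> p" "0 \<le> q" "p + q \<le> 1" "finite F"
  shows "Pr p q (\<lambda>\<omega>. \<forall>z\<in>F. fst (\<omega> z) \<noteq> Blue) = (1 - p) ^ card F"
  using Pr_cylinder[OF assms(4), of p q "\<lambda>_. - {Blue}"] initial_pmf_complement[OF assms(1-3)]
  by simp

lemma Pr_compl:
  assumes "determined_by K P" "finite K"
  shows "Pr p q (\<lambda>\<omega>. \<not> P \<omega>) = 1 - Pr p q P"
proof -
  have "{\<omega>. \<not> P \<omega>} = space (sample_measure p q) - {\<omega>. P \<omega>}"
    by (auto simp: space_sample_measure)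
  then show ?thesis
    using sample.prob_compl[OF sets_determined_by[OF assms]] by simp
qed

lemma Pr_bex_le:
  assumes "finite I" "\<And>i. i \<in> I \<Longrightarrow> {\<omega>. P i \<omega>} \<in> sets (sample_measure p q)"
  shows "Pr p q (\<lambda>\<omega>. \<exists>i\<in>I. P i \<omega>) \<le> (\<Sum>i\<in>I. Pr p q (P i))"
proof -
  have "{\<omega>. \<exists>i\<in>I. P i \<omega>} = (\<Union>i\<in>I. {\<omega>. P i \<omega>})"
    by auto
  then show ?thesis
    using assms by (auto intro!: sample.finite_measure_subadditive_finite)
qed

subsection \<open>Speed of the two colors\<close>

text \<open>Counts the red update times up to the \<open>n\<close>-th update; each of them carries
  red at most \<rho> further.\<close>

abbreviation red_ticks :: "real \<Rightarrow> nat \<Rightarrow> nat" where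
  "red_ticks r n \<equiv> nat \<lfloor>update_time r n / r\<rfloor>"

lemma update_time_nonneg: "0 < r \<Longrightarrow> 0 \<le> update_time r n"
  using strict_mono_less_eq[OF strict_mono_update_time, of r 0 n] by simp

lemma update_time_mono: "0 < r \<Longrightarrow> m \<le> n \<Longrightarrow> update_time r m \<le> update_time r n"
  by (simp add: strict_mono_less_eq[OF strict_mono_update_time])

lemma red_ticks_mono: "0 < r \<Longrightarrow> m \<le> n \<Longrightarrow> red_ticks r m \<le> red_ticks r n"
  by (intro nat_mono floor_mono divide_right_mono update_time_mono) auto

lemma nat_floor_tick:
  fixes s :: real
  assumes "0 \<le> s" "s < real k"
  shows "nat \<lfloor>s\<rfloor> < nat \<lfloor>real k\<rfloor>"
  using assms by (simp add: floor_less_iff nat_less_iff)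

lemma red_ticks_Suc:
  assumes "0 < r" "update_time r (Suc n) \<in> red_times r"
  shows "red_ticks r n < red_ticks r (Suc n)"
proof -
  obtain k where k: "update_time r (Suc n) = real k * r"
    using assms(2) by (auto simp: red_times_def)
  have "update_time r n < update_time r (Suc n)"
    using assms(1) next_time(2) by simp
  then have "update_time r n / r < real k"
    using k assms(1) by (simp add: pos_divide_less_eq)
  then show ?thesis
    using nat_floor_tick[of "update_time r n / r" k] update_time_nonneg[OF assms(1)] k assms(1)
    by (simp del: update_time.simps)
qed

lemma blue_ticks_Suc:
  assumes "0 < r" "update_time r (Suc n) \<in> blue_times"
  shows "nat \<lfloor>update_time r n\<rfloor> < nat \<lfloor>update_time r (Suc n)\<rfloor>"
proof -
  obtain k where k: "update_time r (Suc n) = real k"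
    using assms(2) by (auto simp: blue_times_def)
  have "update_time r n < update_time r (Suc n)"
    using assms(1) next_time(2) by simp
  then show ?thesis
    using nat_floor_tick[of "update_time r n" k] update_time_nonneg[OF assms(1)] k
    by (simp del: update_time.simps)
qed

lemma obtain_update_index:
  assumes "0 < r" "s \<in> blue_times \<union> red_times r"
  obtains m where "update_time r (Suc m) = s"
proof -
  obtain n where n: "s = update_time r n"
    using range_update_time[OF assms(1)] assms(2) by blast
  have "s > 0"
    using assms by (auto simp: blue_times_def red_times_def)
  then show ?thesis
    using n that by (cases n) auto
qed

lemma obtain_blue_index:
  assumes "0 < r" "0 < k"
  obtains m where "update_time r (Suc m) = real k"
proof -
  have "real k \<in> blue_times"
    using assms by (auto simp: blue_times_def)
  then show ?thesis
    using obtain_update_index[OF assms(1)] that by blast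
qed

lemma obtain_red_index:
  assumes "0 < r" "0 < k"
  obtains m where "update_time r (Suc m) = real k * r"
proof -
  have "real k * r \<in> red_times r"
    unfolding red_times_def using assms by force
  then show ?thesis
    using obtain_update_index[OF assms(1)] that by blast
qed

lemma config_Suc_Red:
  assumes "config B R r \<omega> (Suc n) z = Red" "config B R r \<omega> n z \<noteq> Red"
  shows "update_time r (Suc n) \<in> red_times r" "\<exists>b\<in>R. config B R r \<omega> n (z + b) = Red"
  using assms by (auto simp: update_def Let_def split: if_splits)

lemma config_Suc_Blue:
  assumes "config B R r \<omega> (Suc n) z = Blue" "config B R r \<omega> n z \<noteq> Blue"
  shows "update_time r (Suc n) \<in> blue_times" "\<exists>b\<in>B. config B R r \<omega> n (z + b) = Blue"
  using assms by (auto simp: update_def Let_def split: if_splits)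

lemma config_due_blue:
  assumes "update_time r (Suc n) \<in> blue_times" "b \<in> B" "config B R r \<omega> n (z + b) = Blue"
  shows "config B R r \<omega> (Suc n) z \<noteq> Empty"
  using assms by (auto simp: update_def Let_def)

lemma config_due_red:
  assumes "update_time r (Suc n) \<in> red_times r" "b \<in> R" "config B R r \<omega> n (z + b) = Red"
  shows "config B R r \<omega> (Suc n) z \<noteq> Empty"
  using assms by (auto simp: update_def Let_def)

lemma config_stays: "config B R r \<omega> n z = c \<Longrightarrow> c \<noteq> Empty \<Longrightarrow> n \<le> m \<Longrightarrow> config B R r \<omega> m z = c"
  using config_mono by metis

lemma final_state_eqI:
  assumes "config B R r \<omega> n z = c" "c \<noteq> Empty"
  shows "final_state B R r \<omega> z = c"
proof -
  have "\<forall>\<^sub>F m in sequentially. config B R r \<omega> m z = c"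
    unfolding eventually_sequentially using config_stays[OF assms] by blast
  then have "\<forall>\<^sub>F m in sequentially. final_state B R r \<omega> z = c"
    using eventually_final_state[of B R r \<omega> z] by eventually_elim simp
  then show ?thesis by simp
qed

lemma final_state_nonemptyE:
  assumes "final_state B R r \<omega> z \<noteq> Empty"
  obtains n where "\<And>m. n \<le> m \<Longrightarrow> config B R r \<omega> m z = final_state B R r \<omega> z"
  using eventually_final_state[of B R r \<omega> z] by (auto simp: eventually_sequentially)

lemma l1_ball_bounds:
  assumes "b \<in> l1_ball \<rho>"
  shows "\<bar>fst b\<bar> \<le> int \<rho>" "\<bar>snd b\<bar> \<le> int \<rho>"
  using assms by (auto simp: l1_ball_def)

text \<open>Following the infections backwards from \<open>z\<close> leads to an initial red seed;
  each infection uses up one red tick and moves by at most \<rho> in either coordinate.\<close>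

lemma red_speed:
  assumes r: "0 < r" and red: "config B (l1_ball \<rho>) r \<omega> n z = Red"
  shows "\<exists>s. fst (\<omega> s) = Red \<and> \<bar>fst s - fst z\<bar> \<le> int (\<rho> * red_ticks r n) \<and>
    \<bar>snd s - snd z\<bar> \<le> int (\<rho> * red_ticks r n)"
  using red
proof (induction n arbitrary: z)
  case 0
  then show ?case by (intro exI[of _ z]) simp
next
  case (Suc n)
  show ?case
  proof (cases "config B (l1_ball \<rho>) r \<omega> n z = Red")
    case True
    have "int (\<rho> * red_ticks r n) \<le> int (\<rho> * red_ticks r (Suc n))"
      using red_ticks_mono[OF r, of n "Suc n"] by (intro of_nat_mono mult_left_mono) auto
    then show ?thesis
      using Suc.IH[OF True] by (meson order_trans)
  next
    case False
    obtain b where b: "b \<in> l1_ball \<rho>" "config B (l1_ball \<rho>) r \<omega> n (z + b) = Red"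
      using config_Suc_Red(2)[OF Suc.prems False] by blast
    obtain s where s: "fst (\<omega> s) = Red" "\<bar>fst s - fst (z + b)\<bar> \<le> int (\<rho> * red_ticks r n)"
      "\<bar>snd s - snd (z + b)\<bar> \<le> int (\<rho> * red_ticks r n)"
      using Suc.IH[OF b(2)] by blast
    have "\<rho> * (red_ticks r n + 1) \<le> \<rho> * red_ticks r (Suc n)"
      using red_ticks_Suc[OF r config_Suc_Red(1)[OF Suc.prems False]] by (intro mult_le_mono2) linarith
    then have "int (\<rho> * red_ticks r n) + int \<rho> \<le> int (\<rho> * red_ticks r (Suc n))"
      by (simp add: algebra_simps flip: of_nat_add of_nat_mult del: update_time.simps)
    then have "\<bar>fst s - fst z\<bar> \<le> int (\<rho> * red_ticks r (Suc n))"
      "\<bar>snd s - snd z\<bar> \<le> int (\<rho> * red_ticks r (Suc n))"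
      using s(2,3) l1_ball_bounds[OF b(1)] unfolding fst_add snd_add by linarith+
    then show ?thesis using s(1) by blast
  qed
qed

text \<open>The backward argument of \<open>red_speed\<close>, with the integer times as ticks; it
  stays in the row \<open>y\<close> because the blue neighborhood is horizontal.\<close>

lemma blue_speed:
  assumes r: "0 < r" and blue: "config ({- int \<tau>..int \<tau>} \<times> {0}) R r \<omega> n (x, y) = Blue"
  shows "\<exists>x'. fst (\<omega> (x', y)) = Blue \<and> \<bar>x' - x\<bar> \<le> int (\<tau> * nat \<lfloor>update_time r n\<rfloor>)"
  using blue
proof (induction n arbitrary: x)
  case 0
  then show ?case by (intro exI[of _ x]) simp
next
  case (Suc n)
  let ?B = "{- int \<tau>..int \<tau>} \<times> {0::int}"
  show ?case
  proof (cases "config ?B R r \<omega> n (x, y) = Blue")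
    case True
    have "int (\<tau> * nat \<lfloor>update_time r n\<rfloor>) \<le> int (\<tau> * nat \<lfloor>update_time r (Suc n)\<rfloor>)"
      using update_time_mono[OF r, of n "Suc n"]
      by (intro of_nat_mono mult_left_mono nat_mono floor_mono) auto
    then show ?thesis
      using Suc.IH[OF True] by (meson order_trans)
  next
    case False
    obtain b where b: "\<bar>b\<bar> \<le> int \<tau>" "config ?B R r \<omega> n (x + b, y) = Blue"
      using config_Suc_Blue(2)[OF Suc.prems False] by force
    obtain x' where x': "fst (\<omega> (x', y)) = Blue" "\<bar>x' - (x + b)\<bar> \<le> int (\<tau> * nat \<lfloor>update_time r n\<rfloor>)"
      using Suc.IH[OF b(2)] by blast
    have "\<tau> * (nat \<lfloor>update_time r n\<rfloor> + 1) \<le> \<tau> * nat \<lfloor>update_time r (Suc n)\<rfloor>"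
      using blue_ticks_Suc[OF r config_Suc_Blue(1)[OF Suc.prems False]] by (intro mult_le_mono2) linarith
    then have "int (\<tau> * nat \<lfloor>update_time r n\<rfloor>) + int \<tau> \<le> int (\<tau> * nat \<lfloor>update_time r (Suc n)\<rfloor>)"
      by (simp add: algebra_simps flip: of_nat_add of_nat_mult del: update_time.simps)
    then have "\<bar>x' - x\<bar> \<le> int (\<tau> * nat \<lfloor>update_time r (Suc n)\<rfloor>)"
      using x'(2) b(1) by linarith
    then show ?thesis using x'(1) by blast
  qed
qed

text \<open>Blue advances by one column to the left at each integer time, since a site due to become
  blue can only be stopped by being red. Colors are permanent, so excluding red at the final index
  \<open>n\<close> excludes it at all earlier ones.\<close>

lemma blue_fill:
  assumes r: "0 < r" and seed: "fst (\<omega> (x + int k, y)) = Blue"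
    and not_red: "\<And>j. j \<le> k \<Longrightarrow> config {(1, 0)} R r \<omega> n (x + int j, y) \<noteq> Red"
    and time: "real k \<le> update_time r n"
  shows "config {(1, 0)} R r \<omega> n (x, y) = Blue"
proof -
  let ?c = "config {(1, 0)} R r \<omega>"
  \<comment> \<open>Induction on the distance \<open>i\<close> from the seed.\<close>
  have "\<forall>m\<le>n. real i \<le> update_time r m \<longrightarrow> ?c m (x + int (k - i), y) = Blue" if "i \<le> k" for i
    using that
  proof (induction i)
    case 0
    have "?c 0 (x + int k, y) = Blue" using seed by simp
    then show ?case using config_stays[of _ _ _ _ 0 _ Blue] by simp
  next
    case (Suc i)
    obtain m where m: "update_time r (Suc m) = real (Suc i)"
      using obtain_blue_index[OF r, of "Suc i"] by auto
    \<comment> \<open>Red times interleave with the integers, so the update just before time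
      \<open>Suc i\<close> need not be the one at time \<open>i\<close>, but it is not
      earlier.\<close>
    have time_m: "real i \<le> update_time r m"
    proof (cases "i = 0")
      case False
      then obtain m' where m': "update_time r (Suc m') = real i"
        using obtain_blue_index[OF r, of i] by auto
      then have "update_time r (Suc m') < update_time r (Suc m)"
        using m by (simp del: update_time.simps)
      then have "Suc m' \<le> m"
        using strict_mono_less[OF strict_mono_update_time[OF r], of "Suc m'" "Suc m"] by linarith
      then show ?thesis
        using update_time_mono[OF r, of "Suc m'" m] m' by (simp del: update_time.simps)
    qed (use update_time_nonneg[OF r] in simp)
    show ?case
    proof (intro allI impI)
      fix m' assume m': "m' \<le> n" "real (Suc i) \<le> update_time r m'"
      then have "Suc m \<le> m'"
        using m strict_mono_less_eq[OF strict_mono_update_time[OF r], of "Suc m" m'] by metis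
      have "?c m (x + int (k - i), y) = Blue"
        using Suc time_m \<open>Suc m \<le> m'\<close> m'(1) by simp
      moreover have "(x + int (k - Suc i), y) + (1, 0) = (x + int (k - i), y)"
        using Suc.prems by (simp add: of_nat_diff)
      moreover have "update_time r (Suc m) \<in> blue_times"
        unfolding m blue_times_def by (rule CollectI, rule exI[of _ "Suc i"]) simp
      ultimately have "?c (Suc m) (x + int (k - Suc i), y) \<noteq> Empty"
        using config_due_blue[of r m "(1, 0)" "{(1, 0)}" R \<omega> "(x + int (k - Suc i), y)"] by simp
      then have "?c (Suc m) (x + int (k - Suc i), y) = Blue"
        using config_stays[of "{(1, 0)}" R r \<omega> "Suc m" "(x + int (k - Suc i), y)" Red n] not_red[of "k - Suc i"]
          \<open>Suc m \<le> m'\<close> m'(1) by (cases "?c (Suc m) (x + int (k - Suc i), y)") (auto simp del: config.simps)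
      then show "?c m' (x + int (k - Suc i), y) = Blue"
        using config_stays \<open>Suc m \<le> m'\<close> by blast
    qed
  qed
  from this[of k] show ?thesis using time by simp
qed

subsection \<open>Blue barriers\<close>

text \<open>One red jump changes the height by at most \<rho>, so it cannot cross \<rho> consecutive
  rows that are blue throughout the window. Red could only come around the sides; hence the
  protected columns shrink by \<rho> at each red tick, and the invariant is claimed on the shrunken
  window.\<close>

lemma fence:
  fixes centre u u' w :: int
  assumes r: "0 < r" and u: "0 \<le> u" "0 \<le> u'" and mn: "m \<le> n"
    and start: "\<And>z. config B (l1_ball \<rho>) r \<omega> m z = Red \<Longrightarrow> \<bar>fst z - centre\<bar> \<le> w \<Longrightarrow>
      u + int \<rho> < snd z \<or> snd z < - u' - int \<rho>"
    and fence_blue: "\<And>x y. \<bar>x - centre\<bar> \<le> w \<Longrightarrow>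
      u < y \<and> y \<le> u + int \<rho> \<or> - u' - int \<rho> \<le> y \<and> y < - u' \<Longrightarrow>
      config B (l1_ball \<rho>) r \<omega> m (x, y) = Blue"
    and red: "config B (l1_ball \<rho>) r \<omega> n z = Red"
    and near: "\<bar>fst z - centre\<bar> \<le> w - int (\<rho> * (red_ticks r n - red_ticks r m))"
  shows "u + int \<rho> < snd z \<or> snd z < - u' - int \<rho>"
  using mn red near
proof (induction n arbitrary: z rule: dec_induct)
  case base
  then show ?case using start by simp
next
  case (step n)
  let ?c = "config B (l1_ball \<rho>) r \<omega>"
  show ?case
  proof (cases "?c n z = Red")
    case True
    have "\<rho> * (red_ticks r n - red_ticks r m) \<le> \<rho> * (red_ticks r (Suc n) - red_ticks r m)"
      using red_ticks_mono[OF r, of n "Suc n"] by (intro mult_le_mono2 diff_le_mono) simp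
    then have "int (\<rho> * (red_ticks r n - red_ticks r m)) \<le> int (\<rho> * (red_ticks r (Suc n) - red_ticks r m))"
      by (rule of_nat_mono)
    then show ?thesis
      using step.IH[OF True] step.prems(2) by linarith
  next
    case False
    obtain b where b: "b \<in> l1_ball \<rho>" "?c n (z + b) = Red"
      using config_Suc_Red(2)[OF step.prems(1) False] by blast
    note bb = l1_ball_bounds[OF b(1)]
    have "red_ticks r n - red_ticks r m + 1 \<le> red_ticks r (Suc n) - red_ticks r m"
      using red_ticks_Suc[OF r config_Suc_Red(1)[OF step.prems(1) False]]
        red_ticks_mono[OF r step.hyps(1)] by linarith
    then have "\<rho> * (red_ticks r n - red_ticks r m + 1) \<le> \<rho> * (red_ticks r (Suc n) - red_ticks r m)"
      by (rule mult_le_mono2)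
    then have "int (\<rho> * (red_ticks r n - red_ticks r m)) + int \<rho>
        \<le> int (\<rho> * (red_ticks r (Suc n) - red_ticks r m))"
      unfolding distrib_left mult_1_right of_nat_add[symmetric] by (rule of_nat_mono)
    \<comment> \<open>The infecting site may lie \<rho> columns further out, but one red tick
      earlier the window was wider by that much.\<close>
    then have "\<bar>fst (z + b) - centre\<bar> \<le> w - int (\<rho> * (red_ticks r n - red_ticks r m))"
      using step.prems(2) bb unfolding fst_add by linarith
    then have away: "u + int \<rho> < snd (z + b) \<or> snd (z + b) < - u' - int \<rho>"
      using step.IH[OF b(2)] by blast
    have "\<bar>fst z - centre\<bar> \<le> w"
      using step.prems(2) by linarith
    moreover have "?c m (fst z, snd z) \<noteq> Blue"
      using config_stays[of B _ r \<omega> m z Blue "Suc n"] step.prems(1) step.hyps(1) by force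
    ultimately have "\<not> (u < snd z \<and> snd z \<le> u + int \<rho> \<or> - u' - int \<rho> \<le> snd z \<and> snd z < - u')"
      using fence_blue by blast
    \<comment> \<open>\<open>z\<close> avoids the blue rows and lies within \<rho> of a site beyond
      them, hence beyond them on the same side.\<close>
    then show ?thesis
      using away bb u unfolding snd_add by linarith
  qed
qed

text \<open>The seeds lie just to the right of the columns \<open>{(c - 1) * w..<(c + 2) * w}\<close>, which blue fills from
  them, in \<open>\<rho>\<close> consecutive rows, by time \<open>4 * w\<close> unless red interferes; \<open>\<sigma> = 1\<close> and \<open>\<sigma> = - 1\<close> stand for
  the upper and the lower half-plane.\<close>

definition barrier :: "sample \<Rightarrow> nat \<Rightarrow> nat \<Rightarrow> int \<Rightarrow> nat \<Rightarrow> nat \<Rightarrow> int \<Rightarrow> bool" where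
  "barrier \<omega> \<rho> w c u n \<sigma> \<longleftrightarrow> (\<exists>b<n. \<forall>k<\<rho>. \<exists>x\<in>{(c + 2) * int w..<(c + 3) * int w}.
     fst (\<omega> (x, \<sigma> * int (u + b * \<rho> + 1 + k))) = Blue)"

text \<open>The seeds lie to the right of every column within \<open>w\<close> of \<open>x0\<close>
  and at most \<open>4 * w\<close> away, so the leftward growth of blue covers these columns in
  time. Absence of red is required on all columns that this growth crosses.\<close>

lemma barrier_filled:
  assumes r: "0 < r" and \<sigma>: "\<sigma> = 1 \<or> \<sigma> = - 1" and w: "1 \<le> w"
    and bar: "barrier \<omega> \<rho> w (x0 div int w) u n \<sigma>"
    and time: "update_time r m = real (4 * w)"
    and no_red: "\<And>x y. \<bar>x - x0\<bar> \<le> 4 * int w \<Longrightarrow> \<bar>y\<bar> \<le> int (u + n * \<rho>) \<Longrightarrow>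
      config {(1, 0)} R r \<omega> m (x, y) \<noteq> Red"
  obtains b where "b < n" "\<And>x y. \<bar>x - x0\<bar> \<le> int w \<Longrightarrow> int (u + b * \<rho>) < \<sigma> * y \<Longrightarrow>
      \<sigma> * y \<le> int (u + b * \<rho>) + int \<rho> \<Longrightarrow> config {(1, 0)} R r \<omega> m (x, y) = Blue"
proof -
  let ?c = "x0 div int w"
  have x0: "?c * int w \<le> x0" "x0 < ?c * int w + int w"
    using w div_mult_mod_eq[of x0 "int w"] pos_mod_bound[of "int w" x0] pos_mod_sign[of "int w" x0]
    by linarith+
  obtain b where b: "b < n" and seeds: "\<And>k. k < \<rho> \<Longrightarrow> \<exists>x\<in>{(?c + 2) * int w..<(?c + 3) * int w}.
      fst (\<omega> (x, \<sigma> * int (u + b * \<rho> + 1 + k))) = Blue"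
    using bar unfolding barrier_def by blast
  have "(b + 1) * \<rho> \<le> n * \<rho>"
    using b by (intro mult_le_mono1) simp
  then have top: "int (u + b * \<rho>) + int \<rho> \<le> int (u + n * \<rho>)"
    by (simp add: algebra_simps flip: of_nat_add of_nat_mult)
  show ?thesis
  proof (rule that[OF b])
    fix x y assume x: "\<bar>x - x0\<bar> \<le> int w" and y: "int (u + b * \<rho>) < \<sigma> * y"
      "\<sigma> * y \<le> int (u + b * \<rho>) + int \<rho>"
    define k where "k = nat (\<sigma> * y - int (u + b * \<rho>) - 1)"
    have k: "k < \<rho>" "\<sigma> * y = int (u + b * \<rho> + 1 + k)"
      using y by (auto simp: k_def)
    have "\<sigma> * (\<sigma> * y) = y" using \<sigma> by auto
    then have "\<exists>x\<in>{(?c + 2) * int w..<(?c + 3) * int w}. fst (\<omega> (x, y)) = Blue"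
      using seeds[OF k(1)] unfolding k(2)[symmetric] by (simp only:)
    then obtain x' where x': "(?c + 2) * int w \<le> x'" "x' < (?c + 3) * int w" "fst (\<omega> (x', y)) = Blue"
      by auto
    \<comment> \<open>\<open>x\<close> lies between \<open>(?c - 1) * int w\<close> and
      \<open>(?c + 2) * int w\<close>, where the seeds start; they end before
      \<open>(?c + 3) * int w\<close>.\<close>
    have range: "x < x'" "x' - x \<le> 4 * int w" "x' - x0 \<le> 3 * int w"
      using x x' x0 by (auto simp: algebra_simps)
    have "\<sigma> * y = y \<or> \<sigma> * y = - y"
      using \<sigma> by auto
    moreover have "0 \<le> int (u + b * \<rho>)" by simp
    ultimately have abs_y: "\<bar>y\<bar> \<le> int (u + n * \<rho>)"
      using y top by (elim disjE) linarith+
    have eq: "x + int (nat (x' - x)) = x'" using range by simp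
    show "config {(1, 0)} R r \<omega> m (x, y) = Blue"
    proof (rule blue_fill[OF r, of _ _ "nat (x' - x)"])
      show "fst (\<omega> (x + int (nat (x' - x)), y)) = Blue"
        using x'(3) eq by simp
      show "real (nat (x' - x)) \<le> update_time r m"
        unfolding time using range by linarith
    next
      fix j assume "j \<le> nat (x' - x)"
      then have "\<bar>x + int j - x0\<bar> \<le> 4 * int w"
        using range x by linarith
      then show "config {(1, 0)} R r \<omega> m (x + int j, y) \<noteq> Red"
        using no_red abs_y by blast
    qed
  qed
qed

text \<open>Holds if some red seed can come within distance \<open>d\<close> to window
  \<open>c\<close> at heights up to \<open>V\<close>. Only seeds outside the strip of half-height
  \<open>H\<close> count: the box inside is assumed free of red, and the remaining seeds are
  disjoint from the sites that decide the barriers, which yields independence.\<close>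

definition near_red :: "sample \<Rightarrow> nat \<Rightarrow> int \<Rightarrow> nat \<Rightarrow> nat \<Rightarrow> nat \<Rightarrow> bool" where
  "near_red \<omega> w c d H V \<longleftrightarrow> (\<exists>s. fst (\<omega> s) = Red \<and> \<bar>fst s - c * int w\<bar> \<le> int (w + d) \<and>
     int H < \<bar>snd s\<bar> \<and> \<bar>snd s\<bar> \<le> int (V + d))"

text \<open>The deterministic core. At time \<open>4 * w i\<close> there is no red within
  \<open>X i\<close> columns and \<open>Y i\<close> rows of the origin, and \<open>D i\<close>
  bounds how far red has travelled by then. From one time to the next, \<open>4 * w i\<close>
  columns are given up for the growth of the barriers and \<open>nb i * \<rho>\<close> rows for
  their height; red cannot bypass a barrier, as it advances by at most \<open>w i\<close> columns
  meanwhile. At scale \<open>I\<close> blue has had time to reach the origin from a seed within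
  distance \<open>n\<close>.\<close>

lemma blue_survives:
  fixes w nb :: "nat \<Rightarrow> nat" and \<rho> I n H XB :: nat and r :: real
  defines "X \<equiv> \<lambda>i. n + 4 * (\<Sum>j\<in>{i..<I}. w j)"
    and "Y \<equiv> \<lambda>i. \<rho> * (\<Sum>j\<in>{i..<I}. nb j)"
    and "D \<equiv> \<lambda>i. \<rho> * nat \<lfloor>real (4 * w i) / r\<rfloor>"
  assumes r: "0 < r"
    and w: "1 \<le> w 0" "\<And>i. i < I \<Longrightarrow> w i \<le> w (Suc i)" "\<And>i. i < I \<Longrightarrow> D (Suc i) \<le> D i + w i"
    and H: "Y 0 + D 0 \<le> H" and XB: "X 0 + D I \<le> XB"
    and no_red: "\<And>x y. \<bar>x\<bar> \<le> int XB \<Longrightarrow> \<bar>y\<bar> \<le> int H \<Longrightarrow> fst (\<omega> (x, y)) \<noteq> Red"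
    and barriers: "\<And>i c \<sigma>. i < I \<Longrightarrow> \<bar>c\<bar> * int (w i) \<le> int (X (Suc i) + w i) \<Longrightarrow>
      near_red \<omega> (w i) c (D (Suc i)) H (Y (Suc i)) \<Longrightarrow> \<sigma> = 1 \<or> \<sigma> = - 1 \<Longrightarrow>
      barrier \<omega> \<rho> (w i) c (Y (Suc i)) (nb i) \<sigma>"
    and seed: "\<exists>k\<le>n. fst (\<omega> (int k, 0)) = Blue" and nI: "n \<le> 4 * w I"
  shows "final_state {(1, 0)} (l1_ball \<rho>) r \<omega> (0, 0) = Blue"
proof -
  let ?c = "config {(1, 0)} (l1_ball \<rho>) r \<omega>"
  have w1: "1 \<le> w i" if "i \<le> I" for i
    using that
  proof (induction i)
    case (Suc i)
    then show ?case using w(2)[of i] by linarith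
  qed (use w(1) in simp)
  have mono_w: "w i \<le> w j" if "i \<le> j" "j \<le> I" for i j
    using that
  proof (induction j rule: dec_induct)
    case (step j)
    then show ?case using w(2)[of j] by linarith
  qed simp
  have mono_D: "D i \<le> D j" if "i \<le> j" "j \<le> I" for i j
    unfolding D_def using mono_w[OF that] r
    by (intro mult_le_mono2 nat_mono floor_mono divide_right_mono) auto
  have X_Suc: "X i = X (Suc i) + 4 * w i" and Y_Suc: "Y i = Y (Suc i) + nb i * \<rho>" if "i < I" for i
    using sum.atLeast_Suc_lessThan[OF that, of w] sum.atLeast_Suc_lessThan[OF that, of nb]
    by (simp_all add: X_def Y_def algebra_simps)
  have X_le: "X i \<le> X 0" for i
    unfolding X_def by (intro add_left_mono mult_le_mono2 sum_mono2) auto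
  have Y_le: "Y i \<le> Y 0" for i
    unfolding Y_def by (intro mult_le_mono2 sum_mono2) auto
  obtain m where m: "\<And>i. i \<le> I \<Longrightarrow> update_time r (m i) = real (4 * w i)"
  proof -
    have "\<exists>m. i \<le> I \<longrightarrow> update_time r m = real (4 * w i)" for i
      using obtain_blue_index[OF r, of "4 * w i"] w1[of i] by (metis mult_pos_pos zero_less_numeral
          less_le_trans zero_less_one)
    then show ?thesis using that by metis
  qed
  have D_eq: "D i = \<rho> * red_ticks r (m i)" if "i \<le> I" for i
    using m[OF that] by (simp add: D_def)
  \<comment> \<open>Red in the region descends from a seed at horizontal distance at most
    \<open>X 0 + D I\<close> from the origin; as the box contains no red seed, that seed lies
    outside the strip of half-height \<open>H\<close>.\<close>
  have ancestor: "\<exists>s. fst (\<omega> s) = Red \<and> \<bar>fst s - fst z\<bar> \<le> int (D i) \<and> \<bar>snd s - snd z\<bar> \<le> int (D i)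
      \<and> int H < \<bar>snd s\<bar>"
    if red: "?c (m i) z = Red" and z: "\<bar>fst z\<bar> \<le> int (X i)" and i: "i \<le> I" for z i
  proof -
    obtain s where s: "fst (\<omega> s) = Red" "\<bar>fst s - fst z\<bar> \<le> int (D i)" "\<bar>snd s - snd z\<bar> \<le> int (D i)"
      using red_speed[OF r red] D_eq[OF i] by auto
    have "D i \<le> D I" using mono_D i by blast
    then have "\<bar>fst s\<bar> \<le> int XB"
      using s(2) z X_le[of i] XB by linarith
    then have "int H < \<bar>snd s\<bar>"
      using no_red[of "fst s" "snd s"] s(1) by force
    then show ?thesis using s by blast
  qed
  have clear: "?c (m i) z \<noteq> Red" if "\<bar>fst z\<bar> \<le> int (X i)" "\<bar>snd z\<bar> \<le> int (Y i)" "i \<le> I" for i z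
    using that
  proof (induction i arbitrary: z)
    \<comment> \<open>At the first time red from outside the box cannot have come down to height
      \<open>Y 0\<close>, because \<open>Y 0 + D 0 \<le> H\<close>.\<close>
    case 0
    show ?case
    proof
      assume "?c (m 0) z = Red"
      then show False
        using ancestor[of 0 z] 0 H by force
    qed
  next
    case (Suc i)
    then have i: "i < I" by simp
    let ?x = "fst z" and ?d = "fst z div int (w i)"
    show ?case
    proof
      assume red: "?c (m (Suc i)) z = Red"
      have "0 < int (w i)" using w1[of i] i by simp
      then have x: "?d * int (w i) \<le> ?x" "?x < ?d * int (w i) + int (w i)"
        using div_mult_mod_eq[of ?x "int (w i)"] pos_mod_bound[of "int (w i)" ?x]
          pos_mod_sign[of "int (w i)" ?x] by linarith+
      have "\<bar>?d * int (w i)\<bar> \<le> int (X (Suc i) + w i)"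
        using x Suc.prems(1) by linarith
      then have d: "\<bar>?d\<bar> * int (w i) \<le> int (X (Suc i) + w i)"
        by (simp add: abs_mult)
      \<comment> \<open>The site assumed to be red itself supplies the seed that makes the barriers
        of its window available.\<close>
      have "near_red \<omega> (w i) ?d (D (Suc i)) H (Y (Suc i))"
      proof -
        obtain s where s: "fst (\<omega> s) = Red" "\<bar>fst s - ?x\<bar> \<le> int (D (Suc i))"
          "\<bar>snd s - snd z\<bar> \<le> int (D (Suc i))" "int H < \<bar>snd s\<bar>"
          using ancestor[OF red] Suc.prems by blast
        have "\<bar>fst s - ?d * int (w i)\<bar> \<le> int (w i + D (Suc i))"
          "\<bar>snd s\<bar> \<le> int (Y (Suc i) + D (Suc i))"
          using s x Suc.prems(2) by linarith+
        then show ?thesis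
          unfolding near_red_def using s by blast
      qed
      then have bar: "barrier \<omega> \<rho> (w i) ?d (Y (Suc i)) (nb i) \<sigma>" if "\<sigma> = 1 \<or> \<sigma> = - 1" for \<sigma>
        using barriers[OF i d _ that] by blast
      \<comment> \<open>By \<open>X_Suc\<close> and \<open>Y_Suc\<close> the red-free region of
        scale \<open>i\<close> contains the whole area in which the barriers fill.\<close>
      have clear_i: "?c (m i) (x, y) \<noteq> Red" if "\<bar>x - ?x\<bar> \<le> 4 * int (w i)"
        "\<bar>y\<bar> \<le> int (Y (Suc i) + nb i * \<rho>)" for x y
        using Suc.IH[of "(x, y)"] that Suc.prems(1) i X_Suc[OF i] Y_Suc[OF i] by simp
      obtain b where b: "b < nb i" "\<And>x y. \<bar>x - ?x\<bar> \<le> int (w i) \<Longrightarrow> int (Y (Suc i) + b * \<rho>) < 1 * y \<Longrightarrow>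
          1 * y \<le> int (Y (Suc i) + b * \<rho>) + int \<rho> \<Longrightarrow> ?c (m i) (x, y) = Blue"
        using barrier_filled[OF r _ w1 bar m clear_i, of 1] i by auto
      obtain b' where b': "b' < nb i" "\<And>x y. \<bar>x - ?x\<bar> \<le> int (w i) \<Longrightarrow> int (Y (Suc i) + b' * \<rho>) < (- 1) * y \<Longrightarrow>
          (- 1) * y \<le> int (Y (Suc i) + b' * \<rho>) + int \<rho> \<Longrightarrow> ?c (m i) (x, y) = Blue"
        using barrier_filled[OF r _ w1 bar m clear_i, of "- 1"] i by auto
      have top: "int (Y (Suc i) + k * \<rho>) + int \<rho> \<le> int (Y i)" if "k < nb i" for k
      proof -
        have "(k + 1) * \<rho> \<le> nb i * \<rho>"
          using that by (intro mult_le_mono1) simp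
        then show ?thesis
          unfolding Y_Suc[OF i] by (simp add: algebra_simps flip: of_nat_add of_nat_mult)
      qed
      \<comment> \<open>The barriers above and below, filled at time \<open>4 * w i\<close>, hold
        red off until the next time, which contradicts the height of \<open>z\<close>.\<close>
      have "int (Y (Suc i) + b * \<rho>) + int \<rho> < snd z \<or> snd z < - int (Y (Suc i) + b' * \<rho>) - int \<rho>"
      proof (rule fence[OF r _ _ _ _ _ red, where m = "m i" and w = "int (w i)" and centre = "fst z"])
        have "update_time r (m i) \<le> update_time r (m (Suc i))"
          using m[of i] m[of "Suc i"] w(2)[OF i] i by simp
        then show "m i \<le> m (Suc i)"
          using strict_mono_less_eq[OF strict_mono_update_time[OF r]] by blast
      next
        fix z' assume z': "?c (m i) z' = Red" "\<bar>fst z' - ?x\<bar> \<le> int (w i)"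
        then have "\<not> \<bar>snd z'\<bar> \<le> int (Y i)"
          using Suc.IH[of z'] Suc.prems(1) X_Suc[OF i] i by force
        then show "int (Y (Suc i) + b * \<rho>) + int \<rho> < snd z' \<or> snd z' < - int (Y (Suc i) + b' * \<rho>) - int \<rho>"
          using top[OF b(1)] top[OF b'(1)] by linarith
      next
        fix x y assume x: "\<bar>x - ?x\<bar> \<le> int (w i)"
          and y: "int (Y (Suc i) + b * \<rho>) < y \<and> y \<le> int (Y (Suc i) + b * \<rho>) + int \<rho> \<or>
            - int (Y (Suc i) + b' * \<rho>) - int \<rho> \<le> y \<and> y < - int (Y (Suc i) + b' * \<rho>)"
        from y show "?c (m i) (x, y) = Blue"
        proof (elim disjE conjE)
          assume "int (Y (Suc i) + b * \<rho>) < y" "y \<le> int (Y (Suc i) + b * \<rho>) + int \<rho>"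
          then show ?thesis by (intro b(2)[OF x]) linarith+
        next
          assume "- int (Y (Suc i) + b' * \<rho>) - int \<rho> \<le> y" "y < - int (Y (Suc i) + b' * \<rho>)"
          then show ?thesis by (intro b'(2)[OF x]) linarith+
        qed
      next
        \<comment> \<open>The fence window of half-width \<open>w i\<close> has not shrunk to
          nothing: the column of \<open>z\<close> is still protected.\<close>
        have "\<rho> * (red_ticks r (m (Suc i)) - red_ticks r (m i)) \<le> w i"
          using w(3)[OF i] D_eq[of i] D_eq[of "Suc i"] i unfolding diff_mult_distrib2 by simp
        then show "\<bar>fst z - ?x\<bar> \<le> int (w i) - int (\<rho> * (red_ticks r (m (Suc i)) - red_ticks r (m i)))"
          by (simp del: of_nat_mult)
      qed simp_all
      then show False
        using Suc.prems(2) by linarith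
    qed
  qed
  obtain k where k: "k \<le> n" "fst (\<omega> (int k, 0)) = Blue"
    using seed by blast
  have "?c (m I) (0, 0) = Blue"
  proof (rule blue_fill[OF r, of _ 0 k])
    show "real k \<le> update_time r (m I)"
      using m[of I] k(1) nI by simp
    show "?c (m I) (0 + int j, 0) \<noteq> Red" if "j \<le> k" for j
      using clear[of "(int j, 0)" I] that k(1) by (simp add: X_def)
  qed (use k in simp)
  then show ?thesis
    by (rule final_state_eqI) simp
qed

subsection \<open>Red paths to the origin\<close>

lemma nonempty_left:
  assumes r: "0 < r" and \<rho>: "1 \<le> \<rho>" and B: "(1, 0) \<in> B"
    and right: "final_state B (l1_ball \<rho>) r \<omega> (x + 1, y) \<noteq> Empty"
  shows "final_state B (l1_ball \<rho>) r \<omega> (x, y) \<noteq> Empty"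
proof -
  let ?c = "config B (l1_ball \<rho>) r \<omega>"
  obtain n where n: "\<And>m. n \<le> m \<Longrightarrow> ?c m (x + 1, y) = final_state B (l1_ball \<rho>) r \<omega> (x + 1, y)"
    using final_state_nonemptyE[OF right] by blast
  have late: "n \<le> m" if "update_time r n < update_time r (Suc m)" for m
    using that strict_mono_less[OF strict_mono_update_time[OF r], of n "Suc m"]
    by (simp del: update_time.simps)
  \<comment> \<open>Both neighborhoods contain \<open>(1, 0)\<close>, so whichever color the right
    neighbor ends with, a later tick of that color leaves the site nonempty.\<close>
  have "\<exists>m. ?c (Suc m) (x, y) \<noteq> Empty"
  proof (cases "final_state B (l1_ball \<rho>) r \<omega> (x + 1, y)")
    case Blue
    obtain k where k: "update_time r n < real k"
      using reals_Archimedean2 by blast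
    then have "0 < k"
      using update_time_nonneg[OF r, of n] by (cases k) auto
    then obtain m where m: "update_time r (Suc m) = real k"
      using obtain_blue_index[OF r] by blast
    have "update_time r (Suc m) \<in> blue_times"
      unfolding m blue_times_def using \<open>0 < k\<close> by (intro CollectI exI[of _ k]) simp
    then have "?c (Suc m) (x, y) \<noteq> Empty"
      using config_due_blue[of r m "(1, 0)" B _ \<omega> "(x, y)"] B n[OF late[of m]] k m Blue
      by (simp del: update_time.simps config.simps)
    then show ?thesis ..
  next
    case Red
    obtain k where k: "update_time r n / r < real k"
      using reals_Archimedean2 by blast
    then have "0 < k"
      using divide_nonneg_pos[OF update_time_nonneg[OF r, of n] r] by (cases k) auto
    then obtain m where m: "update_time r (Suc m) = real k * r"
      using obtain_red_index[OF r] by blast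
    have "update_time r (Suc m) \<in> red_times r"
      unfolding m red_times_def using \<open>0 < k\<close> by (intro CollectI exI[of _ k]) simp
    moreover have "(1, 0) \<in> l1_ball \<rho>"
      using \<rho> by (simp add: l1_ball_def)
    moreover have "n \<le> m"
      using late[of m] k m r by (simp add: pos_divide_less_eq del: update_time.simps)
    ultimately have "?c (Suc m) (x, y) \<noteq> Empty"
      using config_due_red[of r m "(1, 0)" "l1_ball \<rho>" B \<omega> "(x, y)"] n[of m] Red
      by (simp del: update_time.simps config.simps)
    then show ?thesis ..
  qed (use right in simp)
  then show ?thesis
    using final_state_eqI by metis
qed

lemma nonempty_if_right_nonempty:
  assumes "0 < r" "1 \<le> \<rho>" "(1, 0) \<in> B" "fst (\<omega> (x + int k, y)) \<noteq> Empty"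
  shows "final_state B (l1_ball \<rho>) r \<omega> (x, y) \<noteq> Empty"
  using assms(4)
proof (induction k arbitrary: x)
  case 0
  then show ?case
    using final_state_eqI[of B _ r \<omega> 0 "(x, y)"] by simp
next
  case (Suc k)
  then have "final_state B (l1_ball \<rho>) r \<omega> (x + 1, y) \<noteq> Empty"
    using Suc.IH[of "x + 1"] by (simp add: add.assoc)
  then show ?case
    by (rule nonempty_left[OF assms(1-3)])
qed

text \<open>The first \<open>n\<close> sites of the ray to the right of a given site are all empty
  with probability \<open>(1 - p - q) ^ n\<close>, which tends to 0, and there are only countably
  many sites.\<close>

lemma AE_nonempty_right:
  assumes pq: "0 \<le> p" "0 \<le> q" "p + q \<le> 1" and pos: "\<not> (p = 0 \<and> q = 0)"
  shows "AE \<omega> in sample_measure p q. \<forall>z. \<exists>k. fst (\<omega> (fst z + int k, snd z)) \<noteq> Empty"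
proof -
  have "AE \<omega> in sample_measure p q. \<exists>k. fst (\<omega> (fst z + int k, snd z)) \<noteq> Empty" for z :: site
  proof -
    let ?s = "\<lambda>k. (fst z + int k, snd z)"
    let ?E = "\<lambda>n \<omega>. \<forall>x\<in>?s ` {..<n}. fst (\<omega> x) = Empty"
    have det: "determined_by (?s ` {..<n}) (?E n)" for n
      by (auto simp: determined_by_def)
    have Pr: "Pr p q (?E n) = (1 - p - q) ^ n" for n
    proof -
      have "inj_on ?s {..<n}" by (auto simp: inj_on_def)
      then have "card (?s ` {..<n}) = n" by (simp add: card_image)
      then show ?thesis
        using Pr_cylinder[of "?s ` {..<n}" p q "\<lambda>_. {Empty}"] initial_pmf_complement[OF pq]
        by simp
    qed
    let ?N = "{\<omega>. \<forall>k. fst (\<omega> (?s k)) = Empty}"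
    have N_eq: "?N = (\<Inter>n. {\<omega>. ?E n \<omega>})" by auto
    have meas: "?N \<in> sets (sample_measure p q)"
      unfolding N_eq using sets_determined_by[OF det] by (intro sets.countable_INT) auto
    have "sample.prob p q ?N \<le> (1 - p - q) ^ n" for n
      unfolding Pr[symmetric] using sets_determined_by[OF det]
      by (intro sample.finite_measure_mono) auto
    moreover have "(\<lambda>n. (1 - p - q) ^ n) \<longlonglongrightarrow> 0"
      using pq pos by (intro LIMSEQ_realpow_zero) auto
    ultimately have "sample.prob p q ?N \<le> 0"
      by (intro LIMSEQ_le_const) auto
    then have "emeasure (sample_measure p q) ?N = 0"
      by (simp add: sample.emeasure_eq_measure measure_le_0_iff)
    then show ?thesis
      using meas by (intro AE_I[of _ _ ?N]) auto
  qed
  then show ?thesis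
    unfolding AE_all_countable by blast
qed

section \<open>The descent of red from a seed to row 0 and its way to the origin\<close>

lemma red_step:
  fixes k :: nat
  assumes r: "0 < r" and red: "\<And>n. real k * r \<le> update_time r n \<Longrightarrow> config B R r \<omega> n (z + b) = Red"
    and b: "b \<in> R"
    and clean: "\<And>n. update_time r n \<le> real (Suc k) * r \<Longrightarrow> config B R r \<omega> n z \<noteq> Blue"
    and n: "real (Suc k) * r \<le> update_time r n"
  shows "config B R r \<omega> n z = Red"
proof -
  let ?c = "config B R r \<omega>"
  obtain m where m: "update_time r (Suc m) = real (Suc k) * r"
    using obtain_red_index[OF r, of "Suc k"] by auto
  \<comment> \<open>The last update before red tick \<open>Suc k\<close> does not precede tick
    \<open>k\<close>, so the neighbor is already red there.\<close>
  have "real k * r \<le> update_time r m"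
  proof (cases "k = 0")
    case False
    then obtain m' where m': "update_time r (Suc m') = real k * r"
      using obtain_red_index[OF r, of k] by auto
    then have "update_time r (Suc m') < update_time r (Suc m)"
      using m r by (simp del: update_time.simps)
    then have "Suc m' \<le> m"
      using strict_mono_less[OF strict_mono_update_time[OF r], of "Suc m'" "Suc m"] by linarith
    then show ?thesis
      using update_time_mono[OF r, of "Suc m'" m] m' by (simp del: update_time.simps)
  qed (use update_time_nonneg[OF r] in simp)
  then have "?c m (z + b) = Red" by (rule red)
  moreover have "update_time r (Suc m) \<in> red_times r"
    unfolding m red_times_def by (rule CollectI, rule exI[of _ "Suc k"]) simp
  ultimately have "?c (Suc m) z \<noteq> Empty"
    using config_due_red b by blast
  moreover have "?c (Suc m) z \<noteq> Blue"
    using clean[of "Suc m"] m by simp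
  ultimately have "?c (Suc m) z = Red"
    using state.exhaust by blast
  moreover have "Suc m \<le> n"
    using n m strict_mono_less_eq[OF strict_mono_update_time[OF r], of "Suc m" n] by metis
  ultimately show ?thesis
    using config_stays by blast
qed

lemma not_blue_if_far:
  assumes r: "0 < r" and time: "update_time r n \<le> real k * r" "k \<le> K"
    and far: "\<And>x'. \<bar>x' - x\<bar> \<le> int (\<tau> * nat \<lfloor>real K * r\<rfloor>) \<Longrightarrow> fst (\<omega> (x', y)) \<noteq> Blue"
  shows "config ({- int \<tau>..int \<tau>} \<times> {0}) R r \<omega> n (x, y) \<noteq> Blue"
proof
  assume "config ({- int \<tau>..int \<tau>} \<times> {0}) R r \<omega> n (x, y) = Blue"
  then obtain x' where x': "fst (\<omega> (x', y)) = Blue" "\<bar>x' - x\<bar> \<le> int (\<tau> * nat \<lfloor>update_time r n\<rfloor>)"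
    using blue_speed[OF r] by blast
  have "update_time r n \<le> real K * r"
    using time r by (meson mult_right_mono of_nat_mono order_trans less_imp_le)
  then have "int (\<tau> * nat \<lfloor>update_time r n\<rfloor>) \<le> int (\<tau> * nat \<lfloor>real K * r\<rfloor>)"
    by (intro of_nat_mono mult_le_mono2 nat_mono floor_mono)
  then show False
    using x' far by (meson order_trans)
qed

text \<open>Red goes down the column of its seed: among the \<rho> rows below its current height one
  has no blue seed close enough to arrive in time, and that row is within one jump. Every jump
  descends by at least 1, so \<open>H\<close> ticks suffice; at most \<open>X\<close> more lead
  along row 0, where blue must therefore be kept away for \<open>H + X\<close> ticks.\<close>

lemma red_reaches_origin:
  fixes x :: int and y H X \<tau> \<rho> :: nat
  assumes r: "0 < r" and \<rho>: "1 \<le> \<rho>" and seed: "fst (\<omega> (x, int y)) = Red"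
    and y: "y \<le> H" and x: "\<bar>x\<bar> \<le> int X"
    and row0: "\<And>x'. \<bar>x'\<bar> \<le> int (X + \<tau> * nat \<lfloor>real (H + X) * r\<rfloor>) \<Longrightarrow> fst (\<omega> (x', 0)) \<noteq> Blue"
    and clean: "\<And>u. u + \<rho> < y \<Longrightarrow> \<exists>k<\<rho>. \<forall>x'. \<bar>x' - x\<bar> \<le> int (\<tau> * nat \<lfloor>real H * r\<rfloor>) \<longrightarrow>
      fst (\<omega> (x', int (u + 1 + k))) \<noteq> Blue"
  shows "final_state ({- int \<tau>..int \<tau>} \<times> {0}) (l1_ball \<rho>) r \<omega> (0, 0) = Red"
proof -
  let ?c = "config ({- int \<tau>..int \<tau>} \<times> {0}) (l1_ball \<rho>) r \<omega>"
  let ?Q = "\<lambda>k z. \<forall>n. real k * r \<le> update_time r n \<longrightarrow> ?c n z = Red"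
  have step: "?Q (Suc k) z" if "?Q k (z + b)" "b \<in> l1_ball \<rho>"
    "\<And>n. update_time r n \<le> real (Suc k) * r \<Longrightarrow> ?c n z \<noteq> Blue" for k z b
  proof (intro allI impI)
    fix n assume n: "real (Suc k) * r \<le> update_time r n"
    show "?c n z = Red"
      by (rule red_step[OF r _ that(2) _ n]) (use that in blast)+
  qed
  have clean0: "?c n (x', 0) \<noteq> Blue" if "\<bar>x'\<bar> \<le> int X" "k \<le> H + X" "update_time r n \<le> real k * r" for n x' k
  proof (rule not_blue_if_far[OF r that(3,2)])
    fix x'' assume "\<bar>x'' - x'\<bar> \<le> int (\<tau> * nat \<lfloor>real (H + X) * r\<rfloor>)"
    then have "\<bar>x''\<bar> \<le> int (X + \<tau> * nat \<lfloor>real (H + X) * r\<rfloor>)"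
      using that(1) by linarith
    then show "fst (\<omega> (x'', 0)) \<noteq> Blue" by (rule row0)
  qed
  \<comment> \<open>Each tick lowers the height by at least 1, so the sum of tick and height never
    exceeds \<open>H\<close>; this keeps the ticks within the range for which the rows are
    clean.\<close>
  have vertical: "\<exists>k'\<le>H. ?Q k' (x, 0)" if "?Q k (x, int y')" "k + y' \<le> H" "y' \<le> y" for k y'
    using that
  proof (induction y' arbitrary: k rule: less_induct)
    case (less y')
    show ?case
    proof (cases "y' \<le> \<rho>")
      case True
      show ?thesis
      proof (cases "y' = 0")
        case False
        have "?Q (Suc k) (x, 0)"
        proof (rule step[of k _ "(0, int y')"])
          show "?c n (x, 0) \<noteq> Blue" if "update_time r n \<le> real (Suc k) * r" for n
            by (rule clean0[OF x _ that]) (use False less.prems in linarith)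
        qed (use True less.prems in \<open>simp_all add: l1_ball_def\<close>)
        moreover have "Suc k \<le> H"
          using False less.prems by linarith
        ultimately show ?thesis by blast
      qed (use less.prems in auto)
    next
      case False
      \<comment> \<open>Chosen so that rows \<open>u + 1\<close> to \<open>u + \<rho>\<close> are
        exactly the \<rho> rows below \<open>y'\<close>; the subtraction does not truncate because
        row 0 is out of reach here.\<close>
      define u where "u = y' - \<rho> - 1"
      have u: "y' = u + \<rho> + 1" using False by (simp add: u_def)
      obtain j where j: "j < \<rho>" "\<And>x'. \<bar>x' - x\<bar> \<le> int (\<tau> * nat \<lfloor>real H * r\<rfloor>) \<Longrightarrow>
          fst (\<omega> (x', int (u + 1 + j))) \<noteq> Blue"
        using clean[of u] u less.prems by (auto simp del: of_nat_add of_nat_mult)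
      have "?Q (Suc k) (x, int (u + 1 + j))"
      proof (rule step[of k _ "(0, int (\<rho> - j))"])
        show "?Q k ((x, int (u + 1 + j)) + (0, int (\<rho> - j)))"
          using less.prems(1) j(1) unfolding u by (simp add: of_nat_diff algebra_simps)
        show "?c n (x, int (u + 1 + j)) \<noteq> Blue" if "update_time r n \<le> real (Suc k) * r" for n
          using less.prems u by (intro not_blue_if_far[where K = H, OF r that] j(2)) linarith+
      qed (simp add: l1_ball_def)
      moreover have "u + 1 + j < y'" "Suc k + (u + 1 + j) \<le> H" "u + 1 + j \<le> y"
        using u j(1) less.prems by linarith+
      ultimately show ?thesis
        using less.IH by blast
    qed
  qed
  have "?Q 0 (x, int y)"
  proof (intro allI impI)
    fix n show "?c n (x, int y) = Red"
      using seed config_stays[of _ _ r \<omega> 0 "(x, int y)" Red n] by simp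
  qed
  then obtain k where k: "k \<le> H" "?Q k (x, 0)"
    using vertical[of 0 y] y by auto
  have horizontal: "\<exists>k'. ?Q k' (0, 0)" if "?Q k (x', 0)" "nat \<bar>x'\<bar> = j" "k + j \<le> H + X" "\<bar>x'\<bar> \<le> int X" for k j x'
    using that
  proof (induction j arbitrary: k x')
    case 0
    then show ?case by auto
  next
    case (Suc j)
    have "?Q (Suc k) (x' - sgn x', 0)"
    proof (rule step[of k _ "(sgn x', 0)"])
      show "(sgn x', 0) \<in> l1_ball \<rho>"
        using \<rho> by (simp add: l1_ball_def sgn_if)
      show "?c n (x' - sgn x', 0) \<noteq> Blue" if "update_time r n \<le> real (Suc k) * r" for n
        by (rule clean0[OF _ _ that]) (use Suc.prems in \<open>auto simp: sgn_if\<close>)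
    qed (use Suc.prems in simp)
    then show ?case
      by (rule Suc.IH) (use Suc.prems in \<open>auto simp: sgn_if split: if_splits\<close>)
  qed
  have "k + nat \<bar>x\<bar> \<le> H + X"
    using k(1) x by linarith
  then obtain k' where k': "?Q k' (0, 0)"
    using horizontal[OF k(2) refl _ x] by blast
  obtain m where "update_time r (Suc m) = real (Suc k') * r"
    using obtain_red_index[OF r, of "Suc k'"] by auto
  then have "?c (Suc m) (0, 0) = Red"
    using k' r by (simp add: algebra_simps del: update_time.simps config.simps)
  then show ?thesis
    by (rule final_state_eqI) simp
qed

subsection \<open>The first red seed\<close>

text \<open>The events that \<open>s\<close> is the first red site of \<open>S\<close> are disjoint,
  with total probability \<open>1 - (1 - q) ^ card S\<close>. Given one of them, the earlier sites
  are only known not to be red, which raises their probability of being blue to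
  \<open>p / (1 - q) \<le> 2 * p\<close>, and sites outside the enumeration up to \<open>s\<close>
  are unaffected. A union bound over the obstacles \<open>Z\<close> therefore costs at most a
  proportion \<epsilon> of each event.\<close>

lemma first_seed_bound:
  fixes S :: "site set" and Zs :: "site \<Rightarrow> site set set"
  assumes pq: "0 \<le> p" "0 \<le> q" "q \<le> 1 / 2" "p + q \<le> 1" and S: "finite S"
    and Zs: "\<And>s. s \<in> S \<Longrightarrow> finite (Zs s)" "\<And>s Z. s \<in> S \<Longrightarrow> Z \<in> Zs s \<Longrightarrow> finite Z"
    and eps: "\<And>s. s \<in> S \<Longrightarrow> (\<Sum>Z\<in>Zs s. (2 * p) ^ card Z) \<le> \<epsilon>"
  shows "(1 - \<epsilon>) * (1 - (1 - q) ^ card S) \<le>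
    Pr p q (\<lambda>\<omega>. \<exists>s\<in>S. fst (\<omega> s) = Red \<and> (\<forall>Z\<in>Zs s. \<exists>z\<in>Z. fst (\<omega> z) \<noteq> Blue))"
proof -
  obtain f where f: "bij_betw f S {..<card S}"
    using ex_bij_betw_finite_nat[OF S] by (auto simp: atLeast0LessThan)
  define pre where "pre s = {t \<in> S. f t < f s}" for s
  define First where "First s \<omega> \<longleftrightarrow> fst (\<omega> s) = Red \<and> (\<forall>t\<in>pre s. fst (\<omega> t) \<noteq> Red)" for s and \<omega> :: sample
  define G where "G s \<omega> \<longleftrightarrow> First s \<omega> \<and> (\<forall>Z\<in>Zs s. \<exists>z\<in>Z. fst (\<omega> z) \<noteq> Blue)" for s \<omega>
  have fin_pre: "finite (pre s)" and notin_pre: "s \<notin> pre s" for s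
    using S by (auto simp: pre_def)
  have card_pre: "card (pre s) = f s" if "s \<in> S" for s
  proof -
    have "f ` pre s = {..<f s}"
    proof
      show "{..<f s} \<subseteq> f ` pre s"
      proof
        fix i assume i: "i \<in> {..<f s}"
        moreover have "f s < card S"
          using f that by (auto simp: bij_betw_def)
        ultimately have "i \<in> f ` S"
          using f by (auto simp: bij_betw_def)
        then show "i \<in> f ` pre s"
          using i by (auto simp: pre_def)
      qed
    qed (auto simp: pre_def)
    moreover have "inj_on f (pre s)"
      using f by (auto simp: bij_betw_def pre_def intro: inj_on_subset)
    ultimately show ?thesis
      by (metis card_image card_lessThan)
  qed
  have det_First: "determined_by (insert s (pre s)) (First s)" for s
    by (auto simp: determined_by_def First_def)
  have sets_First: "{\<omega>. First s \<omega>} \<in> sets (sample_measure p q)" for s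
    using sets_determined_by[OF det_First] fin_pre by simp
  have det_G: "determined_by (insert s (pre s) \<union> \<Union>(Zs s)) (G s)" for s
  proof (rule determined_byI)
    fix \<omega> \<omega>' :: sample assume eq: "\<And>z. z \<in> insert s (pre s) \<union> \<Union>(Zs s) \<Longrightarrow> \<omega> z = \<omega>' z"
    then have "First s \<omega> = First s \<omega>'"
      using det_First[of s] unfolding determined_by_def by (metis UnCI)
    then show "G s \<omega> = G s \<omega>'"
      unfolding G_def using eq by (metis (no_types, lifting) UnCI UnionI)
  qed
  have sets_G: "{\<omega>. G s \<omega>} \<in> sets (sample_measure p q)" if "s \<in> S" for s
    using sets_determined_by[OF det_G] fin_pre Zs that by (metis finite_Un finite_Union finite_insert)
  have Pr_First: "Pr p q (First s) = q * (1 - q) ^ f s" if "s \<in> S" for s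
  proof -
    have "Pr p q (First s) = Pr p q (\<lambda>\<omega>. \<forall>z\<in>insert s (pre s). fst (\<omega> z) \<in> (if z = s then {Red} else - {Red}))"
      by (rule arg_cong[where f = "measure _"]) (use notin_pre in \<open>auto simp: First_def\<close>)
    also have "\<dots> = q * (\<Prod>z\<in>pre s. measure (initial_pmf p q) (if z = s then {Red} else - {Red}))"
      using fin_pre notin_pre initial_pmf_complement[OF pq(1,2,4)] by (subst Pr_cylinder) auto
    also have "(\<Prod>z\<in>pre s. measure (initial_pmf p q) (if z = s then {Red} else - {Red})) = (\<Prod>z\<in>pre s. 1 - q)"
      using notin_pre initial_pmf_complement[OF pq(1,2,4)] by (intro prod.cong) auto
    finally show ?thesis by (simp add: card_pre[OF that])
  qed
  have blocked: "Pr p q (\<lambda>\<omega>. First s \<omega> \<and> (\<forall>z\<in>Z. fst (\<omega> z) = Blue)) \<le> (2 * p) ^ card Z * Pr p q (First s)"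
    if s: "s \<in> S" and Z: "finite Z" for s Z
  proof (cases "s \<in> Z")
    case True
    then have "{\<omega>. First s \<omega> \<and> (\<forall>z\<in>Z. fst (\<omega> z) = Blue)} = {}"
      by (auto simp: First_def)
    then have "Pr p q (\<lambda>\<omega>. First s \<omega> \<and> (\<forall>z\<in>Z. fst (\<omega> z) = Blue)) = 0"
      by (simp only: measure_empty)
    then show ?thesis using pq by simp
  next
    case False
    let ?A = "\<lambda>z. if z = s then {Red} else if z \<in> Z then {Blue} else - {Red}"
    have fin: "finite (Z \<union> (pre s - Z))" and notin: "s \<notin> Z \<union> (pre s - Z)"
      using Z fin_pre False notin_pre by auto
    have "Pr p q (\<lambda>\<omega>. First s \<omega> \<and> (\<forall>z\<in>Z. fst (\<omega> z) = Blue))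
        \<le> Pr p q (\<lambda>\<omega>. \<forall>z\<in>insert s (Z \<union> (pre s - Z)). fst (\<omega> z) \<in> ?A z)"
      by (rule Pr_mono[where L = "insert s (Z \<union> (pre s - Z))"])
        (use fin in \<open>auto simp: First_def determined_by_def\<close>)
    also have "\<dots> = q * (\<Prod>z\<in>Z \<union> (pre s - Z). measure (initial_pmf p q) (?A z))"
      using fin notin initial_pmf_complement[OF pq(1,2,4)] by (subst Pr_cylinder) auto
    also have "(\<Prod>z\<in>Z \<union> (pre s - Z). measure (initial_pmf p q) (?A z))
        = (\<Prod>z\<in>Z. measure (initial_pmf p q) (?A z)) * (\<Prod>z\<in>pre s - Z. measure (initial_pmf p q) (?A z))"
      using Z fin_pre by (intro prod.union_disjoint) auto
    also have "(\<Prod>z\<in>Z. measure (initial_pmf p q) (?A z)) = (\<Prod>z\<in>Z. p)"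
      using False initial_pmf_complement[OF pq(1,2,4)] by (intro prod.cong) auto
    also have "(\<Prod>z\<in>pre s - Z. measure (initial_pmf p q) (?A z)) = (\<Prod>z\<in>pre s - Z. 1 - q)"
      using notin_pre initial_pmf_complement[OF pq(1,2,4)] by (intro prod.cong) auto
    \<comment> \<open>Fixing the colors on \<open>Z\<close> drops at most \<open>card Z\<close> of
      the factors \<open>1 - q\<close>, each of which is at least 1/2.\<close>
    also have "(\<Prod>z\<in>pre s - Z. 1 - q) \<le> 2 ^ card Z * (1 - q) ^ f s"
    proof -
      have "f s \<le> card Z + card (pre s - Z)"
        using card_pre[OF s] diff_card_le_card_Diff[OF Z, of "pre s"] by linarith
      then have power_le: "(1 - q) ^ (card Z + card (pre s - Z)) \<le> (1 - q) ^ f s"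
        using pq by (intro power_decreasing) auto
      have "1 \<le> (2 * (1 - q)) ^ card Z"
        using pq by (intro one_le_power) auto
      then have "(1 - q) ^ card (pre s - Z) \<le> (2 * (1 - q)) ^ card Z * (1 - q) ^ card (pre s - Z)"
        using mult_right_mono[of 1 "(2 * (1 - q)) ^ card Z" "(1 - q) ^ card (pre s - Z)"] pq by simp
      also have "\<dots> = 2 ^ card Z * (1 - q) ^ (card Z + card (pre s - Z))"
        by (simp only: power_mult_distrib power_add mult.assoc)
      also have "\<dots> \<le> 2 ^ card Z * (1 - q) ^ f s"
        by (intro mult_left_mono power_le) simp
      finally have "(1 - q) ^ card (pre s - Z) \<le> 2 ^ card Z * (1 - q) ^ f s" .
      then show ?thesis by simp
    qed
    finally have "Pr p q (\<lambda>\<omega>. First s \<omega> \<and> (\<forall>z\<in>Z. fst (\<omega> z) = Blue))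
        \<le> q * ((\<Prod>z\<in>Z. p) * (2 ^ card Z * (1 - q) ^ f s))"
      using pq by (auto simp: mult_left_mono)
    also have "\<dots> = (2 * p) ^ card Z * Pr p q (First s)"
      using Pr_First[OF s] by (simp add: power_mult_distrib)
    finally show ?thesis .
  qed
  have Pr_G: "(1 - \<epsilon>) * Pr p q (First s) \<le> Pr p q (G s)" if s: "s \<in> S" for s
  proof -
    let ?A = "\<lambda>Z \<omega>. First s \<omega> \<and> (\<forall>z\<in>Z. fst (\<omega> z) = Blue)"
    have sets_A: "{\<omega>. ?A Z \<omega>} \<in> sets (sample_measure p q)" if "Z \<in> Zs s" for Z
      by (rule sets_determined_by[where K = "insert s (pre s) \<union> Z"])
        (use fin_pre Zs(2)[OF s that] in \<open>auto simp: First_def determined_by_def\<close>)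
    have "Pr p q (First s) \<le> Pr p q (\<lambda>\<omega>. G s \<omega> \<or> (\<exists>Z\<in>Zs s. ?A Z \<omega>))"
    proof (rule sample.finite_measure_mono)
      have "{\<omega>. G s \<omega> \<or> (\<exists>Z\<in>Zs s. ?A Z \<omega>)} = {\<omega>. G s \<omega>} \<union> (\<Union>Z\<in>Zs s. {\<omega>. ?A Z \<omega>})"
        by auto
      then show "{\<omega>. G s \<omega> \<or> (\<exists>Z\<in>Zs s. ?A Z \<omega>)} \<in> sets (sample_measure p q)"
        using sets_A sets_G[OF s] Zs(1)[OF s] by (simp only:) (intro sets.Un sets.finite_UN)
    qed (auto simp: G_def)
    also have "{\<omega>. G s \<omega> \<or> (\<exists>Z\<in>Zs s. ?A Z \<omega>)} = {\<omega>. G s \<omega>} \<union> {\<omega>. \<exists>Z\<in>Zs s. ?A Z \<omega>}"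
      by auto
    also have "sample.prob p q \<dots> \<le> Pr p q (G s) + Pr p q (\<lambda>\<omega>. \<exists>Z\<in>Zs s. ?A Z \<omega>)"
    proof (rule measure_Un_le)
      have "{\<omega>. \<exists>Z\<in>Zs s. ?A Z \<omega>} = (\<Union>Z\<in>Zs s. {\<omega>. ?A Z \<omega>})"
        by auto
      then show "{\<omega>. \<exists>Z\<in>Zs s. ?A Z \<omega>} \<in> sets (sample_measure p q)"
        using sets_A Zs(1)[OF s] by (simp only:) (intro sets.finite_UN)
    qed (rule sets_G[OF s])
    also have "Pr p q (\<lambda>\<omega>. \<exists>Z\<in>Zs s. ?A Z \<omega>) \<le> (\<Sum>Z\<in>Zs s. Pr p q (?A Z))"
      by (rule Pr_bex_le[OF Zs(1)[OF s] sets_A])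
    also have "\<dots> \<le> (\<Sum>Z\<in>Zs s. (2 * p) ^ card Z * Pr p q (First s))"
      by (intro sum_mono blocked[OF s] Zs(2)[OF s])
    also have "\<dots> = (\<Sum>Z\<in>Zs s. (2 * p) ^ card Z) * Pr p q (First s)"
      by (simp add: sum_distrib_right)
    also have "\<dots> \<le> \<epsilon> * Pr p q (First s)"
      by (intro mult_right_mono eps[OF s]) simp
    finally show ?thesis by (simp add: algebra_simps)
  qed
  have disj: "disjoint_family_on (\<lambda>s. {\<omega>. G s \<omega>}) S"
    unfolding disjoint_family_on_def
  proof (intro ballI impI)
    fix s t assume st: "s \<in> S" "t \<in> S" "s \<noteq> t"
    then have "f s \<noteq> f t"
      using f by (auto simp: bij_betw_def inj_on_def)
    then have "s \<in> pre t \<or> t \<in> pre s"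
      using st by (auto simp: pre_def)
    then show "{\<omega>. G s \<omega>} \<inter> {\<omega>. G t \<omega>} = {}"
      by (auto simp: G_def First_def)
  qed
  have "(1 - \<epsilon>) * (1 - (1 - q) ^ card S) = (1 - \<epsilon>) * (\<Sum>i<card S. q * (1 - q) ^ i)"
    using one_diff_power_eq[of "1 - q" "card S"] by (simp add: sum_distrib_left)
  also have "(\<Sum>i<card S. q * (1 - q) ^ i) = (\<Sum>s\<in>S. Pr p q (First s))"
    using sum.reindex_bij_betw[OF f, of "\<lambda>i. q * (1 - q) ^ i"] Pr_First by simp
  also have "(1 - \<epsilon>) * \<dots> \<le> (\<Sum>s\<in>S. Pr p q (G s))"
    unfolding sum_distrib_left by (rule sum_mono) (rule Pr_G)
  also have "\<dots> = sample.prob p q (\<Union>s\<in>S. {\<omega>. G s \<omega>})"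
    using sets_G disj S by (intro sample.finite_measure_finite_Union[symmetric]) auto
  also have "\<dots> \<le> Pr p q (\<lambda>\<omega>. \<exists>s\<in>S. fst (\<omega> s) = Red \<and> (\<forall>Z\<in>Zs s. \<exists>z\<in>Z. fst (\<omega> z) \<noteq> Blue))"
  proof (rule sample.finite_measure_mono)
    have det: "determined_by (S \<union> (\<Union>s\<in>S. \<Union>(Zs s)))
        (\<lambda>\<omega>. \<exists>s\<in>S. fst (\<omega> s) = Red \<and> (\<forall>Z\<in>Zs s. \<exists>z\<in>Z. fst (\<omega> z) \<noteq> Blue))"
    proof (rule determined_byI)
      fix \<omega> \<omega>' :: sample assume eq: "\<And>z. z \<in> S \<union> (\<Union>s\<in>S. \<Union>(Zs s)) \<Longrightarrow> \<omega> z = \<omega>' z"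
      have "\<omega> s = \<omega>' s" "Z \<in> Zs s \<Longrightarrow> z \<in> Z \<Longrightarrow> \<omega> z = \<omega>' z" if "s \<in> S" for s Z z
        using that by (auto intro!: eq)
      then show "(\<exists>s\<in>S. fst (\<omega> s) = Red \<and> (\<forall>Z\<in>Zs s. \<exists>z\<in>Z. fst (\<omega> z) \<noteq> Blue)) =
          (\<exists>s\<in>S. fst (\<omega>' s) = Red \<and> (\<forall>Z\<in>Zs s. \<exists>z\<in>Z. fst (\<omega>' z) \<noteq> Blue))"
        by (intro bex_cong conj_cong ball_cong refl) simp_all
    qed
    show "{\<omega>. \<exists>s\<in>S. fst (\<omega> s) = Red \<and> (\<forall>Z\<in>Zs s. \<exists>z\<in>Z. fst (\<omega> z) \<noteq> Blue)} \<in> sets (sample_measure p q)"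
      by (rule sets_determined_by[OF det]) (use S Zs in auto)
  qed (auto simp: G_def First_def)
  finally show ?thesis .
qed

text \<open>\<open>first_seed_bound\<close> is applied to the seeds in a box above row 0. The
  obstacles are the single blue sites of row 0 that could interfere, and the sets of \<rho> blue
  sites, one in each of \<rho> consecutive rows, that could close a barrier. If none of them is blue
  throughout, \<open>red_reaches_origin\<close> applies to the seed found.\<close>

lemma blue_prob_le:
  fixes \<rho> \<tau> H X :: nat and r :: real
  defines "n \<equiv> X + \<tau> * nat \<lfloor>real (H + X) * r\<rfloor>" and "D \<equiv> \<tau> * nat \<lfloor>real H * r\<rfloor>"
  assumes r: "0 < r" and \<rho>: "1 \<le> \<rho>" and pq: "0 \<le> p" "0 \<le> q" "q \<le> 1 / 2" "p + q \<le> 1"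
  shows "blue_prob ({- int \<tau>..int \<tau>} \<times> {0}) (l1_ball \<rho>) r p q \<le>
    1 - (1 - ((2 * real n + 1) * (2 * p) + real H * ((2 * real D + 1) * (2 * p)) ^ \<rho>)) *
      (1 - (1 - q) ^ ((2 * X + 1) * H))"
proof -
  define S where "S = {- int X..int X} \<times> int ` {1..H}"
  define Z0 where "Z0 = (\<lambda>x. {(x, 0::int)}) ` {- int n..int n}"
  define Z1 where "Z1 x = (\<lambda>(u, g). (\<lambda>k. (g k, int (u + 1 + k))) ` {..<\<rho>}) `
    ({..<H} \<times> ({..<\<rho>} \<rightarrow>\<^sub>E {x - int D..x + int D}))" for x :: int
  define Zs where "Zs s = Z0 \<union> Z1 (fst s)" for s :: site
  let ?good = "\<lambda>\<omega>. \<exists>s\<in>S. fst (\<omega> s) = Red \<and> (\<forall>Z\<in>Zs s. \<exists>z\<in>Z. fst (\<omega> z) \<noteq> Blue)"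
  let ?F = "{\<omega>. final_state ({- int \<tau>..int \<tau>} \<times> {0}) (l1_ball \<rho>) r \<omega> (0, 0) = Blue}"
  have card_S: "card S = (2 * X + 1) * H"
  proof -
    have "card {- int X..int X} = 2 * X + 1"
      by (subst card_atLeastAtMost_int) linarith
    then show ?thesis
      by (simp add: S_def card_cartesian_product card_image)
  qed
  have fin_Z1: "finite (Z1 x)" for x
    unfolding Z1_def by (intro finite_imageI finite_cartesian_product finite_PiE) auto
  have card_Z1: "card (Z1 x) \<le> H * (2 * D + 1) ^ \<rho>" for x
  proof -
    have "card (Z1 x) \<le> card ({..<H} \<times> ({..<\<rho>} \<rightarrow>\<^sub>E {x - int D..x + int D}))"
      unfolding Z1_def by (intro card_image_le finite_cartesian_product finite_PiE) auto
    also have "\<dots> = H * (2 * D + 1) ^ \<rho>"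
      by (simp add: card_cartesian_product card_PiE nat_add_distrib nat_mult_distrib)
    finally show ?thesis .
  qed
  have Z1_card: "card Z = \<rho>" if "Z \<in> Z1 x" for Z x
  proof -
    obtain u g where "Z = (\<lambda>k. (g k, int (u + 1 + k))) ` {..<\<rho>}"
      using \<open>Z \<in> Z1 x\<close> by (auto simp: Z1_def)
    moreover have "inj_on (\<lambda>k. (g k, int (u + 1 + k))) {..<\<rho>}"
      by (auto simp: inj_on_def)
    ultimately show ?thesis by (simp add: card_image)
  qed
  have "(1 - ((2 * real n + 1) * (2 * p) + real H * ((2 * real D + 1) * (2 * p)) ^ \<rho>)) *
      (1 - (1 - q) ^ card S) \<le> Pr p q ?good"
  proof (rule first_seed_bound[OF pq])
    fix s assume "s \<in> S"
    have "(\<Sum>Z\<in>Zs s. (2 * p) ^ card Z) \<le> (\<Sum>Z\<in>Z0. (2 * p) ^ card Z) + (\<Sum>Z\<in>Z1 (fst s). (2 * p) ^ card Z)"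
      unfolding Zs_def using fin_Z1 pq by (subst sum_Un) (auto simp: Z0_def intro!: sum_nonneg)
    moreover have "(\<Sum>Z\<in>Z0. (2 * p) ^ card Z) = (2 * real n + 1) * (2 * p)"
    proof -
      have "(\<Sum>Z\<in>Z0. (2 * p) ^ card Z) = (\<Sum>x\<in>{- int n..int n}. 2 * p)"
        unfolding Z0_def by (subst sum.reindex) (auto simp: inj_on_def)
      then show ?thesis by (simp add: algebra_simps)
    qed
    moreover have "(\<Sum>Z\<in>Z1 (fst s). (2 * p) ^ card Z) \<le> real H * ((2 * real D + 1) * (2 * p)) ^ \<rho>"
    proof -
      have "(\<Sum>Z\<in>Z1 (fst s). (2 * p) ^ card Z) = real (card (Z1 (fst s))) * (2 * p) ^ \<rho>"
        by (simp add: Z1_card)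
      also have "\<dots> \<le> real (H * (2 * D + 1) ^ \<rho>) * (2 * p) ^ \<rho>"
        using pq card_Z1 by (intro mult_right_mono of_nat_mono) auto
      also have "\<dots> = real H * ((2 * real D + 1) * (2 * p)) ^ \<rho>"
        by (simp add: power_mult_distrib add.commute mult.commute)
      finally show ?thesis .
    qed
    ultimately show "(\<Sum>Z\<in>Zs s. (2 * p) ^ card Z) \<le>
        (2 * real n + 1) * (2 * p) + real H * ((2 * real D + 1) * (2 * p)) ^ \<rho>"
      by linarith
  next
    show "finite (Zs s)" for s
      using fin_Z1 by (simp add: Zs_def Z0_def)
    show "finite Z" if "Z \<in> Zs s" for Z s
      using that by (auto simp: Zs_def Z0_def Z1_def)
  qed (simp add: S_def)
  moreover have "Pr p q ?good \<le> sample.prob p q (space (sample_measure p q) - ?F)"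
  proof (rule sample.finite_measure_mono)
    show "space (sample_measure p q) - ?F \<in> sets (sample_measure p q)"
      by (intro sets.compl_sets sets_final_state)
    show "{\<omega>. ?good \<omega>} \<subseteq> space (sample_measure p q) - ?F"
    proof
      fix \<omega> :: sample assume "\<omega> \<in> {\<omega>. ?good \<omega>}"
      then obtain s where s: "s \<in> S" "fst (\<omega> s) = Red" "\<forall>Z\<in>Zs s. \<exists>z\<in>Z. fst (\<omega> z) \<noteq> Blue"
        by blast
      then obtain x y where xy: "s = (x, int y)" "\<bar>x\<bar> \<le> int X" "y \<le> H"
        by (force simp: S_def)
      have "final_state ({- int \<tau>..int \<tau>} \<times> {0}) (l1_ball \<rho>) r \<omega> (0, 0) = Red"
      proof (rule red_reaches_origin[OF r \<rho> _ xy(3,2)])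
        show "fst (\<omega> (x, int y)) = Red" using s xy by simp
      next
        fix x' assume "\<bar>x'\<bar> \<le> int (X + \<tau> * nat \<lfloor>real (H + X) * r\<rfloor>)"
        then have "x' \<in> {- int n..int n}"
          unfolding n_def by auto
        then have "{(x', 0)} \<in> Zs s"
          by (auto simp: Zs_def Z0_def)
        then show "fst (\<omega> (x', 0)) \<noteq> Blue"
          using s(3) by blast
      next
        fix u assume u: "u + \<rho> < y"
        show "\<exists>k<\<rho>. \<forall>x'. \<bar>x' - x\<bar> \<le> int (\<tau> * nat \<lfloor>real H * r\<rfloor>) \<longrightarrow> fst (\<omega> (x', int (u + 1 + k))) \<noteq> Blue"
        proof (rule ccontr)
          assume "\<not> ?thesis"
          \<comment> \<open>A blue site within reach in every one of the \<rho> rows would make up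
            an entirely blue obstacle of \<open>Z1 x\<close>.\<close>
          then have "\<forall>k\<in>{..<\<rho>}. \<exists>x'. \<bar>x' - x\<bar> \<le> int D \<and> fst (\<omega> (x', int (u + 1 + k))) = Blue"
            unfolding D_def by blast
          then obtain g where g: "\<forall>k\<in>{..<\<rho>}. \<bar>g k - x\<bar> \<le> int D \<and> fst (\<omega> (g k, int (u + 1 + k))) = Blue"
            using bchoice[of "{..<\<rho>}"] by metis
          let ?g = "restrict g {..<\<rho>}"
          have "?g \<in> {..<\<rho>} \<rightarrow>\<^sub>E {x - int D..x + int D}"
            unfolding restrict_PiE_iff
          proof
            fix k assume "k \<in> {..<\<rho>}"
            then have "\<bar>g k - x\<bar> \<le> int D" using g by blast
            then show "g k \<in> {x - int D..x + int D}" by simp linarith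
          qed
          moreover have "u \<in> {..<H}"
            using u xy by auto
          ultimately have "(u, ?g) \<in> {..<H} \<times> ({..<\<rho>} \<rightarrow>\<^sub>E {x - int D..x + int D})"
            by (rule SigmaI[rotated])
          then have "(\<lambda>k. (?g k, int (u + 1 + k))) ` {..<\<rho>} \<in> Z1 x"
            unfolding Z1_def by (rule rev_image_eqI) simp
          then have "\<exists>z\<in>(\<lambda>k. (?g k, int (u + 1 + k))) ` {..<\<rho>}. fst (\<omega> z) \<noteq> Blue"
            using s(3) unfolding Zs_def xy(1) fst_conv by blast
          then obtain k where "k < \<rho>" "fst (\<omega> (?g k, int (u + 1 + k))) \<noteq> Blue"
            by blast
          then show False
            using g by auto
        qed
      qed
      then show "\<omega> \<in> space (sample_measure p q) - ?F"
        by (simp add: space_sample_measure)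
    qed
  qed
  moreover have "sample.prob p q (space (sample_measure p q) - ?F) = 1 - sample.prob p q ?F"
    by (rule sample.prob_compl[OF sets_final_state])
  ultimately show ?thesis
    unfolding blue_prob_def card_S by linarith
qed

subsection \<open>Scaling and the upper bound on blue\<close>

text \<open>The positive solution \<open>h\<close> of
  \<open>h * (p * h) ^ \<rho> = 1\<close>.\<close>

definition height_scale :: "nat \<Rightarrow> real \<Rightarrow> real" where
  "height_scale \<rho> p = p powr (- (real \<rho> / (real \<rho> + 1)))"

lemma height_scale_pos: "0 < p \<Longrightarrow> 0 < height_scale \<rho> p"
  by (simp add: height_scale_def)

lemma height_scale_power:
  assumes "0 < p"
  shows "height_scale \<rho> p ^ (\<rho> + 1) * p ^ \<rho> = 1"
proof -
  have "height_scale \<rho> p ^ (\<rho> + 1) = p powr (- (real \<rho> / (real \<rho> + 1)) * real (\<rho> + 1))"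
    unfolding powr_realpow[OF height_scale_pos[OF assms], symmetric] by (simp add: height_scale_def powr_powr)
  also have "- (real \<rho> / (real \<rho> + 1)) * real (\<rho> + 1) = - real \<rho>"
    by (simp add: field_simps)
  finally show ?thesis
    using assms by (simp add: powr_minus powr_realpow)
qed

lemma height_scale_red:
  assumes "0 < p"
  shows "a * p powr (1 + real \<rho> / (real \<rho> + 1)) * height_scale \<rho> p = a * p"
proof -
  have "p powr (1 + real \<rho> / (real \<rho> + 1)) * height_scale \<rho> p = p powr 1"
    unfolding height_scale_def powr_add[symmetric] by simp
  then show ?thesis using assms by simp
qed

text \<open>Together with the next limit: the heights grow without bound, which makes rounding
  harmless, but stay small against the horizontal scale \<open>1 / p\<close>.\<close>

lemma height_scale_at_top:
  assumes "1 \<le> \<rho>"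
  shows "filterlim (height_scale \<rho>) at_top (at_right 0)"
proof -
  have "0 < real \<rho> / (real \<rho> + 1)" using assms by simp
  then show ?thesis
    unfolding height_scale_def by real_asymp
qed

lemma p_height_scale_tendsto:
  "((\<lambda>p. p * height_scale \<rho> p) \<longlongrightarrow> 0) (at_right 0)"
proof -
  have "real \<rho> / (real \<rho> + 1) < 1" by simp
  then show ?thesis
    unfolding height_scale_def by real_asymp
qed

lemma red_density_tendsto:
  "((\<lambda>p. a * p powr (1 + real \<rho> / (real \<rho> + 1))) \<longlongrightarrow> 0) (at_right 0)"
proof -
  have "0 < 1 + real \<rho> / (real \<rho> + 1)"
    by (simp add: add_pos_nonneg)
  then show ?thesis by real_asymp
qed

lemma eventually_densities:
  assumes "0 < a"
  shows "\<forall>\<^sub>F p in at_right 0. 0 < p \<and> 0 < a * p powr (1 + real \<rho> / (real \<rho> + 1)) \<and>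
    p \<le> 1 / 2 \<and> a * p powr (1 + real \<rho> / (real \<rho> + 1)) \<le> 1 / 2"
proof -
  have "\<forall>\<^sub>F p in at_right 0. a * p powr (1 + real \<rho> / (real \<rho> + 1)) < 1 / 2"
    using order_tendstoD(2)[OF red_density_tendsto, of "1 / 2"] by simp
  moreover have "\<forall>\<^sub>F p in at_right (0::real). 0 < p \<and> p < 1 / 2"
    unfolding eventually_at_right_field by (intro exI[of _ "1 / 2"]) auto
  ultimately show ?thesis
    by eventually_elim (use assms in auto)
qed

lemma one_minus_power_le_exp:
  fixes x :: real
  assumes "0 \<le> x" "x \<le> 1"
  shows "(1 - x) ^ n \<le> exp (- (real n * x))"
proof -
  have "(1 - x) ^ n \<le> exp (- x) ^ n"
    using assms exp_ge_add_one_self[of "- x"] by (intro power_mono) auto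
  then show ?thesis by (simp add: exp_of_nat_mult[symmetric])
qed

text \<open>The box has width of order \<open>c / p\<close> and height \<open>K * h\<close>. For
  suitably small \<open>c\<close> and \<open>K\<close> the obstacles cost at most \<epsilon>, while
  the expected number of red seeds in the box is at least \<open>a * (c * K / 2)\<close>; so
  \<kappa> is \<open>c * K / 2\<close>, independent of \<open>a\<close>.\<close>

lemma eventually_blue_prob_le:
  fixes \<rho> \<tau> :: nat and r \<epsilon> :: real
  assumes r: "0 < r" and \<rho>: "1 \<le> \<rho>" and \<epsilon>: "0 < \<epsilon>" "\<epsilon> \<le> 1"
  obtains \<kappa> where "0 < \<kappa>" "\<And>a. 0 < a \<Longrightarrow> \<forall>\<^sub>F p in at_right 0.
    blue_prob ({- int \<tau>..int \<tau>} \<times> {0}) (l1_ball \<rho>) r p (a * p powr (1 + real \<rho> / (real \<rho> + 1)))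
      \<le> 1 - (1 - \<epsilon>) * (1 - exp (- (a * \<kappa>)))"
proof -
  \<comment> \<open>\<open>9 * c * (1 + \<tau> * r)\<close> will bound the term of row 0: 8 of the 9
    come from \<open>n\<close> and one from \<open>2 * p < c\<close>.
    \<open>K * (4 * \<tau> * r + 2) ^ \<rho>\<close> will bound the term of the barriers. Each gets
    half of \<epsilon>.\<close>
  define c where "c = \<epsilon> / (18 * (1 + \<tau> * r))"
  define K where "K = min 1 (\<epsilon> / (2 * (4 * \<tau> * r + 2) ^ \<rho>))"
  have tr: "0 \<le> \<tau> * r" using r by simp
  have c: "0 < c" unfolding c_def using \<epsilon> tr by (intro divide_pos_pos) auto
  have K: "0 < K" "K \<le> 1" "K * (4 * \<tau> * r + 2) ^ \<rho> \<le> \<epsilon> / 2"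
  proof -
    have pos: "0 < (4 * \<tau> * r + 2) ^ \<rho>" using tr by (intro zero_less_power) auto
    then show "0 < K" "K \<le> 1" using \<epsilon> by (auto simp: K_def)
    have "K * (4 * \<tau> * r + 2) ^ \<rho> \<le> \<epsilon> / (2 * (4 * \<tau> * r + 2) ^ \<rho>) * (4 * \<tau> * r + 2) ^ \<rho>"
      using pos by (intro mult_right_mono) (auto simp: K_def)
    also have "\<dots> = \<epsilon> / 2" using less_imp_neq[OF pos] by (simp del: power_eq_0_iff)
    finally show "K * (4 * \<tau> * r + 2) ^ \<rho> \<le> \<epsilon> / 2" .
  qed
  have c_eq: "9 * c * (1 + \<tau> * r) = \<epsilon> / 2"
    unfolding c_def using tr by (simp add: field_simps add_pos_nonneg)
  show ?thesis
  proof (rule that)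
    show "0 < c * K / 2" using c K by simp
  next
    fix a :: real assume a: "0 < a"
    have "\<forall>\<^sub>F p in at_right 0. 2 / K \<le> height_scale \<rho> p"
      using height_scale_at_top[OF \<rho>] by (simp add: filterlim_at_top)
    moreover have "\<forall>\<^sub>F p in at_right 0. p * height_scale \<rho> p < c / 1"
      using order_tendstoD(2)[OF p_height_scale_tendsto] c by simp
    moreover have "\<forall>\<^sub>F p in at_right (0::real). p < c / 2"
      unfolding eventually_at_right_field using c by (intro exI[of _ "c / 2"]) auto
    ultimately show "\<forall>\<^sub>F p in at_right 0.
      blue_prob ({- int \<tau>..int \<tau>} \<times> {0}) (l1_ball \<rho>) r p (a * p powr (1 + real \<rho> / (real \<rho> + 1)))
        \<le> 1 - (1 - \<epsilon>) * (1 - exp (- (a * (c * K / 2))))"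
      using eventually_densities[OF a, of \<rho>]
    proof eventually_elim
      case (elim p)
      define h where "h = height_scale \<rho> p"
      define q where "q = a * p powr (1 + real \<rho> / (real \<rho> + 1))"
      define H where "H = nat \<lfloor>K * h\<rfloor>"
      define X where "X = nat \<lfloor>c / p\<rfloor>"
      define n where "n = X + \<tau> * nat \<lfloor>real (H + X) * r\<rfloor>"
      define D where "D = \<tau> * nat \<lfloor>real H * r\<rfloor>"
      have p: "0 < p" "p \<le> 1 / 2" "p < c / 2" and q: "0 < q" "q \<le> 1 / 2" "q * h = a * p"
        and h: "2 / K \<le> h" "p * h < c"
        using elim height_scale_red[of p a \<rho>] by (simp_all add: q_def h_def)
      have h2: "2 \<le> K * h" using h(1) K by (simp add: field_simps)
      then have h1: "1 \<le> h" using K mult_right_mono[of K 1 h] by (smt (verit) mult_nonneg_nonpos)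
      have H: "real H \<le> K * h" "K * h / 2 \<le> real H"
        using h2 unfolding H_def by linarith+
      have cp: "2 \<le> c / p" using p by (simp add: field_simps)
      have X: "real X \<le> c / p" "c / p \<le> 2 * real X + 1"
        using cp unfolding X_def by linarith+
      have n_le: "real n \<le> (real X + real H) * (1 + \<tau> * r)"
      proof -
        have "real (nat \<lfloor>real (H + X) * r\<rfloor>) \<le> real (H + X) * r"
          using r by (intro of_nat_floor) auto
        then have "real \<tau> * real (nat \<lfloor>real (H + X) * r\<rfloor>) \<le> real \<tau> * (real (H + X) * r)"
          by (intro mult_left_mono) auto
        then have "real n \<le> real X + real \<tau> * (real (H + X) * r)"
          unfolding n_def by simp
        also have "\<dots> \<le> (real X + real H) * (1 + \<tau> * r)"
          by (simp add: algebra_simps)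
        finally show ?thesis .
      qed
      have "p * real X \<le> c"
        using X(1) p by (simp add: field_simps)
      moreover have "p * real H \<le> c"
      proof -
        have "p * real H \<le> p * (1 * h)"
          using H(1) K h1 p by (intro mult_left_mono order_trans[OF H(1)] mult_right_mono) auto
        then show ?thesis using h(2) by simp
      qed
      ultimately have sum_le: "p * (real X + real H) \<le> 2 * c"
        by (simp add: distrib_left)
      have "p * real n \<le> p * ((real X + real H) * (1 + \<tau> * r))"
        using n_le p by (intro mult_left_mono) auto
      also have "\<dots> \<le> 2 * c * (1 + \<tau> * r)"
        unfolding mult.assoc[symmetric] using sum_le tr by (intro mult_right_mono) auto
      finally have pn: "p * real n \<le> 2 * c * (1 + \<tau> * r)" .
      have "(2 * real n + 1) * (2 * p) = 4 * (p * real n) + 2 * p"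
        by (simp add: algebra_simps)
      also have "\<dots> \<le> 8 * c * (1 + \<tau> * r) + c * (1 + \<tau> * r)"
        using pn p mult_left_mono[of 1 "1 + \<tau> * r" c] c tr by linarith
      also have "\<dots> = \<epsilon> / 2"
        using c_eq by simp
      finally have bound1: "(2 * real n + 1) * (2 * p) \<le> \<epsilon> / 2" .
      have D_le: "2 * real D + 1 \<le> (2 * \<tau> * r + 1) * h"
      proof -
        have "real (nat \<lfloor>real H * r\<rfloor>) \<le> real H * r"
          using r by (intro of_nat_floor) auto
        also have "\<dots> \<le> h * r"
          using H(1) K h1 r by (intro mult_right_mono) (auto intro: order_trans mult_right_mono[of K 1 h, simplified])
        finally have "real \<tau> * real (nat \<lfloor>real H * r\<rfloor>) \<le> real \<tau> * (h * r)"
          by (intro mult_left_mono) auto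
        then show ?thesis
          unfolding D_def using h1 by (simp add: algebra_simps)
      qed
      have bound2: "real H * ((2 * real D + 1) * (2 * p)) ^ \<rho> \<le> \<epsilon> / 2"
      proof -
        have "(2 * real D + 1) * (2 * p) \<le> (4 * \<tau> * r + 2) * h * p"
          using mult_right_mono[OF D_le, of "2 * p"] p by (simp add: algebra_simps)
        then have "((2 * real D + 1) * (2 * p)) ^ \<rho> \<le> ((4 * \<tau> * r + 2) * h * p) ^ \<rho>"
          using p by (intro power_mono) auto
        then have "real H * ((2 * real D + 1) * (2 * p)) ^ \<rho> \<le> K * h * ((4 * \<tau> * r + 2) * h * p) ^ \<rho>"
          using H(1) K h1 p by (intro mult_mono) auto
        also have "\<dots> = K * (4 * \<tau> * r + 2) ^ \<rho> * (h ^ (\<rho> + 1) * p ^ \<rho>)"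
          by (simp add: power_mult_distrib)
        also have "\<dots> \<le> \<epsilon> / 2"
          using height_scale_power[OF p(1), of \<rho>] K(3) by (simp add: h_def)
        finally show ?thesis .
      qed
      have "(1 - q) ^ ((2 * X + 1) * H) \<le> exp (- (real ((2 * X + 1) * H) * q))"
        using q by (intro one_minus_power_le_exp) auto
      also have "\<dots> \<le> exp (- (a * (c * K / 2)))"
      proof -
        have "a * (c * K / 2) = (c / p) * (K * h / 2) * q"
          using q(3) p by (simp add: field_simps)
        also have "\<dots> \<le> (2 * real X + 1) * real H * q"
          using X H q h2 cp by (intro mult_right_mono mult_mono) auto
        finally show ?thesis by (simp add: algebra_simps)
      qed
      finally have "(1 - \<epsilon>) * (1 - exp (- (a * (c * K / 2)))) \<le>
          (1 - ((2 * real n + 1) * (2 * p) + real H * ((2 * real D + 1) * (2 * p)) ^ \<rho>)) *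
          (1 - (1 - q) ^ ((2 * X + 1) * H))"
        using bound1 bound2 \<epsilon> a c K by (intro mult_mono) auto
      moreover have "blue_prob ({- int \<tau>..int \<tau>} \<times> {0}) (l1_ball \<rho>) r p q \<le>
          1 - (1 - ((2 * real n + 1) * (2 * p) + real H * ((2 * real D + 1) * (2 * p)) ^ \<rho>)) *
          (1 - (1 - q) ^ ((2 * X + 1) * H))"
        unfolding n_def D_def using p q by (intro blue_prob_le[OF r \<rho>]) auto
      ultimately show ?case
        unfolding q_def by linarith
    qed
  qed
qed

lemma blue_prob_nonneg: "0 \<le> blue_prob B R r p q"
  by (simp add: blue_prob_def)

text \<open>For every \<open>a > 0\<close> the bound
  \<open>1 - (1 - \<epsilon>) * (1 - exp (- (a * \<kappa>)))\<close> is below 1 as soon as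
  \<open>\<epsilon> < 1\<close>, and it tends to \<epsilon> as \<open>a\<close> grows.\<close>

lemma Limsup_blue_prob:
  fixes \<rho> \<tau> :: nat and r :: real
  assumes r: "0 < r" and \<rho>: "1 \<le> \<rho>"
  defines "L \<equiv> \<lambda>a::real. Limsup (at_right 0) (\<lambda>p. ereal
      (blue_prob ({- int \<tau>..int \<tau>} \<times> {0}) (l1_ball \<rho>) r
         p (a * p powr (1 + real \<rho> / (real \<rho> + 1)))))"
  shows "(\<forall>a>0. L a < 1) \<and> (L \<longlongrightarrow> 0) at_top"
proof -
  have bound: "\<exists>\<kappa>>0. \<forall>a>0. L a \<le> ereal (1 - (1 - \<epsilon>) * (1 - exp (- (a * \<kappa>))))"
    if \<epsilon>: "0 < \<epsilon>" "\<epsilon> \<le> 1" for \<epsilon>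
  proof -
    obtain \<kappa> where \<kappa>: "0 < \<kappa>" "\<And>a. 0 < a \<Longrightarrow> \<forall>\<^sub>F p in at_right 0.
        blue_prob ({- int \<tau>..int \<tau>} \<times> {0}) (l1_ball \<rho>) r p (a * p powr (1 + real \<rho> / (real \<rho> + 1)))
        \<le> 1 - (1 - \<epsilon>) * (1 - exp (- (a * \<kappa>)))"
      using eventually_blue_prob_le[OF r \<rho> \<epsilon>, of \<tau>] by blast
    have "L a \<le> ereal (1 - (1 - \<epsilon>) * (1 - exp (- (a * \<kappa>))))" if "0 < a" for a
      unfolding L_def using \<kappa>(2)[OF that] by (intro Limsup_bounded) simp
    then show ?thesis using \<kappa>(1) by blast
  qed
  have nonneg: "0 \<le> L a" for a
    unfolding L_def by (rule le_Limsup) (auto simp: blue_prob_nonneg zero_ereal_def)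
  show ?thesis
  proof (intro conjI allI impI)
    fix a :: real assume a: "0 < a"
    obtain \<kappa> where \<kappa>: "0 < \<kappa>" "L a \<le> ereal (1 - (1 - 1 / 2) * (1 - exp (- (a * \<kappa>))))"
      using bound[of "1 / 2"] a by auto
    have "ereal (1 - (1 - 1 / 2) * (1 - exp (- (a * \<kappa>)))) < 1"
      using a \<kappa>(1) by (simp add: one_ereal_def)
    then show "L a < 1" using \<kappa>(2) by (rule order_le_less_trans[rotated])
  next
    show "(L \<longlongrightarrow> 0) at_top"
    proof (rule order_tendstoI)
      fix u :: ereal assume "u < 0"
      then show "\<forall>\<^sub>F a in at_top. u < L a"
        using nonneg by (auto intro!: always_eventually intro: less_le_trans)
    next
      fix u :: ereal assume "0 < u"
      then obtain e where e: "0 < ereal e" "ereal e < u"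
        using ereal_dense2 by blast
      define \<epsilon> where "\<epsilon> = min 1 (e / 2)"
      have \<epsilon>: "0 < \<epsilon>" "\<epsilon> \<le> 1" "\<epsilon> \<le> e / 2"
        using e by (auto simp: \<epsilon>_def)
      obtain \<kappa> where \<kappa>: "0 < \<kappa>" "\<And>a. 0 < a \<Longrightarrow> L a \<le> ereal (1 - (1 - \<epsilon>) * (1 - exp (- (a * \<kappa>))))"
        using bound[OF \<epsilon>(1,2)] by blast
      have "((\<lambda>a. 1 - (1 - \<epsilon>) * (1 - exp (- (a * \<kappa>)))) \<longlongrightarrow> 1 - (1 - \<epsilon>) * (1 - 0)) at_top"
        using \<kappa>(1) by real_asymp
      then have "\<forall>\<^sub>F a in at_top. 1 - (1 - \<epsilon>) * (1 - exp (- (a * \<kappa>))) < e"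
        by (rule order_tendstoD) (use \<epsilon> e in auto)
      then show "\<forall>\<^sub>F a in at_top. L a < u"
        using eventually_gt_at_top[of 0]
      proof eventually_elim
        case (elim a)
        then have "L a < ereal e"
          using \<kappa>(2)[of a] by (auto intro: order_le_less_trans)
        then show ?case using e(2) by (rule less_trans)
      qed
    qed
  qed
qed

subsection \<open>The probability that a barrier is missing\<close>

lemma Pr_row_blue:
  fixes c :: int
  assumes pq: "0 \<le> p" "0 \<le> q" "p + q \<le> 1"
  shows "Pr p q (\<lambda>\<omega>. \<exists>x\<in>{(c + 2) * int w..<(c + 3) * int w}. fst (\<omega> (x, y)) = Blue) = 1 - (1 - p) ^ w"
proof -
  let ?F = "(\<lambda>x. (x, y)) ` {(c + 2) * int w..<(c + 3) * int w}"
  have "card ?F = card {(c + 2) * int w..<(c + 3) * int w}"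
    by (intro card_image inj_onI) simp
  also have "\<dots> = w"
    by (simp add: algebra_simps)
  finally have card: "card ?F = w" .
  have "Pr p q (\<lambda>\<omega>. \<not> (\<forall>z\<in>?F. fst (\<omega> z) \<noteq> Blue)) = 1 - Pr p q (\<lambda>\<omega>. \<forall>z\<in>?F. fst (\<omega> z) \<noteq> Blue)"
    by (rule Pr_compl[of ?F]) (auto simp: determined_by_def)
  also have "Pr p q (\<lambda>\<omega>. \<forall>z\<in>?F. fst (\<omega> z) \<noteq> Blue) = (1 - p) ^ w"
    using Pr_all_not_blue[OF pq, of ?F] card by simp
  finally show ?thesis by simp
qed

text \<open>The \<open>n\<close> blocks of \<rho> rows use disjoint sites, and \<open>s\<close> lies
  higher than all of them, so \<open>n + 1\<close> independent events are involved.\<close>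

lemma Pr_red_no_barrier:
  assumes pq: "0 \<le> p" "0 \<le> q" "p + q \<le> 1" and \<sigma>: "\<sigma> = 1 \<or> \<sigma> = - 1"
    and s: "int (u + n * \<rho>) < \<bar>snd s\<bar>"
  shows "Pr p q (\<lambda>\<omega>. fst (\<omega> s) = Red \<and> \<not> barrier \<omega> \<rho> w c u n \<sigma>) =
    q * (1 - (1 - (1 - p) ^ w) ^ \<rho>) ^ n"
proof -
  let ?I = "{(c + 2) * int w..<(c + 3) * int w}"
  let ?y = "\<lambda>b k. \<sigma> * int (u + b * \<rho> + 1 + k)"
  let ?row = "\<lambda>b k \<omega>. \<exists>x\<in>?I. fst (\<omega> (x, ?y b k)) = Blue"
  let ?Krow = "\<lambda>b k. ?I \<times> {?y b k}"
  let ?block = "\<lambda>b \<omega>. \<forall>k\<in>{..<\<rho>}. ?row b k \<omega>"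
  let ?Kblock = "\<lambda>b. \<Union>k\<in>{..<\<rho>}. ?Krow b k"
  have det_row: "determined_by (?Krow b k) (?row b k)" for b k
    unfolding determined_by_def by auto
  have det_block: "determined_by (?Kblock b) (?block b)" for b
    by (rule determined_by_ball) (rule det_row)
  \<comment> \<open>Block and offset are the quotient and the remainder of the row number modulo
    \<rho>.\<close>
  have y_inj: "b = b' \<and> k = k'" if "?y b k = ?y b' k'" "k < \<rho>" "k' < \<rho>" for b b' k k'
  proof -
    have eq: "b * \<rho> + k = b' * \<rho> + k'"
      using that(1) \<sigma> by (auto simp del: of_nat_mult of_nat_add)
    have "(b * \<rho> + k) div \<rho> = b" "(b' * \<rho> + k') div \<rho> = b'"
      using that(2,3) by simp_all
    then show ?thesis using eq by auto
  qed
  have Pr_block: "Pr p q (?block b) = (1 - (1 - p) ^ w) ^ \<rho>" for b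
  proof -
    have "Pr p q (?block b) = (\<Prod>k\<in>{..<\<rho>}. Pr p q (?row b k))"
      using y_inj by (intro Pr_independent[where K = "?Krow b"] det_row) (auto simp: disjoint_family_on_def)
    then show ?thesis
      by (simp add: Pr_row_blue[OF pq] del: of_nat_add of_nat_mult)
  qed
  \<comment> \<open>Indices below \<open>n\<close> stand for the blocks, index \<open>n\<close> for
    the red site \<open>s\<close>.\<close>
  let ?K = "\<lambda>j. if j < n then ?Kblock j else {s}"
  let ?P = "\<lambda>j \<omega>. if j < n then \<not> ?block j \<omega> else fst (\<omega> s) = Red"
  have s_notin: "s \<notin> ?Kblock b" if "b < n" for b
  proof
    assume "s \<in> ?Kblock b"
    then obtain k where k: "k < \<rho>" "snd s = ?y b k" by auto
    have "(b + 1) * \<rho> \<le> n * \<rho>"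
      using that by (intro mult_le_mono1) simp
    then have "\<bar>snd s\<bar> \<le> int (u + n * \<rho>)"
      using k \<sigma> by (auto simp: abs_mult algebra_simps simp flip: of_nat_add of_nat_mult)
    then show False using s by simp
  qed
  have "Pr p q (\<lambda>\<omega>. \<forall>j\<in>{..n}. ?P j \<omega>) = (\<Prod>j\<in>{..n}. Pr p q (?P j))"
  proof (rule Pr_independent[where K = ?K])
    show "disjoint_family_on ?K {..n}"
      unfolding disjoint_family_on_def
    proof (intro ballI impI)
      fix i j assume "i \<in> {..n}" "j \<in> {..n}" "i \<noteq> j"
      moreover have "?Kblock i \<inter> ?Kblock j = {}" if "i \<noteq> j"
        using y_inj that by auto
      ultimately show "?K i \<inter> ?K j = {}"
        using s_notin by (cases "i < n"; cases "j < n") auto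
    qed
    show "determined_by (?K j) (?P j)" for j
      using determined_by_not[OF det_block[of j]] determined_by_site[of s "\<lambda>v. fst v = Red"] by simp
  qed simp_all
  also have "\<dots> = q * (\<Prod>j\<in>{..<n}. Pr p q (\<lambda>\<omega>. \<not> ?block j \<omega>))"
    using Pr_site[of p q s "{Red}"] initial_pmf_complement[OF pq]
    by (simp add: lessThan_Suc_atMost[symmetric])
  also have "\<dots> = q * (1 - (1 - (1 - p) ^ w) ^ \<rho>) ^ n"
    using Pr_compl[OF det_block] Pr_block by simp
  also have "(\<lambda>\<omega>. \<forall>j\<in>{..n}. ?P j \<omega>) = (\<lambda>\<omega>. fst (\<omega> s) = Red \<and> \<not> barrier \<omega> \<rho> w c u n \<sigma>)"
    unfolding barrier_def by (intro ext) (auto simp: le_less)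
  finally show ?thesis .
qed

lemma barrier_determined:
  "determined_by ({(c + 2) * int w..<(c + 3) * int w} \<times>
    (\<lambda>(b, k). \<sigma> * int (u + b * \<rho> + 1 + k)) ` ({..<n} \<times> {..<\<rho>})) (\<lambda>\<omega>. barrier \<omega> \<rho> w c u n \<sigma>)"
proof (rule determined_byI)
  fix \<omega> \<omega>' :: sample
  assume eq: "\<And>z. z \<in> {(c + 2) * int w..<(c + 3) * int w} \<times>
    (\<lambda>(b, k). \<sigma> * int (u + b * \<rho> + 1 + k)) ` ({..<n} \<times> {..<\<rho>}) \<Longrightarrow> \<omega> z = \<omega>' z"
  have "\<omega> (x, \<sigma> * int (u + b * \<rho> + 1 + k)) = \<omega>' (x, \<sigma> * int (u + b * \<rho> + 1 + k))"
    if "x \<in> {(c + 2) * int w..<(c + 3) * int w}" "b < n" "k < \<rho>" for x b k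
    by (rule eq) (use that in \<open>auto simp del: of_nat_add of_nat_mult\<close>)
  then show "barrier \<omega> \<rho> w c u n \<sigma> = barrier \<omega>' \<rho> w c u n \<sigma>"
    unfolding barrier_def by (intro ex_cong all_cong conj_cong imp_cong bex_cong refl) simp
qed

text \<open>A union bound over the possible seeds. They occupy \<open>2 * (w + d) + 1\<close>
  columns and at most \<open>2 * d\<close> heights, since \<open>V \<le> H\<close> leaves only
  absolute heights from \<open>H + 1\<close> to \<open>H + d\<close>; all of them lie beyond the
  barrier, so \<open>Pr_red_no_barrier\<close> applies to each.\<close>

lemma near_red_no_barrier:
  fixes w d V H u n \<rho> :: nat
  assumes pq: "0 \<le> p" "0 \<le> q" "p + q \<le> 1" and \<sigma>: "\<sigma> = 1 \<or> \<sigma> = - 1"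
    and H: "u + n * \<rho> \<le> H" "V \<le> H"
  shows "{\<omega>. near_red \<omega> w c d H V \<and> \<not> barrier \<omega> \<rho> w c u n \<sigma>} \<in> sets (sample_measure p q)"
    and "Pr p q (\<lambda>\<omega>. near_red \<omega> w c d H V \<and> \<not> barrier \<omega> \<rho> w c u n \<sigma>) \<le>
      (2 * real (w + d) + 1) * (2 * real d) * (q * (1 - (1 - (1 - p) ^ w) ^ \<rho>) ^ n)"
proof -
  define A where "A = {c * int w - int (w + d)..c * int w + int (w + d)}"
  define B where "B = {int H + 1..int H + int d} \<union> {- int H - int d..- int H - 1}"
  define N where "N = {s \<in> A \<times> B. \<bar>snd s\<bar> \<le> int (V + d)}"
  have N: "near_red \<omega> w c d H V \<longleftrightarrow> (\<exists>s\<in>N. fst (\<omega> s) = Red)" for \<omega>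
  proof -
    have "s \<in> N \<longleftrightarrow> \<bar>fst s - c * int w\<bar> \<le> int (w + d) \<and> int H < \<bar>snd s\<bar> \<and> \<bar>snd s\<bar> \<le> int (V + d)" for s
      using H(2) by (cases s) (auto simp: N_def A_def B_def)
    then show ?thesis unfolding near_red_def by blast
  qed
  have fin: "finite N" by (simp add: N_def A_def B_def)
  have card_A: "card A = 2 * (w + d) + 1"
  proof -
    have "c * int w + int (w + d) - (c * int w - int (w + d)) + 1 = int (2 * (w + d) + 1)" by simp
    then show ?thesis unfolding A_def card_atLeastAtMost_int by (simp only: nat_int)
  qed
  have "card B \<le> card {int H + 1..int H + int d} + card {- int H - int d..- int H - 1}"
    unfolding B_def by (rule card_Un_le)
  then have card_B: "card B \<le> 2 * d" by simp
  have "card N \<le> card (A \<times> B)"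
    by (rule card_mono) (auto simp: N_def A_def B_def)
  also have "\<dots> \<le> (2 * (w + d) + 1) * (2 * d)"
    unfolding card_cartesian_product card_A using card_B by (rule mult_le_mono2)
  finally have card_N: "real (card N) \<le> (2 * real (w + d) + 1) * (2 * real d)"
    unfolding of_nat_le_iff[where 'a = real, symmetric] by (simp add: algebra_simps)
  let ?P = "\<lambda>s \<omega>. fst (\<omega> s) = Red \<and> \<not> barrier \<omega> \<rho> w c u n \<sigma>"
  have sets: "{\<omega>. ?P s \<omega>} \<in> sets (sample_measure p q)" for s
    by (rule sets_determined_by[OF determined_by_conj[OF
        determined_by_site[of s "\<lambda>v. fst v = Red"] determined_by_not[OF barrier_determined]]]) auto
  have eq: "{\<omega>. near_red \<omega> w c d H V \<and> \<not> barrier \<omega> \<rho> w c u n \<sigma>} = {\<omega>. \<exists>s\<in>N. ?P s \<omega>}"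
    using N by auto
  also have "\<dots> = (\<Union>s\<in>N. {\<omega>. ?P s \<omega>})" by auto
  finally show "{\<omega>. near_red \<omega> w c d H V \<and> \<not> barrier \<omega> \<rho> w c u n \<sigma>} \<in> sets (sample_measure p q)"
    using sets fin by (simp only:) (intro sets.finite_UN)
  let ?b = "q * (1 - (1 - (1 - p) ^ w) ^ \<rho>) ^ n"
  have "Pr p q (\<lambda>\<omega>. \<exists>s\<in>N. ?P s \<omega>) \<le> (\<Sum>s\<in>N. Pr p q (?P s))"
    by (rule Pr_bex_le[OF fin sets])
  also have "\<dots> = (\<Sum>s\<in>N. ?b)"
  proof (rule sum.cong[OF refl])
    fix s assume "s \<in> N"
    then have "int H < \<bar>snd s\<bar>" by (auto simp: N_def B_def)
    then have "int (u + n * \<rho>) < \<bar>snd s\<bar>" using H(1) by linarith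
    then show "Pr p q (?P s) = ?b" by (rule Pr_red_no_barrier[OF pq \<sigma>])
  qed
  also have "\<dots> = real (card N) * ?b" by simp
  also have "\<dots> \<le> (2 * real (w + d) + 1) * (2 * real d) * ?b"
  proof (rule mult_right_mono[OF card_N])
    have "(1 - (1 - p) ^ w) ^ \<rho> \<le> 1"
      using pq by (intro power_le_one) (auto intro: power_le_one)
    then show "0 \<le> ?b" using pq by simp
  qed
  finally show "Pr p q (\<lambda>\<omega>. near_red \<omega> w c d H V \<and> \<not> barrier \<omega> \<rho> w c u n \<sigma>) \<le>
      (2 * real (w + d) + 1) * (2 * real d) * ?b"
    unfolding eq .
qed

section \<open>Red in the box, blue in the initial segment, and the union bound\<close>

lemma Pr_red_and_blue:
  assumes pq: "0 \<le> p" "0 \<le> q" "p + q \<le> 1"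
  shows "Pr p q (\<lambda>\<omega>. fst (\<omega> z) = Red \<and> fst (\<omega> z') = Blue) \<le> q * p"
proof (cases "z = z'")
  case True
  then have "{\<omega> :: sample. fst (\<omega> z) = Red \<and> fst (\<omega> z') = Blue} = {}" by auto
  then have "Pr p q (\<lambda>\<omega>. fst (\<omega> z) = Red \<and> fst (\<omega> z') = Blue) = 0"
    by (simp only: measure_empty)
  then show ?thesis using pq by simp
next
  case False
  then have "Pr p q (\<lambda>\<omega>. \<forall>x\<in>{z, z'}. fst (\<omega> x) \<in> (if x = z then {Red} else {Blue})) = q * p"
    using initial_pmf_complement[OF pq] by (subst Pr_cylinder) auto
  then show ?thesis using False by simp
qed

text \<open>Two union bounds, one over single red sites and one over pairs of a red and a blue site.
  The second gains the factor \<open>(n + 1) * p\<close>: with a box of width proportional to the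
  segment, the loss becomes of second order in the length of a short segment, hence small against
  the probability of a blue seed in it even when \<open>a\<close> is large.\<close>

lemma Pr_red_box_and_blue_segment:
  assumes pq: "0 \<le> p" "0 \<le> q" "p + q \<le> 1" and S: "finite S"
  shows "Pr p q (\<lambda>\<omega>. (\<exists>z\<in>S. fst (\<omega> z) = Red) \<and> (\<exists>k\<le>n. fst (\<omega> (int k, 0)) = Blue)) \<le>
    real (card S) * q * min 1 (real (n + 1) * p)"
proof -
  have det_red: "determined_by {z} (\<lambda>\<omega>. fst (\<omega> z) = Red)" for z
    by (rule determined_by_site)
  have det_pair: "determined_by {z, z'} (\<lambda>\<omega>. fst (\<omega> z) = Red \<and> fst (\<omega> z') = Blue)" for z z'
    by (auto simp: determined_by_def)
  have "Pr p q (\<lambda>\<omega>. (\<exists>z\<in>S. fst (\<omega> z) = Red) \<and> (\<exists>k\<le>n. fst (\<omega> (int k, 0)) = Blue))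
      \<le> Pr p q (\<lambda>\<omega>. \<exists>z\<in>S. fst (\<omega> z) = Red)"
    by (rule Pr_mono[where L = S]) (use S in \<open>auto simp: determined_by_def\<close>)
  also have "\<dots> \<le> (\<Sum>z\<in>S. Pr p q (\<lambda>\<omega>. fst (\<omega> z) = Red))"
    by (intro Pr_bex_le S sets_determined_by[OF det_red]) simp
  also have "\<dots> = real (card S) * q"
    using Pr_site[of p q _ "{Red}"] initial_pmf_complement[OF pq] by simp
  finally have bound1: "Pr p q (\<lambda>\<omega>. (\<exists>z\<in>S. fst (\<omega> z) = Red) \<and> (\<exists>k\<le>n. fst (\<omega> (int k, 0)) = Blue))
      \<le> real (card S) * q" .
  have "{\<omega> :: sample. (\<exists>z\<in>S. fst (\<omega> z) = Red) \<and> (\<exists>k\<le>n. fst (\<omega> (int k, 0)) = Blue)}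
      = {\<omega>. \<exists>i\<in>S \<times> {..n}. fst (\<omega> (fst i)) = Red \<and> fst (\<omega> (int (snd i), 0)) = Blue}"
    by (auto simp: Bex_def)
  then have "Pr p q (\<lambda>\<omega>. (\<exists>z\<in>S. fst (\<omega> z) = Red) \<and> (\<exists>k\<le>n. fst (\<omega> (int k, 0)) = Blue))
      = Pr p q (\<lambda>\<omega>. \<exists>i\<in>S \<times> {..n}. fst (\<omega> (fst i)) = Red \<and> fst (\<omega> (int (snd i), 0)) = Blue)"
    by simp
  also have "\<dots> \<le> (\<Sum>i\<in>S \<times> {..n}. Pr p q (\<lambda>\<omega>. fst (\<omega> (fst i)) = Red \<and> fst (\<omega> (int (snd i), 0)) = Blue))"
    by (intro Pr_bex_le sets_determined_by[OF det_pair]) (use S in auto)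
  also have "\<dots> \<le> (\<Sum>i\<in>S \<times> {..n}. q * p)"
    by (intro sum_mono Pr_red_and_blue[OF pq])
  also have "\<dots> = real (card S) * q * (real (n + 1) * p)"
    by (simp add: card_cartesian_product algebra_simps)
  finally have bound2: "Pr p q (\<lambda>\<omega>. (\<exists>z\<in>S. fst (\<omega> z) = Red) \<and> (\<exists>k\<le>n. fst (\<omega> (int k, 0)) = Blue))
      \<le> real (card S) * q * (real (n + 1) * p)" .
  show ?thesis
    using bound1 bound2 by (auto simp: min_def)
qed

lemma Pr_blue_segment:
  assumes pq: "0 \<le> p" "0 \<le> q" "p + q \<le> 1"
  shows "Pr p q (\<lambda>\<omega>. \<exists>k\<le>n. fst (\<omega> (int k, 0)) = Blue) = 1 - (1 - p) ^ (n + 1)"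
proof -
  let ?F = "(\<lambda>k. (int k, 0::int)) ` {..n}"
  have "card ?F = n + 1"
    by (subst card_image) (auto simp: inj_on_def)
  then have "Pr p q (\<lambda>\<omega>. \<not> (\<forall>z\<in>?F. fst (\<omega> z) \<noteq> Blue)) = 1 - (1 - p) ^ (n + 1)"
    using Pr_compl[of ?F "\<lambda>\<omega>. \<forall>z\<in>?F. fst (\<omega> z) \<noteq> Blue" p q] Pr_all_not_blue[OF pq, of ?F]
    by (simp add: determined_by_def)
  moreover have "{\<omega> :: sample. \<exists>k\<le>n. fst (\<omega> (int k, 0)) = Blue} = {\<omega>. \<not> (\<forall>z\<in>?F. fst (\<omega> z) \<noteq> Blue)}"
    by auto
  ultimately show ?thesis by simp
qed

text \<open>Given a blue seed among the first \<open>n + 1\<close> sites of row 0,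
  \<open>blue_survives\<close> can only fail through a red seed in the box or through a window with
  a near red seed but without a barrier.\<close>

lemma blue_prob_ge:
  fixes w nb :: "nat \<Rightarrow> nat" and \<rho> I n H XB :: nat and r :: real
  defines "X \<equiv> \<lambda>i. n + 4 * (\<Sum>j\<in>{i..<I}. w j)"
    and "Y \<equiv> \<lambda>i. \<rho> * (\<Sum>j\<in>{i..<I}. nb j)"
    and "D \<equiv> \<lambda>i. \<rho> * nat \<lfloor>real (4 * w i) / r\<rfloor>"
  assumes r: "0 < r" and pq: "0 \<le> p" "0 \<le> q" "p + q \<le> 1"
    and w: "1 \<le> w 0" "\<And>i. i < I \<Longrightarrow> w i \<le> w (Suc i)" "\<And>i. i < I \<Longrightarrow> D (Suc i) \<le> D i + w i"
    and H: "Y 0 + D 0 \<le> H" and XB: "X 0 + D I \<le> XB" and nI: "n \<le> 4 * w I"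
  shows "1 - (1 - p) ^ (n + 1) - (2 * real XB + 1) * (2 * real H + 1) * q * min 1 (real (n + 1) * p) -
    (\<Sum>i<I. 2 * (2 * (real (X 0) / real (w i)) + 3) * ((2 * real (w i + D (Suc i)) + 1) * (2 * real (D (Suc i))) *
      (q * (1 - (1 - (1 - p) ^ w i) ^ \<rho>) ^ nb i))) \<le> blue_prob {(1, 0)} (l1_ball \<rho>) r p q"
proof -
  define S where "S = {- int XB..int XB} \<times> {- int H..int H}"
  define Cs where "Cs i = {- int ((X (Suc i) + w i) div w i)..int ((X (Suc i) + w i) div w i)}" for i
  define J where "J = (SIGMA i : {..<I}. Cs i \<times> {1, - 1 :: int})"
  let ?fail = "\<lambda>(i, c, \<sigma>) \<omega>. near_red \<omega> (w i) c (D (Suc i)) H (Y (Suc i)) \<and>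
    \<not> barrier \<omega> \<rho> (w i) c (Y (Suc i)) (nb i) \<sigma>"
  let ?seg = "\<lambda>\<omega>. \<exists>k\<le>n. fst (\<omega> (int k, 0)) = Blue"
  let ?red = "\<lambda>\<omega>. \<exists>z\<in>S. fst (\<omega> z) = Red"
  let ?F = "{\<omega>. final_state {(1, 0)} (l1_ball \<rho>) r \<omega> (0, 0) = Blue}"
  let ?b = "\<lambda>i. (2 * real (w i + D (Suc i)) + 1) * (2 * real (D (Suc i))) *
      (q * (1 - (1 - (1 - p) ^ w i) ^ \<rho>) ^ nb i)"
  have w1: "1 \<le> w i" if "i \<le> I" for i
    using that
  proof (induction i)
    case (Suc i)
    then show ?case using w(2)[of i] by linarith
  qed (use w(1) in simp)
  have X_le: "X i \<le> X 0" for i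
    unfolding X_def by (intro add_left_mono mult_le_mono2 sum_mono2) auto
  have Y_le: "Y i \<le> Y 0" for i
    unfolding Y_def by (intro mult_le_mono2 sum_mono2) auto
  have Y_Suc: "Y i = Y (Suc i) + nb i * \<rho>" if "i < I" for i
    using sum.atLeast_Suc_lessThan[OF that, of nb] by (simp add: Y_def algebra_simps)
  have fin_J: "finite J" unfolding J_def Cs_def by (intro finite_SigmaI) auto
  have fin_S: "finite S" by (simp add: S_def)
  have fail: "{\<omega>. ?fail j \<omega>} \<in> sets (sample_measure p q)" "Pr p q (?fail j) \<le> ?b (fst j)" if J: "j \<in> J" for j
  proof -
    obtain i c \<sigma> where j: "j = (i, c, \<sigma>)" "i < I" "\<sigma> = 1 \<or> \<sigma> = - 1"
      using J by (cases j) (auto simp: J_def)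
    have "Y (Suc i) + nb i * \<rho> \<le> H"
      using Y_Suc[OF j(2)] Y_le[of i] H by linarith
    moreover have "Y (Suc i) \<le> H"
      using Y_le[of "Suc i"] H by linarith
    ultimately show "{\<omega>. ?fail j \<omega>} \<in> sets (sample_measure p q)" "Pr p q (?fail j) \<le> ?b (fst j)"
      using near_red_no_barrier[OF pq j(3), of "Y (Suc i)" "nb i" \<rho> H "Y (Suc i)" "w i" c "D (Suc i)"]
      unfolding j(1) by simp_all
  qed
  have det_seg: "determined_by ((\<lambda>k. (int k, 0)) ` {..n}) ?seg"
    unfolding determined_by_def by auto
  have det_red: "determined_by S ?red"
    unfolding determined_by_def by auto
  have sets_red_seg: "{\<omega>. ?red \<omega> \<and> ?seg \<omega>} \<in> sets (sample_measure p q)"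
    by (rule sets_determined_by[OF determined_by_conj[OF det_red det_seg]]) (use fin_S in auto)
  have sets_fail: "{\<omega>. \<exists>j\<in>J. ?fail j \<omega>} \<in> sets (sample_measure p q)"
  proof -
    have "{\<omega>. \<exists>j\<in>J. ?fail j \<omega>} = (\<Union>j\<in>J. {\<omega>. ?fail j \<omega>})" by blast
    then show ?thesis using fail(1) fin_J by (simp only:) (intro sets.finite_UN)
  qed
  have "{\<omega>. ?seg \<omega>} \<subseteq> ?F \<union> ({\<omega>. ?red \<omega> \<and> ?seg \<omega>} \<union> {\<omega>. \<exists>j\<in>J. ?fail j \<omega>})"
  proof (rule subsetI, rule ccontr)
    fix \<omega> :: sample
    assume seg: "\<omega> \<in> {\<omega>. ?seg \<omega>}"
      and notin: "\<omega> \<notin> ?F \<union> ({\<omega>. ?red \<omega> \<and> ?seg \<omega>} \<union> {\<omega>. \<exists>j\<in>J. ?fail j \<omega>})"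
    have "final_state {(1, 0)} (l1_ball \<rho>) r \<omega> (0, 0) = Blue"
    proof (rule blue_survives[OF r, where w = w and nb = nb and I = I and n = n and H = H and XB = XB])
      show "fst (\<omega> (x, y)) \<noteq> Red" if "\<bar>x\<bar> \<le> int XB" "\<bar>y\<bar> \<le> int H" for x y
      proof -
        have "(x, y) \<in> S" using that by (auto simp: S_def)
        then show ?thesis using notin seg by blast
      qed
    next
      fix i c \<sigma> assume i: "i < I" and c: "\<bar>c\<bar> * int (w i) \<le> int (n + 4 * (\<Sum>j\<in>{Suc i..<I}. w j) + w i)"
        and near: "near_red \<omega> (w i) c (\<rho> * nat \<lfloor>real (4 * w (Suc i)) / r\<rfloor>) H (\<rho> * (\<Sum>j\<in>{Suc i..<I}. nb j))"
        and \<sigma>: "\<sigma> = 1 \<or> \<sigma> = (- 1 :: int)"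
      have "0 < int (w i)" using w1[of i] i by simp
      then have "\<bar>c\<bar> \<le> int (X (Suc i) + w i) div int (w i)"
        using zdiv_mono1[OF c, of "int (w i)"] unfolding X_def by simp
      then have "(i, c, \<sigma>) \<in> J"
        using i \<sigma> by (auto simp: J_def Cs_def zdiv_int abs_le_iff)
      then show "barrier \<omega> \<rho> (w i) c (\<rho> * (\<Sum>j\<in>{Suc i..<I}. nb j)) (nb i) \<sigma>"
        using notin near unfolding D_def Y_def by blast
    qed (use w H XB nI seg in \<open>auto simp: X_def Y_def D_def\<close>)
    then show False using notin by blast
  qed
  then have "Pr p q ?seg \<le> sample.prob p q (?F \<union> ({\<omega>. ?red \<omega> \<and> ?seg \<omega>} \<union> {\<omega>. \<exists>j\<in>J. ?fail j \<omega>}))"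
    using sets_final_state sets_red_seg sets_fail by (intro sample.finite_measure_mono sets.Un) auto
  also have "\<dots> \<le> sample.prob p q ?F + sample.prob p q ({\<omega>. ?red \<omega> \<and> ?seg \<omega>} \<union> {\<omega>. \<exists>j\<in>J. ?fail j \<omega>})"
    using sets_final_state sets_red_seg sets_fail by (intro measure_Un_le sets.Un)
  also have "\<dots> \<le> sample.prob p q ?F + (Pr p q (\<lambda>\<omega>. ?red \<omega> \<and> ?seg \<omega>) + Pr p q (\<lambda>\<omega>. \<exists>j\<in>J. ?fail j \<omega>))"
    by (intro add_left_mono measure_Un_le sets_red_seg sets_fail)
  finally have main: "Pr p q ?seg \<le>
      sample.prob p q ?F + (Pr p q (\<lambda>\<omega>. ?red \<omega> \<and> ?seg \<omega>) + Pr p q (\<lambda>\<omega>. \<exists>j\<in>J. ?fail j \<omega>))" .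
  have card_S: "real (card S) = (2 * real XB + 1) * (2 * real H + 1)"
    unfolding S_def card_cartesian_product by simp
  have "Pr p q (\<lambda>\<omega>. \<exists>j\<in>J. ?fail j \<omega>) \<le> (\<Sum>j\<in>J. Pr p q (?fail j))"
    by (rule Pr_bex_le[OF fin_J fail(1)])
  also have "\<dots> \<le> (\<Sum>j\<in>J. ?b (fst j))"
    by (rule sum_mono) (rule fail(2))
  also have "\<dots> = (\<Sum>i<I. \<Sum>j\<in>Cs i \<times> {1, - 1 :: int}. ?b i)"
    unfolding J_def by (subst sum.Sigma) (simp_all add: Cs_def split_def)
  also have "\<dots> = (\<Sum>i<I. real (card (Cs i) * 2) * ?b i)"
    by (simp add: card_cartesian_product)
  also have "\<dots> \<le> (\<Sum>i<I. 2 * (2 * (real (X 0) / real (w i)) + 3) * ?b i)"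
  proof (intro sum_mono mult_right_mono)
    fix i assume i: "i \<in> {..<I}"
    have "(1 - (1 - p) ^ w i) ^ \<rho> \<le> 1"
      using pq by (intro power_le_one) (auto intro: power_le_one)
    then show "0 \<le> ?b i" using pq by simp
    have "real ((X (Suc i) + w i) div w i) \<le> real (X (Suc i) + w i) / real (w i)"
      by (rule of_nat_div_le_of_nat)
    also have "\<dots> \<le> real (X 0) / real (w i) + 1"
      using X_le[of "Suc i"] w1[of i] i by (simp add: field_simps)
    finally show "real (card (Cs i) * 2) \<le> 2 * (2 * (real (X 0) / real (w i)) + 3)"
      unfolding Cs_def by simp
  qed
  finally have fails: "Pr p q (\<lambda>\<omega>. \<exists>j\<in>J. ?fail j \<omega>) \<le> (\<Sum>i<I. 2 * (2 * (real (X 0) / real (w i)) + 3) * ?b i)" .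
  show ?thesis
    using main fails Pr_red_box_and_blue_segment[OF pq fin_S, of n] Pr_blue_segment[OF pq, of n]
    unfolding blue_prob_def card_S by linarith
qed

subsection \<open>The lower bound on blue\<close>

text \<open>\<open>exp y \<ge> 1 + y\<close> gives \<open>1 - exp (- y) \<ge> y / (1 + y)\<close>
  for \<open>y = n * x\<close>, a bound of the right order both for small and for bounded
  \<open>y\<close>.\<close>

lemma blue_in_window_ge:
  fixes x :: real
  assumes "0 \<le> x" "x \<le> 1"
  shows "real n * x / (1 + real n * x) \<le> 1 - (1 - x) ^ n"
proof -
  have nx: "0 \<le> real n * x" using assms by simp
  have "(1 - x) ^ n \<le> exp (- (real n * x))"
    by (rule one_minus_power_le_exp[OF assms])
  also have "\<dots> \<le> 1 / (1 + real n * x)"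
    unfolding exp_minus inverse_eq_divide using exp_ge_add_one_self[of "real n * x"] nx
    by (intro divide_left_mono) auto
  finally have "(1 - x) ^ n \<le> 1 / (1 + real n * x)" .
  moreover have "real n * x / (1 + real n * x) = 1 - 1 / (1 + real n * x)"
    using nx by (simp add: divide_simps)
  ultimately show ?thesis by linarith
qed

text \<open>\<open>x / 3 \<le> exp (x / 3)\<close>, cubed. Degree three is what the sum over scales
  asks for: with \<open>\<gamma> = sqrt g\<close>, the windows times their nearby seeds grow like
  \<open>\<gamma> ^ (2 * i)\<close>, and a missing barrier contributes
  \<open>\<gamma> ^ (3 * i)\<close> in the denominator.\<close>

lemma exp_minus_le_cube:
  fixes x :: real
  assumes "0 < x"
  shows "exp (- x) \<le> 27 / x ^ 3"
proof -
  have "x / 3 \<le> exp (x / 3)"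
    using exp_ge_add_one_self[of "x / 3"] by linarith
  then have "(x / 3) ^ 3 \<le> exp (x / 3) ^ 3"
    using assms by (intro power_mono) auto
  also have "\<dots> = exp x"
    by (simp add: exp_of_nat_mult[symmetric])
  finally have "1 / exp x \<le> 1 / (x ^ 3 / 27)"
    using assms by (intro divide_left_mono) (auto simp: power_divide)
  then show ?thesis by (simp add: exp_minus inverse_eq_divide)
qed

text \<open>\<nu> is a lower bound for the expected number of complete blocks among \<open>V\<close>
  ones; having only \<open>V - 1\<close> of them guaranteed costs the factor \<open>exp 1\<close>.
  The denominator \<open>1 + C1\<close> replaces the \<open>1 + p * w\<close> of
  \<open>blue_in_window_ge\<close>.\<close>

lemma no_barrier_le:
  fixes p C1 V :: real and w nb \<rho> :: nat
  assumes p: "0 < p" "p \<le> 1" and w: "1 \<le> w" "p * real w \<le> C1" and V: "0 < V" "V - 1 \<le> real nb"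
    and \<nu>: "0 < \<nu>" "\<nu> \<le> V * (p * real w / (1 + C1)) ^ \<rho>"
  shows "(1 - (1 - (1 - p) ^ w) ^ \<rho>) ^ nb \<le> 27 * exp 1 / \<nu> ^ 3"
proof -
  define \<theta> where "\<theta> = (p * real w / (1 + C1)) ^ \<rho>"
  have pw: "0 < p * real w" using p w by simp
  have "0 \<le> p * real w / (1 + C1)" "p * real w / (1 + C1) \<le> 1"
    using pw w(2) by (simp_all add: divide_simps)
  then have \<theta>: "0 \<le> \<theta>" "\<theta> \<le> 1"
    unfolding \<theta>_def by - (rule zero_le_power, assumption, rule power_le_one)
  have pos: "0 \<le> 1 - (1 - p) ^ w" "1 - (1 - p) ^ w \<le> 1"
    using p by (auto intro: power_le_one)
  have "p * real w / (1 + C1) \<le> real w * p / (1 + real w * p)"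
    using pw w(2) by (intro frac_le) (auto simp: mult.commute)
  also have "\<dots> \<le> 1 - (1 - p) ^ w"
    using p by (intro blue_in_window_ge) auto
  finally have \<theta>_le: "\<theta> \<le> (1 - (1 - p) ^ w) ^ \<rho>"
    unfolding \<theta>_def using pw w(2) by (intro power_mono) auto
  have "(1 - (1 - (1 - p) ^ w) ^ \<rho>) ^ nb \<le> (1 - \<theta>) ^ nb"
    using \<theta>_le pos by (intro power_mono) (auto intro: power_le_one)
  also have "\<dots> \<le> exp (- (real nb * \<theta>))"
    by (rule one_minus_power_le_exp[OF \<theta>])
  also have "\<dots> \<le> exp (1 - V * \<theta>)"
  proof -
    have "(V - 1) * \<theta> \<le> real nb * \<theta>" using V \<theta> by (intro mult_right_mono)
    then show ?thesis using \<theta> by (simp add: algebra_simps)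
  qed
  also have "\<dots> \<le> exp (1 - \<nu>)"
    using \<nu> by (simp add: \<theta>_def)
  also have "\<dots> = exp 1 * exp (- \<nu>)"
    by (simp add: exp_add[symmetric])
  also have "\<dots> \<le> exp 1 * (27 / \<nu> ^ 3)"
    by (intro mult_left_mono exp_minus_le_cube \<nu>) simp
  finally show ?thesis by (simp add: mult.commute)
qed

text \<open>Between the times \<open>4 * w i\<close> and \<open>4 * w (Suc i)\<close> red travels
  about \<open>4 * \<rho> * (g - 1) / r\<close> window widths, which this \<open>g\<close> makes a
  quarter. The lower bound on \<open>W\<close> lets half a width absorb all rounding.\<close>

lemma window_growth:
  fixes \<rho> :: nat and r W g :: real
  defines "g \<equiv> 1 + r / (16 * real \<rho>)"
  defines "w \<equiv> \<lambda>i. nat \<lfloor>W * g ^ i\<rfloor>"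
  assumes r: "0 < r" and \<rho>: "1 \<le> \<rho>" and W: "2 * (4 * real \<rho> / r + real \<rho> + 1) \<le> W"
  shows "W * g ^ i / 2 \<le> real (w i)" "real (w i) \<le> W * g ^ i" "1 \<le> w i" "w i \<le> w (Suc i)"
    "\<rho> * nat \<lfloor>real (4 * w (Suc i)) / r\<rfloor> \<le> \<rho> * nat \<lfloor>real (4 * w i) / r\<rfloor> + w i"
proof -
  have g: "1 < g" using r \<rho> by (simp add: g_def)
  have "2 * 1 \<le> 2 * (4 * real \<rho> / r + real \<rho> + 1)"
    using r by (intro mult_left_mono) auto
  then have W2: "2 \<le> W" using W by linarith
  define u where "u = W * g ^ i"
  have gi: "1 \<le> g ^ i" using g by (simp add: one_le_power)
  have u: "W \<le> u" using gi W2 mult_left_mono[of 1 "g ^ i" W] by (simp add: u_def)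
  have u_Suc: "W * g ^ Suc i = u + u * r / (16 * real \<rho>)"
    by (simp add: u_def g_def algebra_simps)
  show bounds: "W * g ^ i / 2 \<le> real (w i)" "real (w i) \<le> W * g ^ i"
    using u W2 unfolding w_def u_def[symmetric] by linarith+
  show "1 \<le> w i"
    using bounds(1) u W2 unfolding u_def[symmetric] by linarith
  have "0 \<le> u * r / (16 * real \<rho>)" using u W2 r by simp
  then show "w i \<le> w (Suc i)"
    unfolding w_def u_Suc u_def[symmetric] by (intro nat_mono floor_mono) simp
  have Suc_le: "real (w (Suc i)) \<le> u + u * r / (16 * real \<rho>)"
    unfolding w_def u_Suc using u W2 \<open>0 \<le> u * r / (16 * real \<rho>)\<close> by (intro of_nat_floor) simp
  have w_ge: "u - 1 \<le> real (w i)" "real (w i) \<ge> 0"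
    unfolding w_def u_def[symmetric] by linarith+
  have "real (nat \<lfloor>real (4 * w (Suc i)) / r\<rfloor>) \<le> real (4 * w (Suc i)) / r"
    using r by (intro of_nat_floor) simp
  also have "\<dots> \<le> 4 * (u + u * r / (16 * real \<rho>)) / r"
    unfolding of_nat_mult of_nat_numeral using Suc_le r by (intro divide_right_mono mult_left_mono) auto
  also have "\<dots> = 4 * u / r + u / (4 * real \<rho>)"
    using r \<rho> by (simp add: field_simps)
  finally have upper: "real (nat \<lfloor>real (4 * w (Suc i)) / r\<rfloor>) \<le> 4 * u / r + u / (4 * real \<rho>)" .
  have "4 * u / r - 4 / r - 1 \<le> real (4 * w i) / r - 1"
    using w_ge(1) r by (simp add: divide_simps)
  also have "\<dots> \<le> real (nat \<lfloor>real (4 * w i) / r\<rfloor>)"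
    by linarith
  finally have lower: "4 * u / r - 4 / r - 1 \<le> real (nat \<lfloor>real (4 * w i) / r\<rfloor>)" .
  have "real \<rho> * real (nat \<lfloor>real (4 * w (Suc i)) / r\<rfloor>) \<le> real \<rho> * (4 * u / r + u / (4 * real \<rho>))"
    using upper by (intro mult_left_mono) auto
  also have "\<dots> = real \<rho> * (4 * u / r - 4 / r - 1) + (4 * real \<rho> / r + real \<rho> + u / 4)"
    using \<rho> r by (simp add: field_simps)
  also have "\<dots> \<le> real \<rho> * real (nat \<lfloor>real (4 * w i) / r\<rfloor>) + real (w i)"
  proof (intro add_mono mult_left_mono lower)
    have "2 * (4 * real \<rho> / r + real \<rho> + 1) \<le> 2 * (u / 2)" using order_trans[OF W u] by simp
    then have "4 * real \<rho> / r + real \<rho> + 1 \<le> u / 2" by (rule mult_left_le_imp_le) simp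
    then show "4 * real \<rho> / r + real \<rho> + u / 4 \<le> real (w i)"
      using w_ge(1) u W2 by linarith
  qed simp
  finally show "\<rho> * nat \<lfloor>real (4 * w (Suc i)) / r\<rfloor> \<le> \<rho> * nat \<lfloor>real (4 * w i) / r\<rfloor> + w i"
    unfolding of_nat_mult[symmetric] of_nat_add[symmetric] of_nat_le_iff .
qed

text \<open>Windows grow by the factor \<open>g\<close> per scale while the number of blocks shrinks
  by \<open>sqrt g\<close>. So the total height stays of order \<open>W\<close>, yet the expected
  number of complete blocks, of order \<open>nb i * (p * w i) ^ \<rho>\<close>, grows at least like
  \<open>sqrt g ^ i\<close>. The constants bound a geometric series (\<open>A0\<close>), the
  half-width of the box in units of \<open>C / p\<close> (\<open>A1\<close>), its half-height in
  units of \<open>W\<close> (\<open>A2\<close>), and the red range \<open>D (Suc i)\<close> in units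
  of \<open>W * g ^ i\<close> (\<open>A3\<close>).\<close>

lemma blue_prob_ge_of_scale:
  fixes \<rho> :: nat and r g C1 C K W a p q :: real
  defines "g \<equiv> 1 + r / (16 * real \<rho>)"
  defines "A0 \<equiv> 1 / (1 - 1 / sqrt g)"
    and "A3 \<equiv> 4 * real \<rho> * g / r"
  defines "A1 \<equiv> 1 + 4 * g / (g - 1) + A3" and "A2 \<equiv> real \<rho> * A0 + 4 * real \<rho> / r"
    and "\<mu> \<equiv> 1 / (2 * (1 + C1)) ^ \<rho>"
  assumes r: "0 < r" and \<rho>: "1 \<le> \<rho>" and C: "0 < C" "C \<le> C1" and K: "1 \<le> K" and a: "0 < a"
    and p: "0 < p" "p \<le> 1 / 2" "p \<le> C" and q: "0 < q" "q \<le> 1 / 2"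
    and W: "2 * (4 * real \<rho> / r + real \<rho> + 1) \<le> W" "4 * W + 1 < C / p"
    and scale: "W ^ (\<rho> + 1) * p ^ \<rho> = K ^ (\<rho> + 1)" "q * W = a * K * p"
  shows "C / (1 + C) - 3 * A1 * (2 * A2 + 1) * a * C * K * min 1 (2 * C) -
      648 * exp 1 * A1 * A3 * (3 + 2 * A3) * A0 / \<mu> ^ 3 * a * C / K
    \<le> blue_prob {(1, 0)} (l1_ball \<rho>) r p q"
proof -
  define \<gamma> where "\<gamma> = sqrt g"
  define w where "w i = nat \<lfloor>W * g ^ i\<rfloor>" for i
  define nb where "nb i = nat \<lfloor>W / \<gamma> ^ i\<rfloor>" for i
  define n where "n = nat \<lfloor>C / p\<rfloor>"
  \<comment> \<open>The first scale at which blue has time to cross the segment; thus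
    \<open>W * g ^ I\<close> is of order \<open>C / p\<close>.\<close>
  define I where "I = (LEAST i. n \<le> 4 * w i)"
  define X where "X i = n + 4 * (\<Sum>j\<in>{i..<I}. w j)" for i
  define Y where "Y i = \<rho> * (\<Sum>j\<in>{i..<I}. nb j)" for i
  define D where "D i = \<rho> * nat \<lfloor>real (4 * w i) / r\<rfloor>" for i
  define XB where "XB = X 0 + D I"
  define H where "H = Y 0 + D 0"
  note w = window_growth[OF r \<rho> W(1), folded g_def, folded w_def]
  have g: "1 < g" using r \<rho> by (simp add: g_def)
  have \<gamma>: "1 < \<gamma>" "\<gamma> ^ 2 = g" using g by (simp_all add: \<gamma>_def)
  have A0: "0 < A0" using \<gamma> by (simp add: A0_def \<gamma>_def[symmetric])
  have A3: "0 < A3" using r \<rho> g by (simp add: A3_def)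
  have A1: "1 \<le> A1" using g A3 by (simp add: A1_def)
  have "2 * 1 \<le> 2 * (4 * real \<rho> / r + real \<rho> + 1)"
    using r by (intro mult_left_mono) auto
  then have W2: "2 \<le> W" using W(1) by linarith
  have A2: "0 < A2"
    unfolding A2_def using \<rho> r A0 by (intro add_pos_nonneg mult_pos_pos) auto
  have gi: "1 \<le> g ^ i" and \<gamma>i: "1 \<le> \<gamma> ^ i" for i
    using g \<gamma> by (simp_all add: one_le_power)
  have Wg: "2 \<le> W * g ^ i" for i
    using gi[of i] W2 mult_mono[of 2 W 1 "g ^ i"] by simp
  have Cp: "0 < C / p" using C p by simp
  have n: "real n \<le> C / p" "C / p \<le> real n + 1"
    using Cp unfolding n_def by linarith+
  have ex: "\<exists>i. n \<le> 4 * w i"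
  proof -
    obtain i where "real n < g ^ i"
      using real_arch_pow[OF g] by blast
    moreover have "g ^ i \<le> 4 * real (w i)"
      using w(1)[of i] W2 gi[of i] mult_right_mono[of 2 W "g ^ i"] by linarith
    ultimately have "real n \<le> real (4 * w i)" by simp
    then show ?thesis by (metis of_nat_le_iff)
  qed
  have nI: "n \<le> 4 * w I"
    unfolding I_def by (rule LeastI_ex[OF ex])
  have before: "4 * w i < n" if "i < I" for i
    using not_less_Least[of i "\<lambda>i. n \<le> 4 * w i"] that by (simp add: I_def)
  \<comment> \<open>\<open>4 * W + 1 < C / p\<close> forces at least one scale before
    \<open>I\<close>; minimality of \<open>I\<close> there bounds the last window in
    \<open>WgI\<close>.\<close>
  have "I \<noteq> 0"
  proof
    assume "I = 0"
    then have "real n \<le> real (4 * w 0)" using nI by (metis of_nat_le_iff)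
    then show False using w(2)[of 0] W(2) n by simp
  qed
  then obtain I' where I': "I = Suc I'" by (cases I) auto
  have WgI: "W * g ^ I \<le> g * (C / p)"
  proof -
    have "real (4 * w I') < real n" using before[of I'] I' by simp
    then have "W * g ^ I' \<le> C / p" using w(1)[of I'] n Cp by simp
    then have "g * (W * g ^ I') \<le> g * (C / p)" using g by (intro mult_left_mono) auto
    then show ?thesis unfolding I' power_Suc by (simp only: mult.left_commute)
  qed
  \<comment> \<open>The windows form a geometric series, bounded through its last term by
    \<open>WgI\<close>.\<close>
  have X0: "real (X 0) \<le> (1 + 4 * g / (g - 1)) * (C / p)"
  proof -
    have "(\<Sum>j\<in>{0..<I}. real (w j)) \<le> (\<Sum>j<I. W * g ^ j)"
      unfolding atLeast0LessThan by (intro sum_mono w(2))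
    also have "\<dots> = W * ((g ^ I - 1) / (g - 1))"
      using g by (simp add: sum_distrib_left[symmetric] geometric_sum)
    also have "\<dots> \<le> W * (g ^ I / (g - 1))"
      using g W2 by (intro mult_left_mono divide_right_mono) auto
    also have "\<dots> \<le> g * (C / p) / (g - 1)"
      unfolding times_divide_eq_right using WgI g by (intro divide_right_mono) auto
    finally have "4 * (\<Sum>j\<in>{0..<I}. real (w j)) \<le> 4 * (g * (C / p) / (g - 1))"
      by simp
    moreover have "(1 + 4 * g / (g - 1)) * (C / p) = C / p + 4 * (g * (C / p) / (g - 1))"
      by (simp only: distrib_right mult_1_left times_divide_eq_left times_divide_eq_right
          add_divide_distrib divide_divide_eq_left mult.assoc mult.commute[of p])
    moreover have "real (X 0) = real n + 4 * (\<Sum>j\<in>{0..<I}. real (w j))"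
      by (simp add: X_def)
    ultimately show ?thesis
      using n(1) by linarith
  qed
  have D_le: "real (D i) \<le> 4 * real \<rho> / r * (W * g ^ i)" for i
  proof -
    have "real (nat \<lfloor>real (4 * w i) / r\<rfloor>) \<le> real (4 * w i) / r"
      using r by (intro of_nat_floor) simp
    also have "\<dots> \<le> 4 * (W * g ^ i) / r"
      using w(2)[of i] r by (intro divide_right_mono) auto
    finally have "real \<rho> * real (nat \<lfloor>real (4 * w i) / r\<rfloor>) \<le> real \<rho> * (4 * (W * g ^ i) / r)"
      by (intro mult_left_mono) auto
    then show ?thesis by (simp add: D_def mult_ac)
  qed
  have D_Suc_le: "real (D (Suc i)) \<le> A3 * (W * g ^ i)" for i
    using D_le[of "Suc i"] by (simp add: A3_def mult_ac)
  have XB: "real XB \<le> A1 * (C / p)"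
  proof -
    have "real (D I) \<le> 4 * real \<rho> / r * (g * (C / p))"
      using D_le[of I] WgI r by (meson divide_nonneg_pos mult_left_mono mult_nonneg_nonneg of_nat_0_le_iff
        order_trans zero_le_numeral)
    then have "real (D I) \<le> A3 * (C / p)" by (simp add: A3_def mult_ac)
    then show ?thesis
      using X0 distrib_right[of "1 + 4 * g / (g - 1)" A3 "C / p"]
      unfolding XB_def A1_def of_nat_add by linarith
  qed
  have sum_\<gamma>: "(\<Sum>i<I. (1 / \<gamma>) ^ i) \<le> A0"
  proof -
    have "(\<Sum>i<I. (1 / \<gamma>) ^ i) = (1 - (1 / \<gamma>) ^ I) / (1 - 1 / \<gamma>)"
      using \<gamma> by (simp add: sum_gp_strict)
    also have "\<dots> \<le> 1 / (1 - 1 / \<gamma>)"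
      using \<gamma> by (intro divide_right_mono) auto
    finally show ?thesis by (simp add: A0_def \<gamma>_def)
  qed
  have H: "real H \<le> A2 * W"
  proof -
    have "(\<Sum>j\<in>{0..<I}. real (nb j)) \<le> (\<Sum>j<I. W * (1 / \<gamma>) ^ j)"
      unfolding atLeast0LessThan
    proof (rule sum_mono)
      fix j show "real (nb j) \<le> W * (1 / \<gamma>) ^ j"
        using W2 \<gamma> of_nat_floor[of "W / \<gamma> ^ j"] by (simp add: nb_def power_divide)
    qed
    also have "\<dots> \<le> W * A0"
      unfolding sum_distrib_left[symmetric] using sum_\<gamma> W2 by (intro mult_left_mono) auto
    finally have "real (Y 0) \<le> real \<rho> * (W * A0)"
      unfolding Y_def of_nat_mult of_nat_sum by (intro mult_left_mono) auto
    then show ?thesis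
      using D_le[of 0] by (simp add: H_def A2_def algebra_simps)
  qed
  let ?T = "\<lambda>i. 2 * (2 * (real (X 0) / real (w i)) + 3) * ((2 * real (w i + D (Suc i)) + 1) *
      (2 * real (D (Suc i))) * (q * (1 - (1 - (1 - p) ^ w i) ^ \<rho>) ^ nb i))"
  let ?\<Gamma> = "648 * exp 1 * A1 * A3 * (3 + 2 * A3) / \<mu> ^ 3 * a * C / K"
  have main: "1 - (1 - p) ^ (n + 1) - (2 * real XB + 1) * (2 * real H + 1) * q * min 1 (real (n + 1) * p) -
      (\<Sum>i<I. ?T i) \<le> blue_prob {(1, 0)} (l1_ball \<rho>) r p q"
    unfolding X_def D_def
    by (rule blue_prob_ge[OF r, where H = H and XB = XB])
      (use p q w nI in \<open>auto simp: XB_def H_def X_def Y_def D_def\<close>)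
  have \<mu>: "0 < \<mu>" unfolding \<mu>_def using C by (intro divide_pos_pos zero_less_power) auto
  \<comment> \<open>At scale \<open>i\<close> there are of order \<open>X 0 / u\<close> windows with
    of order \<open>u ^ 2\<close> seed positions each; \<open>t1\<close> to \<open>t4\<close> bound
    the factors one by one.\<close>
  have T: "?T i \<le> ?\<Gamma> * (1 / \<gamma>) ^ i" if i: "i < I" for i
  proof -
    define u where "u = W * g ^ i"
    have u: "2 \<le> u" "u / 2 \<le> real (w i)" "real (w i) \<le> u"
      using Wg[of i] w(1,2)[of i] by (simp_all add: u_def)
    have X0_ge: "4 * real (w i) \<le> real (X 0)"
    proof -
      have "4 * w i \<le> X 0" using before[OF i] by (simp add: X_def)
      then show ?thesis by (metis of_nat_le_iff of_nat_mult of_nat_numeral)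
    qed
    have t1: "2 * (real (X 0) / real (w i)) + 3 \<le> 6 * real (X 0) / u"
    proof -
      have "real (X 0) / real (w i) \<le> real (X 0) / (u / 2)"
        using u by (intro divide_left_mono) auto
      moreover have "3 \<le> 2 * real (X 0) / u"
        using X0_ge u by (simp add: field_simps)
      ultimately show ?thesis by simp
    qed
    have D_u: "real (D (Suc i)) \<le> A3 * u"
      using D_Suc_le[of i] by (simp add: u_def)
    then have t2: "2 * real (w i + D (Suc i)) + 1 \<le> (3 + 2 * A3) * u"
      using u by (simp add: distrib_right)
    have t3: "2 * real (D (Suc i)) \<le> 2 * (A3 * u)"
      using D_u by simp
    have t4: "(1 - (1 - (1 - p) ^ w i) ^ \<rho>) ^ nb i \<le> 27 * exp 1 / (K * \<mu> * \<gamma> ^ i) ^ 3"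
    proof (rule no_barrier_le[where ?C1.0 = C1 and V = "W / \<gamma> ^ i"])
      have "real (4 * w i) < real n" using before[OF i] by (simp only: of_nat_less_iff)
      then have "real (w i) \<le> C / p" using n by simp
      then show "p * real (w i) \<le> C1" using p C(2) by (simp add: field_simps)
      show "W / \<gamma> ^ i - 1 \<le> real (nb i)" unfolding nb_def by linarith
      show "0 < W / \<gamma> ^ i" "0 < K * \<mu> * \<gamma> ^ i" using W2 \<gamma> K \<mu> by auto
      \<comment> \<open>\<open>K \<le> K ^ (\<rho> + 1)\<close>, which the scaling turns into
        \<open>W * (p * W) ^ \<rho>\<close>. Of the two factors \<gamma> in \<open>g\<close>, one is
        spent on the decreasing number of blocks.\<close>
      have "K * \<mu> * \<gamma> ^ i \<le> K ^ (\<rho> + 1) * \<mu> * \<gamma> ^ i"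
        using power_increasing[of 1 "\<rho> + 1" K] K \<mu> \<gamma> by (intro mult_right_mono) auto
      also have "\<dots> = W / \<gamma> ^ i * ((p * W) ^ \<rho> * \<mu> * g ^ i)"
      proof -
        have "g ^ i = \<gamma> ^ i * \<gamma> ^ i"
          unfolding \<gamma>(2)[symmetric] by (simp add: power2_eq_square power_mult_distrib)
        then show ?thesis
          unfolding scale(1)[symmetric] using \<gamma> by (simp add: power_mult_distrib field_simps)
      qed
      also have "\<dots> \<le> W / \<gamma> ^ i * (p * real (w i) / (1 + C1)) ^ \<rho>"
      proof (rule mult_left_mono)
        have "(p * W) ^ \<rho> * \<mu> * g ^ i \<le> (p * W) ^ \<rho> * \<mu> * (g ^ i) ^ \<rho>"
          using power_increasing[of 1 \<rho> "g ^ i"] \<rho> gi[of i] p W2 \<mu> by (intro mult_left_mono) auto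
        also have "\<dots> = (p * (u / 2) / (1 + C1)) ^ \<rho>"
          by (simp add: \<mu>_def u_def power_mult_distrib power_divide)
        also have "\<dots> \<le> (p * real (w i) / (1 + C1)) ^ \<rho>"
          using u p C by (intro power_mono divide_right_mono mult_left_mono) auto
        finally show "(p * W) ^ \<rho> * \<mu> * g ^ i \<le> (p * real (w i) / (1 + C1)) ^ \<rho>" .
      qed (use W2 \<gamma> in simp)
      finally show "K * \<mu> * \<gamma> ^ i \<le> W / \<gamma> ^ i * (p * real (w i) / (1 + C1)) ^ \<rho>" .
    qed (use p w(3) in auto)
    have "(1 - (1 - p) ^ w i) ^ \<rho> \<le> 1"
      using p by (intro power_le_one) (auto intro: power_le_one)
    then have nonneg: "0 \<le> (1 - (1 - (1 - p) ^ w i) ^ \<rho>) ^ nb i" by simp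
    have "?T i \<le> 2 * (6 * real (X 0) / u) * (((3 + 2 * A3) * u) * (2 * (A3 * u)) *
        (q * (27 * exp 1 / (K * \<mu> * \<gamma> ^ i) ^ 3)))"
      using t1 t2 t3 t4 nonneg q u A3 by (intro mult_mono mult_left_mono mult_nonneg_nonneg add_nonneg_nonneg) auto
    \<comment> \<open>\<open>648 = 2 * 6 * 2 * 27\<close>; of \<open>u ^ 2 / u\<close> a single
      \<open>u = W * g ^ i\<close> is left.\<close>
    also have "\<dots> = 648 * exp 1 * A3 * (3 + 2 * A3) * (real (X 0) * (q * W)) * (g ^ i / (K * \<mu> * \<gamma> ^ i) ^ 3)"
    proof -
      have "u \<noteq> 0" using u by simp
      then have "2 * (6 * x / u) * ((s * u) * (2 * (A3 * u)) * (q * (27 * e / Q)))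
          = 648 * e * A3 * s * (x * (q * u) / Q)" for x s e Q :: real
        by simp
      then show ?thesis by (simp add: u_def mult_ac)
    qed
    \<comment> \<open>The cube beats \<open>g ^ i = \<gamma> ^ (2 * i)\<close> and leaves a summable
      factor.\<close>
    also have "g ^ i / (K * \<mu> * \<gamma> ^ i) ^ 3 = 1 / (\<mu> ^ 3 * K ^ 3) * (1 / \<gamma>) ^ i"
    proof -
      have "g ^ i = \<gamma> ^ i * \<gamma> ^ i"
        unfolding \<gamma>(2)[symmetric] by (simp add: power2_eq_square power_mult_distrib)
      then show ?thesis
        using \<gamma> by (simp add: power_mult_distrib power_divide power3_eq_cube)
    qed
    also have "648 * exp 1 * A3 * (3 + 2 * A3) * (real (X 0) * (q * W)) * (1 / (\<mu> ^ 3 * K ^ 3) * (1 / \<gamma>) ^ i)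
        \<le> 648 * exp 1 * A3 * (3 + 2 * A3) * (A1 * (C / p) * (q * W)) * (1 / (\<mu> ^ 3 * K ^ 3) * (1 / \<gamma>) ^ i)"
    proof -
      have "real (X 0) \<le> real XB" by (simp add: XB_def)
      then have "real (X 0) \<le> A1 * (C / p)" using XB by linarith
      then show ?thesis
        using A3 \<mu> K \<gamma> q W2 by (intro mult_right_mono mult_left_mono mult_nonneg_nonneg) auto
    qed
    also have "\<dots> = 648 * exp 1 * A1 * A3 * (3 + 2 * A3) / \<mu> ^ 3 * a * C * (K / K ^ 3) * (1 / \<gamma>) ^ i"
      unfolding scale(2) using p by simp
    also have "\<dots> \<le> 648 * exp 1 * A1 * A3 * (3 + 2 * A3) / \<mu> ^ 3 * a * C * (1 / K) * (1 / \<gamma>) ^ i"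
    proof -
      have "K / K ^ 3 \<le> 1 / K"
        using K by (simp add: power3_eq_cube field_simps)
      then show ?thesis
        using A1 A3 \<mu> a C \<gamma> by (intro mult_right_mono mult_left_mono mult_nonneg_nonneg) auto
    qed
    finally show ?thesis by simp
  qed
  have "(\<Sum>i<I. ?T i) \<le> (\<Sum>i<I. ?\<Gamma> * (1 / \<gamma>) ^ i)"
    using T by (intro sum_mono) auto
  also have "\<dots> \<le> ?\<Gamma> * A0"
    unfolding sum_distrib_left[symmetric] using sum_\<gamma> A1 A3 \<mu> a C K
    by (intro mult_left_mono divide_nonneg_nonneg mult_nonneg_nonneg) auto
  also have "\<dots> = 648 * exp 1 * A1 * A3 * (3 + 2 * A3) * A0 / \<mu> ^ 3 * a * C / K"
    by simp
  finally have fails: "(\<Sum>i<I. ?T i) \<le> 648 * exp 1 * A1 * A3 * (3 + 2 * A3) * A0 / \<mu> ^ 3 * a * C / K" .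
  have "C / (1 + C) \<le> real (n + 1) * p / (1 + real (n + 1) * p)"
  proof -
    have "C \<le> real (n + 1) * p" using n p by (simp add: field_simps)
    then show ?thesis using C by (simp add: divide_simps) (simp add: algebra_simps)
  qed
  also have "\<dots> \<le> 1 - (1 - p) ^ (n + 1)"
    using p by (intro blue_in_window_ge) auto
  finally have first: "C / (1 + C) \<le> 1 - (1 - p) ^ (n + 1)" .
  \<comment> \<open>The box has size of order \<open>C / p\<close> by \<open>W\<close>, and
    \<open>q * W = a * K * p\<close> cancels the \<open>1 / p\<close>. Since \<open>C / p\<close>,
    \<open>A1\<close> and \<open>W\<close> are at least 1, they absorb the additive ones, and
    \<open>(n + 1) * p \<le> C + p \<le> 2 * C\<close>.\<close>
  have second: "(2 * real XB + 1) * (2 * real H + 1) * q * min 1 (real (n + 1) * p) \<le>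
      3 * A1 * (2 * A2 + 1) * a * C * K * min 1 (2 * C)"
  proof -
    have "1 \<le> C / p" using p by simp
    then have "1 \<le> A1 * (C / p)" using A1 mult_mono[of 1 A1 1 "C / p"] by simp
    then have "2 * real XB + 1 \<le> 3 * (A1 * (C / p))" using XB by linarith
    moreover have "2 * real H + 1 \<le> (2 * A2 + 1) * W"
      using H W2 by (simp add: algebra_simps)
    moreover have "real (n + 1) * p \<le> 2 * C"
      using n(1) p by (simp add: field_simps)
    then have "min 1 (real (n + 1) * p) \<le> min 1 (2 * C)" by simp
    ultimately have "(2 * real XB + 1) * (2 * real H + 1) * q * min 1 (real (n + 1) * p) \<le>
        3 * (A1 * (C / p)) * ((2 * A2 + 1) * W) * q * min 1 (2 * C)"
      using A1 A2 C p q W2 by (intro mult_mono mult_nonneg_nonneg) auto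
    also have "\<dots> = 3 * A1 * (2 * A2 + 1) * (C / p) * (q * W) * min 1 (2 * C)"
      by (simp add: mult_ac)
    also have "\<dots> = 3 * A1 * (2 * A2 + 1) * a * C * K * min 1 (2 * C)"
      unfolding scale(2) using p by simp
    finally show ?thesis .
  qed
  show ?thesis
    using main fails first second by linarith
qed

text \<open>\<Gamma> depends on \<rho>, \<open>r\<close> and the upper bound \<open>C1\<close>, but
  not on \<open>C\<close>, \<open>K\<close> and \<open>a\<close>, so these can be chosen after it.
  The smallest window has width of order \<open>W = K * h\<close>.\<close>

lemma eventually_blue_prob_ge:
  fixes \<rho> :: nat and r C1 :: real
  assumes r: "0 < r" and \<rho>: "1 \<le> \<rho>" and C1: "0 < C1"
  obtains \<Gamma> where "0 < \<Gamma>" "\<And>C K a. 0 < C \<Longrightarrow> C \<le> C1 \<Longrightarrow> 1 \<le> K \<Longrightarrow> 0 < a \<Longrightarrow> \<forall>\<^sub>F p in at_right 0.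
    C / (1 + C) - \<Gamma> * a * C * K * min 1 (2 * C) - \<Gamma> * a * C / K \<le>
      blue_prob {(1, 0)} (l1_ball \<rho>) r p (a * p powr (1 + real \<rho> / (real \<rho> + 1)))"
proof -
  define g where "g = 1 + r / (16 * real \<rho>)"
  define A0 where "A0 = 1 / (1 - 1 / sqrt g)"
  define A3 where "A3 = 4 * real \<rho> * g / r"
  define A1 where "A1 = 1 + 4 * g / (g - 1) + A3"
  define A2 where "A2 = real \<rho> * A0 + 4 * real \<rho> / r"
  define \<mu> where "\<mu> = 1 / (2 * (1 + C1)) ^ \<rho>"
  define \<Gamma>1 where "\<Gamma>1 = 3 * A1 * (2 * A2 + 1)"
  define \<Gamma>2 where "\<Gamma>2 = 648 * exp 1 * A1 * A3 * (3 + 2 * A3) * A0 / \<mu> ^ 3"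
  have g: "1 < g" using r \<rho> by (simp add: g_def)
  then have "0 < A0" "0 < A3" using r \<rho> by (simp_all add: A0_def A3_def)
  moreover have "0 < A1" using g \<open>0 < A3\<close> by (simp add: A1_def add_pos_pos)
  moreover have "0 < A2" using r \<rho> \<open>0 < A0\<close> by (simp add: A2_def add_pos_pos)
  moreover have "0 < \<mu>" unfolding \<mu>_def using C1 by (intro divide_pos_pos zero_less_power) auto
  ultimately have \<Gamma>: "0 < \<Gamma>1" "0 < \<Gamma>2" by (simp_all add: \<Gamma>1_def \<Gamma>2_def)
  show ?thesis
  proof (rule that)
    show "0 < max \<Gamma>1 \<Gamma>2" using \<Gamma> by simp
  next
    fix C K a :: real assume C: "0 < C" "C \<le> C1" and K: "1 \<le> K" and a: "0 < a"
    have "\<forall>\<^sub>F p in at_right 0. 2 * (4 * real \<rho> / r + real \<rho> + 1) \<le> height_scale \<rho> p"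
      using height_scale_at_top[OF \<rho>] by (simp add: filterlim_at_top)
    moreover have "\<forall>\<^sub>F p in at_right 0. p * height_scale \<rho> p < C / (8 * K)"
      using order_tendstoD(2)[OF p_height_scale_tendsto, of "C / (8 * K)"] C K by simp
    moreover have "\<forall>\<^sub>F p in at_right (0::real). p < C / 2"
      unfolding eventually_at_right_field using C by (intro exI[of _ "C / 2"]) auto
    ultimately show "\<forall>\<^sub>F p in at_right 0.
        C / (1 + C) - max \<Gamma>1 \<Gamma>2 * a * C * K * min 1 (2 * C) - max \<Gamma>1 \<Gamma>2 * a * C / K \<le>
        blue_prob {(1, 0)} (l1_ball \<rho>) r p (a * p powr (1 + real \<rho> / (real \<rho> + 1)))"
      using eventually_densities[OF a, of \<rho>]
    proof eventually_elim
      case (elim p)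
      define h where "h = height_scale \<rho> p"
      define q where "q = a * p powr (1 + real \<rho> / (real \<rho> + 1))"
      have p: "0 < p" "p \<le> 1 / 2" "p < C / 2" and q: "0 < q" "q \<le> 1 / 2"
        using elim by (simp_all add: q_def)
      have qh: "q * h = a * p"
        using height_scale_red[OF p(1), of a \<rho>] by (simp add: q_def h_def)
      have h_pos: "0 < h" using height_scale_pos[OF p(1)] by (simp add: h_def)
      have "C / (1 + C) - \<Gamma>1 * a * C * K * min 1 (2 * C) - \<Gamma>2 * a * C / K
          \<le> blue_prob {(1, 0)} (l1_ball \<rho>) r p q"
        unfolding \<Gamma>1_def \<Gamma>2_def A1_def A2_def A0_def \<mu>_def A3_def g_def
      proof (rule blue_prob_ge_of_scale[OF r \<rho> C K a _ _ _ q, where W = "K * h"])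
        have "2 * (4 * real \<rho> / r + real \<rho> + 1) \<le> h" using elim by (simp add: h_def)
        also have "h \<le> K * h" using K h_pos by simp
        finally show "2 * (4 * real \<rho> / r + real \<rho> + 1) \<le> K * h" .
        \<comment> \<open>Half of \<open>C / p\<close> covers \<open>4 * (K * h)\<close>, the other
          half covers the summand 1.\<close>
        have "p * h < C / (8 * K)" using elim by (simp add: h_def)
        then have "8 * (K * h) < C / p" using K p by (simp add: field_simps)
        moreover have "2 < C / p" using p by (simp add: field_simps)
        ultimately show "4 * (K * h) + 1 < C / p" by linarith
        show "(K * h) ^ (\<rho> + 1) * p ^ \<rho> = K ^ (\<rho> + 1)"
          using height_scale_power[OF p(1), of \<rho>] by (simp add: power_mult_distrib h_def)
        show "q * (K * h) = a * K * p"
          using qh by (simp add: mult.left_commute mult_ac)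
      qed (use p C in auto)
      moreover have "\<Gamma>1 * (a * C * K * min 1 (2 * C)) \<le> max \<Gamma>1 \<Gamma>2 * (a * C * K * min 1 (2 * C))"
        using a C K by (intro mult_right_mono) auto
      moreover have "\<Gamma>2 * (a * C / K) \<le> max \<Gamma>1 \<Gamma>2 * (a * C / K)"
        using a C K by (intro mult_right_mono) auto
      ultimately show ?case
        unfolding q_def by (simp add: mult.assoc)
    qed
  qed
qed

lemma blue_prob_le_1: "blue_prob B R r p q \<le> 1"
  unfolding blue_prob_def by (rule sample.prob_le_1)

text \<open>The gain \<open>C / (1 + C)\<close> has to beat two losses. For fixed \<open>a\<close>,
  a large \<open>K\<close> makes the barrier loss a small multiple of \<open>C\<close>, and a small
  \<open>C\<close> then does the same for the box loss, which is quadratic in \<open>C\<close>. As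
  \<open>a\<close> tends to 0, a fixed large \<open>C\<close> makes the gain close to 1 while both
  losses vanish.\<close>

lemma Liminf_blue_prob:
  fixes \<rho> :: nat and r :: real
  assumes r: "0 < r" and \<rho>: "1 \<le> \<rho>"
  defines "L \<equiv> \<lambda>a::real. Liminf (at_right 0) (\<lambda>p. ereal
      (blue_prob {(1, 0)} (l1_ball \<rho>) r p (a * p powr (1 + real \<rho> / (real \<rho> + 1)))))"
  shows "(\<forall>a>0. L a > 0) \<and> (L \<longlongrightarrow> 1) (at_right 0)"
proof -
  have bound: "\<exists>\<Gamma>>0. \<forall>C K a. 0 < C \<longrightarrow> C \<le> C1 \<longrightarrow> 1 \<le> K \<longrightarrow> 0 < a \<longrightarrow>
      ereal (C / (1 + C) - \<Gamma> * a * C * K * min 1 (2 * C) - \<Gamma> * a * C / K) \<le> L a"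
    if C1: "0 < C1" for C1
  proof -
    obtain \<Gamma> where \<Gamma>: "0 < \<Gamma>" "\<And>C K a. 0 < C \<Longrightarrow> C \<le> C1 \<Longrightarrow> 1 \<le> K \<Longrightarrow> 0 < a \<Longrightarrow> \<forall>\<^sub>F p in at_right 0.
        C / (1 + C) - \<Gamma> * a * C * K * min 1 (2 * C) - \<Gamma> * a * C / K \<le>
          blue_prob {(1, 0)} (l1_ball \<rho>) r p (a * p powr (1 + real \<rho> / (real \<rho> + 1)))"
      using eventually_blue_prob_ge[OF r \<rho> C1] by blast
    show ?thesis
      unfolding L_def using \<Gamma> by (intro exI[of _ \<Gamma>] conjI allI impI Liminf_bounded) simp_all
  qed
  have le_1: "L a \<le> 1" for a
  proof -
    have "L a \<le> Limsup (at_right 0) (\<lambda>p. ereal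
        (blue_prob {(1, 0)} (l1_ball \<rho>) r p (a * p powr (1 + real \<rho> / (real \<rho> + 1)))))"
      unfolding L_def by (rule Liminf_le_Limsup) simp
    also have "\<dots> \<le> 1"
      by (rule Limsup_bounded) (simp add: blue_prob_le_1 one_ereal_def)
    finally show ?thesis .
  qed
  show ?thesis
  proof (intro conjI allI impI)
    fix a :: real assume a: "0 < a"
    obtain \<Gamma> where \<Gamma>: "0 < \<Gamma>" "\<And>C K. 0 < C \<Longrightarrow> C \<le> 1 \<Longrightarrow> 1 \<le> K \<Longrightarrow>
        ereal (C / (1 + C) - \<Gamma> * a * C * K * min 1 (2 * C) - \<Gamma> * a * C / K) \<le> L a"
      using bound[of 1] a by auto
    \<comment> \<open>\<open>K\<close> brings the barrier loss down to \<open>C / 8\<close>, and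
      \<open>C\<close> then does so for the box loss; the gain is at least \<open>C / 2\<close>
      because \<open>C \<le> 1\<close>.\<close>
    define K where "K = 1 + 8 * \<Gamma> * a"
    define C where "C = 1 / (1 + 16 * (\<Gamma> * a * K))"
    have K: "1 \<le> K" "\<Gamma> * a / K \<le> 1 / 8"
      using \<Gamma>(1) a by (auto simp: K_def divide_simps add_pos_pos)
    have pos: "0 < \<Gamma> * a * K" using \<Gamma>(1) a K by simp
    then have C: "0 < C" "C \<le> 1" "16 * (\<Gamma> * a * K) * C \<le> 1"
      by (auto simp: C_def divide_simps)
    have "C / 2 \<le> C / (1 + C)"
      using C by (intro divide_left_mono) auto
    moreover have "\<Gamma> * a * C * K * min 1 (2 * C) \<le> C / 8"
    proof -
      have "\<Gamma> * a * C * K * min 1 (2 * C) \<le> \<Gamma> * a * C * K * (2 * C)"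
        using pos C \<Gamma>(1) a K by (intro mult_left_mono) auto
      also have "\<dots> = 16 * (\<Gamma> * a * K) * C * (C / 8)" by simp
      also have "\<dots> \<le> 1 * (C / 8)" using C by (intro mult_right_mono) auto
      finally show ?thesis by simp
    qed
    moreover have "\<Gamma> * a * C / K \<le> C / 8"
      using mult_right_mono[OF K(2), of C] C by simp
    ultimately have "0 < C / (1 + C) - \<Gamma> * a * C * K * min 1 (2 * C) - \<Gamma> * a * C / K"
      using C(1) by linarith
    then show "0 < L a"
      using \<Gamma>(2)[OF C(1,2) K(1)] by (meson ereal_less(2) less_le_trans)
  next
    show "(L \<longlongrightarrow> 1) (at_right 0)"
    proof (rule order_tendstoI)
      fix u :: ereal assume "1 < u"
      then show "\<forall>\<^sub>F a in at_right 0. L a < u"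
        using le_1 by (auto intro!: always_eventually intro: le_less_trans)
    next
      fix u :: ereal assume "u < 1"
      then obtain e where e: "u < ereal e" "ereal e < 1"
        using ereal_dense2 by blast
      then have e1: "e < 1" by (simp add: one_ereal_def)
      have "((\<lambda>C::real. C / (1 + C)) \<longlongrightarrow> 1) at_top" by real_asymp
      then have "\<forall>\<^sub>F C in at_top. e < C / (1 + C)"
        using e1 by (rule order_tendstoD)
      then have "\<forall>\<^sub>F C in at_top. e < C / (1 + C) \<and> (0::real) < C"
        using eventually_gt_at_top by (rule eventually_conj)
      then obtain C :: real where C: "e < C / (1 + C)" "0 < C"
        unfolding eventually_at_top_linorder by blast
      obtain \<Gamma> where \<Gamma>: "\<And>a. 0 < a \<Longrightarrow>
          ereal (C / (1 + C) - \<Gamma> * a * C * 1 * min 1 (2 * C) - \<Gamma> * a * C / 1) \<le> L a"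
        using bound[OF C(2)] C(2) by (meson order_refl)
      have "((\<lambda>a. C / (1 + C) - \<Gamma> * a * C * 1 * min 1 (2 * C) - \<Gamma> * a * C / 1) \<longlongrightarrow>
          C / (1 + C) - \<Gamma> * 0 * C * 1 * min 1 (2 * C) - \<Gamma> * 0 * C / 1) (at_right 0)"
        by (intro tendsto_intros) simp
      then have "\<forall>\<^sub>F a in at_right 0. e < C / (1 + C) - \<Gamma> * a * C * 1 * min 1 (2 * C) - \<Gamma> * a * C / 1"
        by (rule order_tendstoD) (use C in simp)
      moreover have "\<forall>\<^sub>F a in at_right (0::real). 0 < a"
        by (simp add: eventually_at_right_less)
      ultimately show "\<forall>\<^sub>F a in at_right 0. u < L a"
      proof eventually_elim
        case (elim a)
        then have "ereal e < L a"
          using \<Gamma>[of a] by (meson less_ereal.simps(1) less_le_trans)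
        then show ?case using e(1) by (rule less_trans[rotated])
      qed
    qed
  qed
qed

theorem theorem1p3:
  fixes \<rho> :: nat and r :: real
  assumes "1 \<le> \<rho>" and "0 < r"
  shows "(\<forall>B p q. finite B \<and> B \<subseteq> UNIV \<times> {0} \<and> (1, 0) \<in> B \<and>
             0 \<le> p \<and> 0 \<le> q \<and> p + q \<le> 1 \<and> \<not> (p = 0 \<and> q = 0) \<longrightarrow>
             (AE \<omega> in sample_measure p q.
                \<forall>x. final_state B (l1_ball \<rho>) r \<omega> x \<in> {Blue, Red}))
    \<and> (\<forall>\<tau>::nat. 1 \<le> \<tau> \<longrightarrow>
         (let L = (\<lambda>a::real. Limsup (at_right 0) (\<lambda>p. ereal
                (blue_prob ({- int \<tau>..int \<tau>} \<times> {0}) (l1_ball \<rho>) r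
                   p (a * p powr (1 + real \<rho> / (real \<rho> + 1))))))
          in (\<forall>a>0. L a < 1) \<and> (L \<longlongrightarrow> 0) at_top))
    \<and> (let L = (\<lambda>a::real. Liminf (at_right 0) (\<lambda>p. ereal
                (blue_prob {(1, 0)} (l1_ball \<rho>) r
                   p (a * p powr (1 + real \<rho> / (real \<rho> + 1))))))
          in (\<forall>a>0. L a > 0) \<and> (L \<longlongrightarrow> 1) (at_right 0))"
proof (intro conjI allI impI)
  fix B :: "site set" and p q :: real
  assume *: "finite B \<and> B \<subseteq> UNIV \<times> {0} \<and> (1, 0) \<in> B \<and>
    0 \<le> p \<and> 0 \<le> q \<and> p + q \<le> 1 \<and> \<not> (p = 0 \<and> q = 0)"
  then have "AE \<omega> in sample_measure p q. \<forall>z. \<exists>k. fst (\<omega> (fst z + int k, snd z)) \<noteq> Empty"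
    by (intro AE_nonempty_right) auto
  then show "AE \<omega> in sample_measure p q. \<forall>x. final_state B (l1_ball \<rho>) r \<omega> x \<in> {Blue, Red}"
  proof eventually_elim
    case (elim \<omega>)
    show ?case
    proof
      fix x :: site
      obtain k where "fst (\<omega> (fst x + int k, snd x)) \<noteq> Empty"
        using elim by blast
      then have "final_state B (l1_ball \<rho>) r \<omega> (fst x, snd x) \<noteq> Empty"
        using * assms by (intro nonempty_if_right_nonempty) auto
      then show "final_state B (l1_ball \<rho>) r \<omega> x \<in> {Blue, Red}"
        by (cases "final_state B (l1_ball \<rho>) r \<omega> x") simp_all
    qed
  qed
next
  fix \<tau> :: nat
  show "let L = (\<lambda>a::real. Limsup (at_right 0) (\<lambda>p. ereal
                (blue_prob ({- int \<tau>..int \<tau>} \<times> {0}) (l1_ball \<rho>) r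
                   p (a * p powr (1 + real \<rho> / (real \<rho> + 1))))))
          in (\<forall>a>0. L a < 1) \<and> (L \<longlongrightarrow> 0) at_top"
    unfolding Let_def by (rule Limsup_blue_prob[OF assms(2,1)])
next
  show "let L = (\<lambda>a::real. Liminf (at_right 0) (\<lambda>p. ereal
                (blue_prob {(1, 0)} (l1_ball \<rho>) r
                   p (a * p powr (1 + real \<rho> / (real \<rho> + 1))))))
          in (\<forall>a>0. L a > 0) \<and> (L \<longlongrightarrow> 1) (at_right 0)"
    unfolding Let_def by (rule Liminf_blue_prob[OF assms(2,1)])
qed

end
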